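(* Let $L/L^{+}$ be a quadratic imaginary (totally imaginary quadratic) extension of a totally real number field, and let $n,k_1,k_2,v$ be positive integers with $k_1,k_2\ge n$ and such that $\frac{|\mu(L)|}{2}\,[\mathcal{O}_{L}^{\times}:\mu(L)\mathcal{O}_{L^{+}}^{\times}]$ divides $v$, where $\mu(L)$ is the set of roots of unity in $L$. Write a polynomial $Q\in\mathcal{Q}_{n,v}(2)$ as $$Q=\sum_{\alpha}C(\alpha)\prod_{j=0}^{n}Q_{j}^{\alpha_{j}},$$ where the sum ranges over tuples $\alpha=(\alpha_{0},\dots,\alpha_{n})\in\mathbb{Z}_{\geq 0}^{n+1}$ with $\sum_{j=0}^{n}\alpha_{j}=v$ and $C(\alpha)\in\mathbb{C}$. Then $Q$ is pluriharmonic, i.e. $Q\in\mathcal{H}_{n,v}(k_{1},k_{2})$, if for every such $\alpha\neq(0,\dots,0,v)$ the following linear relation holds, where $0\le m<n$ denotes the least integer such that $\alpha_m>0$: $$\begin{aligned} 0 ={}& C(\alpha)\,\alpha_{m}(k_{1}+1-n+m) + C(\alpha-1_{m}+1_{m+1})\,(\alpha-1_{m}+1_{m+1})_{m+1}\,(k_{2}-m)\\ &+ C(\alpha)\,\alpha_{m}(\alpha_{m}-1)\\ &+ \sum_{\substack{m<\ell\leq \ell'\leq n\\ \ell+\ell'-m-1\leq n}} C(\tilde{\alpha}(m,\ell,\ell'))\,\tilde{\alpha}(m,\ell,\ell')_{\ell}\,\big(\tilde{\alpha}(m,\ell,\ell')_{\ell'}-\delta_{\ell,\ell'}\big)(2-\delta_{\ell,\ell'})\\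 &- \sum_{\substack{m<\ell\leq \ell'\leq n\\ \ell+\ell'-m\leq n}} C(\alpha(m,\ell,\ell'))\,\alpha(m,\ell,\ell')_{\ell}\,\big(\alpha(m,\ell,\ell')_{\ell'}-\delta_{\ell,\ell'}\big)(2-\delta_{\ell,\ell'}). \end{aligned}$$ In particular, every coefficient $C(\alpha)$ is determined by the value of $C(0,\dots,0,v)$, so there is a unique (up to scaling) pluriharmonic polynomial inside $\mathcal{Q}_{n,v}(2)$; that is, $\mathcal{H}_{n,v}(k_{1},k_{2})$ is one-dimensional over $\mathbb{C}$.
   Context: $\mathcal{Q}_{n,v}(2)$ is the space of complex polynomials $Q(W,Z)$ in the entries of two $n\times n$ matrices $W,Z$ such that $Q(AW\,{}^{t}B,AZ\,{}^{t}B)=\det(A)^{v}\det(B)^{v}Q(W,Z)$ for all $A,B\in\mathrm{GL}(n,\mathbb{C})$, where ${}^{t}B$ is the transpose. The polynomials $Q_0,\dots,Q_n\in\mathcal{Q}_{n,1}(2)$ are defined by $\det(W+\lambda Z)=\sum_{a=0}^{n}Q_{a}(W,Z)\lambda^{a}$. (Every element of $\mathcal{Q}_{n,v}(2)$ is, uniquely, a homogeneous polynomial of degree $v$ in $Q_0,\dots,Q_n$, so the expansion in the claim always exists and its coefficients $C(\alpha)$ are well defined.) With $k=k_1+k_2$, a polynomial $P(X,Y)$ in the entries of $X=(x_{s,u}),Y=(y_{s,u})\in M_{n,k}(\mathbb{C})$ is pluriharmonic if $\sum_{u=1}^{k}\frac{\partial^{2}}{\partial x_{s,u}\partial y_{t,u}}P=0$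 for all $1\le s,t\le n$. $\mathcal{H}_{n,v}(k_{1},k_{2})$ is the subspace of all $Q\in\mathcal{Q}_{n,v}(2)$ such that $Q(X_{1}{}^{t}Y_{1},X_{2}{}^{t}Y_{2})$ is pluriharmonic as a polynomial in the entries of $X=(X_{1},X_{2})$ and $Y=(Y_{1},Y_{2})$, where $X_{i},Y_{i}\in M_{n,k_{i}}$; such a $Q$ is also called pluriharmonic. Notation for tuples: $1_j\in\mathbb{Z}^{n+1}$ ($0\le j\le n$) is the tuple with $1$ in position $j$ and $0$ elsewhere; $(\beta)_j=\beta_j$ is the $j$-th component of a tuple $\beta=(\beta_0,\dots,\beta_n)$; $\delta$ is the Kronecker delta; $\alpha(m,\ell,\ell'):=\alpha-1_{m}+1_{\ell}+1_{\ell'}-1_{\ell+\ell'-m}$ and $\tilde{\alpha}(m,\ell,\ell'):=\alpha-1_{m}+1_{\ell}+1_{\ell'}-1_{\ell+\ell'-m-1}$. By convention $C(\beta)=0$ if $\beta_j<0$ for some $j$. *)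

theory Defs
  imports
    "HOL-Algebra.Algebraic_Closure_Type"
    "HOL-Algebra.Coset"
    "HOL-Library.Function_Algebras"
    "HOL-Analysis.Analysis"
begin

section \<open>The number fields\<close>

text \<open>
  Number fields are subfields of an arbitrary field of characteristic 0, given as a type;
  the library constant \<^const>\<open>ring_of_type_algebra\<close> regards that type as a ring record.
\<close>

abbreviation ambient :: "'a::field_char_0 ring" where
  "ambient \<equiv> ring_of_type_algebra"

definition number_field :: "'a::field_char_0 set \<Rightarrow> bool" where
  "number_field K \<longleftrightarrow> subfield K ambient \<and> ring.finite_dimension ambient \<rat> K"

definition complex_embeddings :: "'a::field_char_0 set \<Rightarrow> ('a \<Rightarrow> complex) set" where
  "complex_embeddings K = ring_hom (ambient\<lparr>carrier := K\<rparr>) ring_of_type_algebra"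

definition totally_real :: "'a::field_char_0 set \<Rightarrow> bool" where
  "totally_real K \<longleftrightarrow> (\<forall>\<sigma> \<in> complex_embeddings K. \<sigma> ` K \<subseteq> \<real>)"

definition totally_imaginary :: "'a::field_char_0 set \<Rightarrow> bool" where
  "totally_imaginary K \<longleftrightarrow> (\<forall>\<sigma> \<in> complex_embeddings K. \<not> \<sigma> ` K \<subseteq> \<real>)"

definition totally_imaginary_quadratic_extension ::
    "'a::field_char_0 set \<Rightarrow> 'a set \<Rightarrow> bool" where
  "totally_imaginary_quadratic_extension L Lp \<longleftrightarrow>
     number_field Lp \<and> totally_real Lp \<and>
     number_field L \<and> totally_imaginary L \<and>
     Lp \<subseteq> L \<and> ring.dimension ambient 2 Lp L"

definition ring_of_integers :: "'a::field_char_0 set \<Rightarrow> 'a set" where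
  "ring_of_integers K = {x \<in> K. algebraic_int x}"

definition unit_group :: "'a::field_char_0 set \<Rightarrow> 'a monoid" where
  "unit_group K = units_of (ambient\<lparr>carrier := ring_of_integers K\<rparr>)"

definition roots_of_unity :: "'a::field_char_0 set \<Rightarrow> 'a set" where
  "roots_of_unity K = {x \<in> K. \<exists>m>0. x ^ m = 1}"

text \<open>
  In the divisibility hypothesis, \<open>card (roots_of_unity L) div 2\<close> is an exact division,
  because \<open>-1\<close> is a root of unity.
\<close>

definition unit_index :: "'a::field_char_0 set \<Rightarrow> 'a set \<Rightarrow> nat" where
  "unit_index L Lp =
     card (rcosets\<^bsub>unit_group L\<^esub> (roots_of_unity L <#>\<^bsub>unit_group L\<^esub> carrier (unit_group Lp)))"


section \<open>Polynomials in the entries of two matrices\<close>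

text \<open>
  Since \<open>\<complex>\<close> is infinite, polynomials in the entries of two matrices are identified with the
  polynomial functions they induce; their partial derivatives are then complex derivatives.
\<close>

inductive matrix_polynomial :: "(complex^'c^'r \<Rightarrow> complex^'c^'r \<Rightarrow> complex) \<Rightarrow> bool" where
  const: "matrix_polynomial (\<lambda>x y. c)"
| entry1: "matrix_polynomial (\<lambda>x y. x $ s $ u)"
| entry2: "matrix_polynomial (\<lambda>x y. y $ s $ u)"
| add: "matrix_polynomial P \<Longrightarrow> matrix_polynomial Q \<Longrightarrow> matrix_polynomial (\<lambda>x y. P x y + Q x y)"
| mult: "matrix_polynomial P \<Longrightarrow> matrix_polynomial Q \<Longrightarrow> matrix_polynomial (\<lambda>x y. P x y * Q x y)"

definition scale_fun :: "complex \<Rightarrow> ('a \<Rightarrow> 'b \<Rightarrow> complex) \<Rightarrow> 'a \<Rightarrow> 'b \<Rightarrow> complex" where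
  "scale_fun c Q = (\<lambda>W Z. c * Q W Z)"

text \<open>The space \<open>\<Q>\<^sub>n\<^sub>,\<^sub>v(2)\<close>, where \<open>n\<close> is the cardinality of the index type \<open>'n\<close>.\<close>

definition invariant_polynomials ::
    "nat \<Rightarrow> (complex^'n^'n \<Rightarrow> complex^'n^'n \<Rightarrow> complex) set" where
  "invariant_polynomials v = {Q. matrix_polynomial Q \<and>
     (\<forall>A B W Z. invertible A \<longrightarrow> invertible B \<longrightarrow>
        Q (A ** W ** transpose B) (A ** Z ** transpose B) = det A ^ v * det B ^ v * Q W Z)}"

text \<open>
  The coefficient \<open>Q\<^sub>a(W, Z)\<close> of \<open>\<lambda>\<^sup>a\<close> in \<open>det (W + \<lambda>Z)\<close>; the determinant is taken over \<open>\<complex>[\<lambda>]\<close>.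
\<close>

definition det_coeff :: "nat \<Rightarrow> complex^'n^'n \<Rightarrow> complex^'n^'n \<Rightarrow> complex" where
  "det_coeff a W Z = Polynomial.coeff (det (\<chi> i j. [:W $ i $ j, Z $ i $ j:])) a"

definition set_entry :: "complex^'c^'r \<Rightarrow> 'r \<Rightarrow> 'c \<Rightarrow> complex \<Rightarrow> complex^'c^'r" where
  "set_entry x s u z = (\<chi> i j. if i = s \<and> j = u then z else x $ i $ j)"

definition partial_deriv ::
    "'r \<Rightarrow> 'c \<Rightarrow> (complex^'c^'r \<Rightarrow> complex) \<Rightarrow> complex^'c^'r \<Rightarrow> complex" where
  "partial_deriv s u F x = deriv (\<lambda>z. F (set_entry x s u z)) (x $ s $ u)"

definition pluriharmonic :: "(complex^'k^'n \<Rightarrow> complex^'k^'n \<Rightarrow> complex) \<Rightarrow> bool" where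
  "pluriharmonic P \<longleftrightarrow> matrix_polynomial P \<and>
     (\<forall>s t x y. (\<Sum>u\<in>UNIV.
        partial_deriv s u (\<lambda>x'. partial_deriv t u (\<lambda>y'. P x' y') y) x) = 0)"

text \<open>
  An \<open>n \<times> (k\<^sub>1 + k\<^sub>2)\<close> matrix has its columns indexed by the sum type \<open>'k1 + 'k2\<close>, and
  \<open>X = (X\<^sub>1, X\<^sub>2)\<close> is the corresponding decomposition into blocks.
\<close>

definition left_block :: "complex^('k1::finite + 'k2::finite)^'n \<Rightarrow> complex^'k1^'n" where
  "left_block x = (\<chi> i u. x $ i $ Inl u)"

definition right_block :: "complex^('k1::finite + 'k2::finite)^'n \<Rightarrow> complex^'k2^'n" where
  "right_block x = (\<chi> i u. x $ i $ Inr u)"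

definition pluriharmonic_polynomials ::
    "nat \<Rightarrow> 'k1::finite itself \<Rightarrow> 'k2::finite itself \<Rightarrow>
      (complex^'n^'n \<Rightarrow> complex^'n^'n \<Rightarrow> complex) set" where
  "pluriharmonic_polynomials v _ _ = {Q \<in> invariant_polynomials v.
     pluriharmonic (\<lambda>(x :: complex^('k1 + 'k2)^'n) y.
       Q (left_block x ** transpose (left_block y)) (right_block x ** transpose (right_block y)))}"


section \<open>The expansion and the linear relations\<close>

text \<open>Tuples \<open>(\<beta>\<^sub>0, \<dots>, \<beta>\<^sub>n)\<close> of integers are functions on \<open>nat\<close> that vanish beyond \<open>n\<close>.\<close>

definition exponents :: "nat \<Rightarrow> nat \<Rightarrow> (nat \<Rightarrow> int) set" where
  "exponents n v =
     {\<alpha>. (\<forall>j\<le>n. 0 \<le> \<alpha> j) \<and> (\<forall>j>n. \<alpha> j = 0) \<and> (\<Sum>j\<le>n. \<alpha> j) = int v}"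

definition unit_tuple :: "nat \<Rightarrow> nat \<Rightarrow> int" where
  "unit_tuple j = (\<lambda>i. if i = j then 1 else 0)"

definition last_exponent :: "nat \<Rightarrow> nat \<Rightarrow> nat \<Rightarrow> int" where
  "last_exponent n v = (\<lambda>j. if j = n then int v else 0)"

definition det_expansion ::
    "nat \<Rightarrow> ((nat \<Rightarrow> int) \<Rightarrow> complex) \<Rightarrow> complex^'n^'n \<Rightarrow> complex^'n^'n \<Rightarrow> complex" where
  "det_expansion v C = (\<lambda>W Z. \<Sum>\<alpha>\<in>exponents CARD('n) v.
     C \<alpha> * (\<Prod>j\<le>CARD('n). det_coeff j W Z ^ nat (\<alpha> j)))"

text \<open>The convention that \<open>C(\<beta>) = 0\<close> as soon as \<open>\<beta>\<close> has a negative component.\<close>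

definition coeff_at :: "((nat \<Rightarrow> int) \<Rightarrow> complex) \<Rightarrow> (nat \<Rightarrow> int) \<Rightarrow> complex" where
  "coeff_at C \<beta> = (if \<exists>j. \<beta> j < 0 then 0 else C \<beta>)"

definition shift :: "(nat \<Rightarrow> int) \<Rightarrow> nat \<Rightarrow> nat \<Rightarrow> nat \<Rightarrow> nat \<Rightarrow> int" where
  "shift \<alpha> m l l' =
     \<alpha> - unit_tuple m + unit_tuple l + unit_tuple l' - unit_tuple (l + l' - m)"

definition shift_tilde :: "(nat \<Rightarrow> int) \<Rightarrow> nat \<Rightarrow> nat \<Rightarrow> nat \<Rightarrow> nat \<Rightarrow> int" where
  "shift_tilde \<alpha> m l l' =
     \<alpha> - unit_tuple m + unit_tuple l + unit_tuple l' - unit_tuple (l + l' - m - 1)"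

definition kronecker :: "nat \<Rightarrow> nat \<Rightarrow> int" where
  "kronecker l l' = (if l = l' then 1 else 0)"

text \<open>The summand shared by the two sums of the relation, at \<open>\<beta> = \<alpha>\<^sup>~(m,l,l')\<close> or \<open>\<alpha>(m,l,l')\<close>.\<close>

definition relation_term ::
    "((nat \<Rightarrow> int) \<Rightarrow> complex) \<Rightarrow> (nat \<Rightarrow> int) \<Rightarrow> nat \<Rightarrow> nat \<Rightarrow> complex" where
  "relation_term C \<beta> l l' =
     coeff_at C \<beta> * of_int (\<beta> l * (\<beta> l' - kronecker l l') * (2 - kronecker l l'))"

definition linear_relation ::
    "nat \<Rightarrow> nat \<Rightarrow> nat \<Rightarrow> ((nat \<Rightarrow> int) \<Rightarrow> complex) \<Rightarrow> (nat \<Rightarrow> int) \<Rightarrow> bool" where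
  "linear_relation n k1 k2 C \<alpha> \<longleftrightarrow>
     (let m = (LEAST j. \<alpha> j > 0);
          \<beta> = \<alpha> - unit_tuple m + unit_tuple (m + 1)
      in 0 = coeff_at C \<alpha> * of_int (\<alpha> m * (int k1 + 1 - int n + int m))
           + coeff_at C \<beta> * of_int (\<beta> (m + 1) * (int k2 - int m))
           + coeff_at C \<alpha> * of_int (\<alpha> m * (\<alpha> m - 1))
           + (\<Sum>(l, l') \<in> {(l, l'). m < l \<and> l \<le> l' \<and> l' \<le> n \<and> l + l' - m - 1 \<le> n}.
                relation_term C (shift_tilde \<alpha> m l l') l l')
           - (\<Sum>(l, l') \<in> {(l, l'). m < l \<and> l \<le> l' \<and> l' \<le> n \<and> l + l' - m \<le> n}.
                relation_term C (shift \<alpha> m l l') l l'))"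

definition satisfies_relations ::
    "nat \<Rightarrow> nat \<Rightarrow> nat \<Rightarrow> nat \<Rightarrow> ((nat \<Rightarrow> int) \<Rightarrow> complex) \<Rightarrow> bool" where
  "satisfies_relations n k1 k2 v C \<longleftrightarrow>
     (\<forall>\<alpha> \<in> exponents n v. \<alpha> \<noteq> last_exponent n v \<longrightarrow> linear_relation n k1 k2 C \<alpha>)"

end

theory Submission
  imports Defs
begin

text \<open>
  Let \<open>g\<^sub>m(s, t)\<close> be the coefficient of \<open>\<lambda>\<^sup>m\<close> in the cofactor \<open>(s, t)\<close> of \<open>W + \<lambda>Z\<close>. Pushed down to the variables
  \<open>(W, Z) = (X\<^sub>1 Y\<^sub>1\<^sup>t, X\<^sub>2 Y\<^sub>2\<^sup>t)\<close>, the Laplacian \<open>\<Delta>\<^sub>s\<^sub>t\<close> becomes a second order operator \<open>D\<^sub>s\<^sub>t\<close>, and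
  \<open>D\<^sub>s\<^sub>t F(Q\<^sub>0, \<dots>, Q\<^sub>n) = \<Sum>\<^sub>m g\<^sub>m(s, t) R\<^sub>m(F)(Q\<^sub>0, \<dots>, Q\<^sub>n)\<close> with second order operators \<open>R\<^sub>0, \<dots>, R\<^sub>n\<^sub>-\<^sub>1\<close> in \<open>n + 1\<close>
  variables. On companion pencils the \<open>Q\<^sub>a\<close> are arbitrary and the \<open>g\<^sub>m\<close> independent, so \<open>F(Q\<^sub>0, \<dots>, Q\<^sub>n)\<close> is
  pluriharmonic iff all \<open>R\<^sub>m(F)\<close> vanish; the coefficient of \<open>R\<^sub>m(F)\<close> at \<open>\<alpha> - 1\<^sub>m\<close>, for \<open>m\<close> least with \<open>\<alpha>\<^sub>m > 0\<close>,
  is the stated relation. These relations are triangular with nonzero diagonal, which gives uniqueness.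

  For existence, \<open>E = \<Sum>\<^sub>s\<^sub>t (W + Z)\<^sub>s\<^sub>t D\<^sub>s\<^sub>t\<close> preserves the span of the monomials of degree \<open>v\<close> in the \<open>Q\<^sub>a\<close>, and its
  values vanish at \<open>(1, -1)\<close>; so it is not onto and has a nonzero kernel. As multiplication by \<open>(X Y\<^sup>t)\<^sub>s\<^sub>t\<close> is
  adjoint to \<open>\<Delta>\<^sub>s\<^sub>t\<close> for the Fischer inner product, \<open>E Q = 0\<close> forces every \<open>D\<^sub>s\<^sub>t Q\<close> to vanish. Adjointness also
  shows that a pluriharmonic \<open>Q\<close> in the ideal generated by the entries of \<open>W + Z\<close> is zero. Since
  \<open>Q(W, -W) = det(W)\<^sup>v Q(1, -1)\<close>, a pluriharmonic \<open>Q\<close> is determined by \<open>Q(1, -1)\<close>, so the space is a line.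
  Given any solution of the relations, uniqueness makes it a multiple of the one found in the kernel of \<open>E\<close>.
\<close>

section \<open>Polynomial functions of several complex variables\<close>

text \<open>\<open>S\<close> bounds the variables that occur. It is \<open>{..n}\<close> for
  polynomials in Q_0, ..., Q_n, whose index type \<open>nat\<close> is infinite, and
  \<open>UNIV\<close> for polynomials in matrix entries.\<close>

inductive poly_fun :: "'i set \<Rightarrow> (('i \<Rightarrow> complex) \<Rightarrow> complex) \<Rightarrow> bool" for S where
  const: "poly_fun S (\<lambda>z. c)"
| coord: "i \<in> S \<Longrightarrow> poly_fun S (\<lambda>z. z i)"
| add: "poly_fun S f \<Longrightarrow> poly_fun S g \<Longrightarrow> poly_fun S (\<lambda>z. f z + g z)"
| mult: "poly_fun S f \<Longrightarrow> poly_fun S g \<Longrightarrow> poly_fun S (\<lambda>z. f z * g z)"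

definition pd :: "'i \<Rightarrow> (('i \<Rightarrow> complex) \<Rightarrow> complex) \<Rightarrow> ('i \<Rightarrow> complex) \<Rightarrow> complex" where
  "pd i f z = deriv (\<lambda>w. f (z(i := w))) (z i)"

lemma poly_fun_sum:
  "(\<And>x. x \<in> A \<Longrightarrow> poly_fun S (f x)) \<Longrightarrow> poly_fun S (\<lambda>z. \<Sum>x\<in>A. f x z)"
  by (induction A rule: infinite_finite_induct) (auto intro: poly_fun.intros)

lemma poly_fun_prod:
  "(\<And>x. x \<in> A \<Longrightarrow> poly_fun S (f x)) \<Longrightarrow> poly_fun S (\<lambda>z. \<Prod>x\<in>A. f x z)"
  by (induction A rule: infinite_finite_induct) (auto intro: poly_fun.intros)

lemma poly_fun_power: "poly_fun S f \<Longrightarrow> poly_fun S (\<lambda>z. f z ^ k)"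
  by (induction k) (auto intro: poly_fun.intros)

lemma poly_fun_compose:
  assumes "poly_fun S f" and "\<And>i. i \<in> S \<Longrightarrow> poly_fun T (p i)"
  shows "poly_fun T (\<lambda>z. f (\<lambda>i. p i z))"
  using assms by (induction) (auto intro: poly_fun.intros)

lemma poly_fun_differentiable:
  "poly_fun S f \<Longrightarrow> (\<lambda>w. f (z(i := w))) field_differentiable at w"
proof (induction rule: poly_fun.induct)
  case (coord j)
  then show ?case by (cases "i = j") (auto intro!: derivative_intros)
qed (auto intro!: derivative_intros)

lemma pd_const [simp]: "pd i (\<lambda>z. c) = (\<lambda>z. 0)"
  by (auto simp: pd_def)

lemma pd_coord [simp]: "pd i (\<lambda>z. z j) = (\<lambda>z. if i = j then 1 else 0)"
  by (auto simp: pd_def)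

lemma pd_add:
  assumes "poly_fun S f" "poly_fun S g"
  shows "pd i (\<lambda>z. f z + g z) = (\<lambda>z. pd i f z + pd i g z)"
  unfolding pd_def
  by (intro ext deriv_add assms[THEN poly_fun_differentiable])

lemma pd_mult:
  assumes "poly_fun S f" "poly_fun S g"
  shows "pd i (\<lambda>z. f z * g z) = (\<lambda>z. f z * pd i g z + pd i f z * g z)"
  unfolding pd_def
  by (rule ext, subst deriv_mult) (auto intro: assms[THEN poly_fun_differentiable])

lemma pd_sum:
  assumes "\<And>x. x \<in> A \<Longrightarrow> poly_fun S (f x)"
  shows "pd i (\<lambda>z. \<Sum>x\<in>A. f x z) = (\<lambda>z. \<Sum>x\<in>A. pd i (f x) z)"
  using assms
proof (induction A rule: infinite_finite_induct)
  case (insert x A)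
  then show ?case by (simp add: pd_add[of S] poly_fun_sum)
qed auto

lemma pd_cmult:
  assumes "poly_fun S f"
  shows "pd i (\<lambda>z. c * f z) = (\<lambda>z. c * pd i f z)"
  using pd_mult[OF poly_fun.const assms, of i c] by simp

lemma poly_fun_pd: "poly_fun S f \<Longrightarrow> poly_fun S (pd i f)"
proof (induction rule: poly_fun.induct)
  case (mult f g)
  then show ?case by (simp add: pd_mult[OF mult(1,2)] poly_fun.intros)
next
  case (add f g)
  then show ?case by (simp add: pd_add[OF add(1,2)] poly_fun.intros)
qed (auto intro: poly_fun.intros)

text \<open>The chain rule follows the way \<open>f\<close> is built from constants, coordinates,
  sums and products, so one-variable derivatives suffice.\<close>

lemma pd_compose:
  assumes "poly_fun S f" and "finite S" and p: "\<And>i. i \<in> S \<Longrightarrow> poly_fun T (p i)"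
  shows "pd j (\<lambda>z. f (\<lambda>i. p i z)) = (\<lambda>z. \<Sum>i\<in>S. pd i f (\<lambda>i. p i z) * pd j (p i) z)"
  using assms(1)
proof (induction rule: poly_fun.induct)
  case (const c)
  then show ?case by simp
next
  case (coord i)
  then show ?case using \<open>finite S\<close>
    by (intro ext) (simp add: if_distrib[of "\<lambda>x. x * _"] sum.If_cases Int_absorb1 cong: if_cong)
next
  case (add f g)
  show ?case
    by (intro ext)
       (simp add: pd_add[OF add(1,2)] add.IH sum.distrib algebra_simps
          pd_add[OF poly_fun_compose[OF add(1) p] poly_fun_compose[OF add(2) p]])
next
  case (mult f g)
  show ?case
    by (intro ext)
       (simp add: pd_mult[OF mult(1,2)] mult.IH sum.distrib algebra_simps sum_distrib_left
          pd_mult[OF poly_fun_compose[OF mult(1) p] poly_fun_compose[OF mult(2) p]])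
qed

text \<open>Applied to two substitutions: Gram matrices for (W, Z), and the Q_a for their variables.
  The first sum collects second derivatives of the inner functions, the second becomes the new
  second order part.\<close>

lemma pd_pd_compose:
  assumes f: "poly_fun S f" and "finite S" and p: "\<And>i. i \<in> S \<Longrightarrow> poly_fun T (p i)"
  shows "pd j (pd k (\<lambda>z. f (\<lambda>i. p i z))) z =
    (\<Sum>a\<in>S. pd a f (\<lambda>i. p i z) * pd j (pd k (p a)) z) +
    (\<Sum>a\<in>S. \<Sum>b\<in>S. pd b (pd a f) (\<lambda>i. p i z) * (pd j (p b) z * pd k (p a) z))"
proof -
  have 1: "pd k (\<lambda>z. f (\<lambda>i. p i z)) = (\<lambda>z. \<Sum>a\<in>S. pd a f (\<lambda>i. p i z) * pd k (p a) z)"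
    by (rule pd_compose[OF f \<open>finite S\<close> p])
  have 2: "poly_fun T (\<lambda>z. pd a f (\<lambda>i. p i z))" for a
    by (rule poly_fun_compose[OF poly_fun_pd[OF f] p])
  have 3: "pd j (\<lambda>z. pd a f (\<lambda>i. p i z)) = (\<lambda>z. \<Sum>b\<in>S. pd b (pd a f) (\<lambda>i. p i z) * pd j (p b) z)" for a
    by (rule pd_compose[OF poly_fun_pd[OF f] \<open>finite S\<close> p])
  have "pd j (pd k (\<lambda>z. f (\<lambda>i. p i z))) z =
     (\<Sum>a\<in>S. pd j (\<lambda>z. pd a f (\<lambda>i. p i z) * pd k (p a) z) z)"
    unfolding 1
    by (subst pd_sum[where S = T]) (auto intro!: poly_fun.mult 2 poly_fun_pd p)
  also have "\<dots> = (\<Sum>a\<in>S. pd a f (\<lambda>i. p i z) * pd j (pd k (p a)) z +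
      (\<Sum>b\<in>S. pd b (pd a f) (\<lambda>i. p i z) * pd j (p b) z) * pd k (p a) z)"
  proof (rule sum.cong[OF refl])
    fix a assume "a \<in> S"
    show "pd j (\<lambda>z. pd a f (\<lambda>i. p i z) * pd k (p a) z) z = 
      pd a f (\<lambda>i. p i z) * pd j (pd k (p a)) z +
      (\<Sum>b\<in>S. pd b (pd a f) (\<lambda>i. p i z) * pd j (p b) z) * pd k (p a) z"
      by (subst pd_mult[of T])
        (auto intro!: 2 poly_fun_pd p \<open>a \<in> S\<close> simp: 3)
  qed
  also have "\<dots> = (\<Sum>a\<in>S. pd a f (\<lambda>i. p i z) * pd j (pd k (p a)) z) +
    (\<Sum>a\<in>S. \<Sum>b\<in>S. pd b (pd a f) (\<lambda>i. p i z) * (pd j (p b) z * pd k (p a) z))"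
    by (simp add: sum.distrib sum_distrib_right mult.assoc)
  finally show ?thesis .
qed

section \<open>Coefficients and the Fischer inner product\<close>

text \<open>The formal side: coefficient families indexed by exponents, evaluated by
  \<open>ev\<close>, with \<open>dX\<close> and \<open>mX\<close> as derivation and multiplication
  by a variable. Comparison of coefficients and the Fischer product take place here.\<close>

definition monv :: "'i set \<Rightarrow> ('i \<Rightarrow> nat) \<Rightarrow> ('i \<Rightarrow> complex) \<Rightarrow> complex" where
  "monv S a z = (\<Prod>i\<in>S. z i ^ a i)"

definition coefs :: "'i set \<Rightarrow> (('i \<Rightarrow> nat) \<Rightarrow> complex) \<Rightarrow> bool" where
  "coefs S c \<longleftrightarrow> finite {a. c a \<noteq> 0} \<and> (\<forall>a i. c a \<noteq> 0 \<longrightarrow> i \<notin> S \<longrightarrow> a i = 0)"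

definition ev :: "'i set \<Rightarrow> (('i \<Rightarrow> nat) \<Rightarrow> complex) \<Rightarrow> ('i \<Rightarrow> complex) \<Rightarrow> complex" where
  "ev S c z = (\<Sum>a | c a \<noteq> 0. c a * monv S a z)"

definition inc :: "'i \<Rightarrow> ('i \<Rightarrow> nat) \<Rightarrow> 'i \<Rightarrow> nat" where
  "inc i a = a(i := Suc (a i))"

definition dX :: "'i \<Rightarrow> (('i \<Rightarrow> nat) \<Rightarrow> complex) \<Rightarrow> ('i \<Rightarrow> nat) \<Rightarrow> complex" where
  "dX i c a = of_nat (Suc (a i)) * c (inc i a)"

definition mX :: "'i \<Rightarrow> (('i \<Rightarrow> nat) \<Rightarrow> complex) \<Rightarrow> ('i \<Rightarrow> nat) \<Rightarrow> complex" where
  "mX i c a = (if a i = 0 then 0 else c (a(i := a i - 1)))"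

lemma inj_inc: "inj (inc i)"
proof (rule injI)
  fix a b :: "'a \<Rightarrow> nat" assume "inc i a = inc i b"
  hence "inc i a j = inc i b j" for j by simp
  thus "a = b" by (simp add: inc_def fun_eq_iff) (metis nat.inject)
qed

lemma supp_dX: "{a. dX i c a \<noteq> 0} = inc i -` {a. c a \<noteq> 0}"
  by (auto simp: dX_def simp del: of_nat_Suc)

lemma supp_mX: "{a. mX i c a \<noteq> 0} = inc i ` {a. c a \<noteq> 0}"
proof -
  have "a = inc i (a(i := a i - 1))" if "a i \<noteq> 0" for a
    using that by (auto simp: inc_def fun_eq_iff)
  thus ?thesis
    by (auto simp: mX_def inc_def split: if_splits intro!: image_eqI)
qed

lemma mX_inc [simp]: "mX i c (inc i a) = c a"
  by (simp add: mX_def inc_def)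

lemma coefs_zero_outside: "coefs S c \<Longrightarrow> c a \<noteq> 0 \<Longrightarrow> i \<notin> S \<Longrightarrow> a i = 0"
  by (simp add: coefs_def)

lemma coefs_dX:
  assumes "coefs S c" shows "coefs S (dX i c)"
proof -
  have "a j = 0" if "c (inc i a) \<noteq> 0" "j \<notin> S" for a j
    using assms that by (auto simp: coefs_def inc_def split: if_splits dest!: spec[of _ "a(i := Suc (a i))"])
  moreover have "finite (inc i -` {a. c a \<noteq> 0})"
    using assms inj_inc[of i] by (intro finite_vimageI) (auto simp: coefs_def)
  moreover have "c (inc i a) \<noteq> 0" if "dX i c a \<noteq> 0" for a
    using that by (auto simp: dX_def)
  ultimately show ?thesis unfolding coefs_def supp_dX by blast
qed

lemma coefs_mX:
  assumes "coefs S c" "i \<in> S" shows "coefs S (mX i c)"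
proof -
  have "inc i a j = 0" if "c a \<noteq> 0" "j \<notin> S" for a j
    using assms that by (auto simp: coefs_def inc_def)
  moreover have "finite (inc i ` {a. c a \<noteq> 0})"
    using assms by (auto simp: coefs_def)
  moreover have "mX i c a \<noteq> 0 \<longleftrightarrow> a \<in> inc i ` {a. c a \<noteq> 0}" for a
    unfolding supp_mX[symmetric] by simp
  ultimately show ?thesis unfolding coefs_def supp_mX by auto
qed

lemma coefs_add: "coefs S c \<Longrightarrow> coefs S d \<Longrightarrow> coefs S (\<lambda>a. c a + d a)"
  unfolding coefs_def
  by (auto intro: finite_subset[of _ "{a. c a \<noteq> 0} \<union> {a. d a \<noteq> 0}"]) (metis add_0)

lemma coefs_cmult: "coefs S c \<Longrightarrow> coefs S (\<lambda>a. k * c a)"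
  unfolding coefs_def
  by (auto intro: finite_subset[of _ "{a. c a \<noteq> 0}"])

lemma coefs_0: "coefs S (\<lambda>a. 0)"
  by (simp add: coefs_def)

lemma coefs_sum: "(\<And>x. x \<in> A \<Longrightarrow> coefs S (c x)) \<Longrightarrow> coefs S (\<lambda>a. \<Sum>x\<in>A. c x a)"
  by (induction A rule: infinite_finite_induct) (auto intro: coefs_add coefs_0)

lemma ev_superset:
  "finite A \<Longrightarrow> {a. c a \<noteq> 0} \<subseteq> A \<Longrightarrow> ev S c z = (\<Sum>a\<in>A. c a * monv S a z)"
  unfolding ev_def by (rule sum.mono_neutral_left) auto

lemma ev_add:
  assumes "coefs S c" "coefs S d"
  shows "ev S (\<lambda>a. c a + d a) z = ev S c z + ev S d z"
proof -
  let ?A = "{a. c a \<noteq> 0} \<union> {a. d a \<noteq> 0}"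
  have "finite ?A" using assms by (simp add: coefs_def)
  thus ?thesis
    by (subst (1 2 3) ev_superset[of ?A]) (auto simp: sum.distrib algebra_simps)
qed

lemma ev_cmult:
  assumes "coefs S c" shows "ev S (\<lambda>a. k * c a) z = k * ev S c z"
proof -
  have "finite {a. c a \<noteq> 0}" using assms by (simp add: coefs_def)
  thus ?thesis
    by (subst (1 2) ev_superset[of "{a. c a \<noteq> 0}"]) (auto simp: sum_distrib_left mult.assoc)
qed

lemma ev_0 [simp]: "ev S (\<lambda>a. 0) z = 0"
  by (simp add: ev_def)

lemma ev_sum:
  "(\<And>x. x \<in> A \<Longrightarrow> coefs S (c x)) \<Longrightarrow> ev S (\<lambda>a. \<Sum>x\<in>A. c x a) z = (\<Sum>x\<in>A. ev S (c x) z)"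
  by (induction A rule: infinite_finite_induct) (auto simp: ev_add coefs_sum)

lemma monv_inc: "finite S \<Longrightarrow> i \<in> S \<Longrightarrow> monv S (inc i a) z = z i * monv S a z"
  by (simp add: monv_def inc_def prod.remove[of S i])

lemma ev_mX:
  assumes "finite S" "i \<in> S" shows "ev S (mX i c) z = z i * ev S c z"
proof -
  have "ev S (mX i c) z = (\<Sum>a\<in>inc i ` {a. c a \<noteq> 0}. mX i c a * monv S a z)"
    by (simp add: ev_def supp_mX)
  also have "\<dots> = (\<Sum>a | c a \<noteq> 0. c a * (z i * monv S a z))"
    using inj_inc[of i] by (subst sum.reindex) (auto simp: inj_on_def monv_inc assms)
  finally show ?thesis by (simp add: ev_def sum_distrib_left algebra_simps)
qed

lemma poly_fun_monv: "poly_fun S (monv S a)"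
  unfolding monv_def by (auto intro!: poly_fun_prod poly_fun_power poly_fun.coord)

lemma poly_fun_ev: "poly_fun S (ev S c)"
  unfolding ev_def by (auto intro!: poly_fun_sum poly_fun.mult poly_fun.const poly_fun_monv)

lemma pd_monv:
  assumes "finite S" "i \<in> S"
  shows "pd i (monv S a) z = of_nat (a i) * monv S (a(i := a i - 1)) z"
proof -
  have "pd i (monv S a) z = deriv (\<lambda>w. w ^ a i * (\<Prod>j\<in>S-{i}. z j ^ a j)) (z i)"
    unfolding pd_def monv_def by (simp add: prod.remove[OF assms])
  also have "\<dots> = of_nat (a i) * z i ^ (a i - 1) * (\<Prod>j\<in>S-{i}. z j ^ a j)"
    by (rule DERIV_imp_deriv) (auto intro!: derivative_eq_intros)
  finally show ?thesis by (simp add: monv_def prod.remove[OF assms])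
qed

lemma ev_dX:
  assumes "finite S" "i \<in> S" "coefs S c" shows "ev S (dX i c) = pd i (ev S c)"
proof
  fix z
  have fin: "finite {a. c a \<noteq> 0}" using assms by (simp add: coefs_def)
  have "pd i (ev S c) z = (\<Sum>a | c a \<noteq> 0. c a * (of_nat (a i) * monv S (a(i := a i - 1)) z))"
    unfolding ev_def
    by (subst pd_sum[where S = S])
       (auto intro!: poly_fun.mult poly_fun.const poly_fun_monv sum.cong 
         simp: pd_cmult[OF poly_fun_monv] pd_monv assms)
  also have "\<dots> = (\<Sum>a\<in>inc i ` {a. dX i c a \<noteq> 0}. c a * (of_nat (a i) * monv S (a(i := a i - 1)) z))"
  proof (rule sum.mono_neutral_right[OF fin])
    show "inc i ` {a. dX i c a \<noteq> 0} \<subseteq> {a. c a \<noteq> 0}" by (auto simp: supp_dX)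
    have "a \<in> inc i ` {a. dX i c a \<noteq> 0}" if "c a \<noteq> 0" "a i \<noteq> 0" for a
    proof -
      have "a = inc i (a(i := a i - 1))" using that by (auto simp: inc_def fun_eq_iff)
      moreover from this have "dX i c (a(i := a i - 1)) \<noteq> 0"
        using that by (simp add: dX_def del: of_nat_Suc)
      ultimately show ?thesis by (metis (mono_tags, lifting) imageI mem_Collect_eq)
    qed
    thus "\<forall>a\<in>{a. c a \<noteq> 0} - inc i ` {a. dX i c a \<noteq> 0}.
            c a * (of_nat (a i) * monv S (a(i := a i - 1)) z) = 0"
      by (metis (mono_tags, lifting) DiffD1 DiffD2 mem_Collect_eq mult_eq_0_iff of_nat_0)
  qed
  also have "\<dots> = ev S (dX i c) z"
    using inj_inc[of i]
    by (subst sum.reindex) (auto simp: inj_on_def ev_def dX_def inc_def algebra_simps)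
  finally show "ev S (dX i c) z = pd i (ev S c) z" by simp
qed

text \<open>Induction on the degree of the exponent: at the origin only the constant monomial
  survives, and a coefficient of positive degree is, up to a nonzero integer factor, a coefficient
  of lower degree of some derivative.\<close>

lemma ev_inject_0:
  assumes "finite S" "coefs S c" "ev S c = (\<lambda>z. 0)"
  shows "c = (\<lambda>a. 0)"
proof
  fix a
  have "c a = 0" if "coefs S c" "ev S c = (\<lambda>z. 0)" for c
    using that
  proof (induction "\<Sum>i\<in>S. a i" arbitrary: a c)
    case 0
    show ?case
    proof (rule ccontr)
      assume ne: "c a \<noteq> 0"
      have a: "a = (\<lambda>i. 0)" 
        using 0(1) assms(1) coefs_zero_outside[OF 0(2) ne] by (auto simp: fun_eq_iff)
      have fin: "finite {a. c a \<noteq> 0}" using 0 by (simp add: coefs_def)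
      have "monv S b (\<lambda>i. 0) = (if b = a then 1 else 0)" if "c b \<noteq> 0" for b
      proof (cases "b = a")
        case False
        then obtain i where "b i \<noteq> 0" using a by auto
        moreover have "i \<in> S"
          using coefs_zero_outside[OF 0(2) that, of i] \<open>b i \<noteq> 0\<close> by auto
        ultimately show ?thesis using assms(1) False 
          by (auto simp: monv_def intro!: prod_zero bexI[of _ i])
      qed (simp add: monv_def a)
      hence "ev S c (\<lambda>i. 0) = (\<Sum>b | c b \<noteq> 0. if b = a then c b else 0)"
        unfolding ev_def by (intro sum.cong) auto
      also have "\<dots> = c a" using fin ne by simp
      finally show False using ne 0 by simp
    qed
  next
    case (Suc k)
    then obtain i where i: "i \<in> S" "a i \<noteq> 0" 
      by (metis nat.distinct(1) sum.neutral)
    let ?a = "a(i := a i - 1)"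
    have inc: "inc i ?a = a" using i by (auto simp: inc_def fun_eq_iff)
    have "(\<Sum>i\<in>S. ?a i) = k"
      using Suc(2) i assms(1) by (simp add: sum.remove[of S i])
    hence "dX i c ?a = 0"
      by (intro Suc(1)) (simp_all add: coefs_dX ev_dX Suc assms i)
    thus ?case using inc i by (simp add: dX_def del: of_nat_Suc)
  qed
  thus "c a = 0" using assms by blast
qed

lemma poly_fun_ev_ex:
  assumes "poly_fun S f" "finite S"
  shows "\<exists>c. coefs S c \<and> f = ev S c"
proof -
  \<comment> \<open>Generalised to \<open>f\<close> times an arbitrary evaluated family, so that the
    product case composes the two hypotheses and no convolution of coefficients is needed. The
    family \<open>?d\<close> of the constant 1 recovers the claim.\<close>
  have "\<exists>c. coefs S c \<and> (\<lambda>z. f z * ev S d z) = ev S c" if "coefs S d" for d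
    using assms(1) that
  proof (induction arbitrary: d rule: poly_fun.induct)
    case (const k)
    thus ?case using ev_cmult[OF const, of k] coefs_cmult[OF const, of k]
      by (intro exI[of _ "\<lambda>a. k * d a"]) auto
  next
    case (coord i)
    thus ?case using ev_mX[of S i d] coefs_mX[of S d i] assms(2)
      by (intro exI[of _ "mX i d"]) auto
  next
    case (add f g)
    obtain c where c: "coefs S c" "(\<lambda>z. f z * ev S d z) = ev S c" using add by blast
    obtain c' where c': "coefs S c'" "(\<lambda>z. g z * ev S d z) = ev S c'" using add by blast
    show ?case using c c' 
      by (intro exI[of _ "\<lambda>a. c a + c' a"]) (auto simp: coefs_add ev_add fun_eq_iff algebra_simps)
  next
    case (mult f g)
    obtain c where c: "coefs S c" "(\<lambda>z. g z * ev S d z) = ev S c" using mult by blast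
    obtain c' where c': "coefs S c'" "(\<lambda>z. f z * ev S c z) = ev S c'" using mult c by blast
    have "(\<lambda>z. f z * g z * ev S d z) = ev S c'"
      unfolding c'(2)[symmetric] c(2)[symmetric] by (simp add: mult.assoc)
    thus ?case using c' by blast
  qed
  moreover let ?d = "\<lambda>a. if a = (\<lambda>i. 0) then 1 else 0 :: complex"
  have "coefs S ?d" by (auto simp: coefs_def)
  moreover have "ev S ?d = (\<lambda>z. 1)" 
    by (intro ext) (simp add: ev_def monv_def)
  ultimately show ?thesis by (metis (no_types, lifting) ext mult.right_neutral)
qed

section \<open>The Fischer inner product: adjointness and positivity\<close>

definition fischer :: "(('i::finite \<Rightarrow> nat) \<Rightarrow> complex) \<Rightarrow> (('i \<Rightarrow> nat) \<Rightarrow> complex) \<Rightarrow> complex" where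
  "fischer c d = (\<Sum>a | c a \<noteq> 0. (\<Prod>i\<in>UNIV. fact (a i)) * c a * cnj (d a))"

lemma fact_inc: "(\<Prod>j\<in>UNIV. fact (inc i a j)) = (of_nat (Suc (a i)) * (\<Prod>j\<in>UNIV. fact (a j)) :: complex)"
  for i :: "'i::finite"
  by (simp add: inc_def prod.remove[of UNIV i] del: of_nat_Suc)

text \<open>Raising the exponent of variable \<open>i\<close> multiplies the factorial weight by
  exactly the factor that \<open>dX\<close> introduces.\<close>

lemma fischer_mX: "fischer (mX i c) d = fischer c (dX i d)"
proof -
  have "fischer (mX i c) d =
      (\<Sum>a | c a \<noteq> 0. (\<Prod>j\<in>UNIV. fact (inc i a j)) * c a * cnj (d (inc i a)))"
    unfolding fischer_def supp_mX using inj_inc[of i]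
    by (subst sum.reindex) (auto simp: inj_on_def)
  thus ?thesis unfolding fact_inc fischer_def dX_def by (simp add: algebra_simps)
qed

lemma fischer_superset:
  "finite A \<Longrightarrow> {a. c a \<noteq> 0} \<subseteq> A \<Longrightarrow>
    fischer c d = (\<Sum>a\<in>A. (\<Prod>i\<in>UNIV. fact (a i)) * c a * cnj (d a))"
  unfolding fischer_def by (rule sum.mono_neutral_left) auto

lemma fischer_add_left:
  assumes "coefs S c" "coefs S c'"
  shows "fischer (\<lambda>a. c a + c' a) d = fischer c d + fischer c' d"
proof -
  let ?A = "{a. c a \<noteq> 0} \<union> {a. c' a \<noteq> 0}"
  have "finite ?A" using assms by (simp add: coefs_def)
  thus ?thesis
    by (subst (1 2 3) fischer_superset[of ?A]) (auto simp: sum.distrib algebra_simps)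
qed

lemma fischer_0 [simp]: "fischer (\<lambda>a. 0) d = 0" "fischer c (\<lambda>a. 0) = 0"
  by (simp_all add: fischer_def)

lemma fischer_sum_left:
  "(\<And>x. x \<in> A \<Longrightarrow> coefs S (c x)) \<Longrightarrow> fischer (\<lambda>a. \<Sum>x\<in>A. c x a) d = (\<Sum>x\<in>A. fischer (c x) d)"
  by (induction A rule: infinite_finite_induct) (auto simp: fischer_add_left[of S] coefs_sum)

lemma fischer_sum_right: "fischer c (\<lambda>a. \<Sum>x\<in>A. d x a) = (\<Sum>x\<in>A. fischer c (d x))"
  unfolding fischer_def by (subst sum.swap) (simp add: sum_distrib_left)

lemma fischer_self: 
  "fischer c c = of_real (\<Sum>a | c a \<noteq> 0. (\<Prod>i\<in>UNIV. fact (a i)) * (cmod (c a))\<^sup>2)"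
  unfolding fischer_def of_real_sum
  by (intro sum.cong) (simp_all add: complex_mult_cnj cmod_power2 mult.assoc flip: complex_norm_square)

text \<open>Positive definiteness, for finitely many families at once: a sum of nonnegative squared
  norms vanishes only termwise.\<close>

lemma sum_fischer_self_eq_0:
  assumes "finite R" "\<And>r. r \<in> R \<Longrightarrow> coefs UNIV (c r)" "(\<Sum>r\<in>R. fischer (c r) (c r)) = 0" "r \<in> R"
  shows "c r = (\<lambda>a. 0)"
proof -
  let ?g = "\<lambda>a. (\<Prod>i\<in>UNIV. fact (a i)) :: real"
  have pos: "?g a > 0" for a by (simp add: prod_pos)
  let ?f = "\<lambda>r. \<Sum>a | c r a \<noteq> 0. ?g a * (cmod (c r a))\<^sup>2"
  have "(\<Sum>r\<in>R. ?f r) = 0" 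
    using assms(3) unfolding fischer_self of_real_sum[symmetric] by (simp only: of_real_eq_0_iff)
  hence "?f r = 0"
    using assms(1,4) by (subst (asm) sum_nonneg_eq_0_iff) (auto intro!: sum_nonneg mult_nonneg_nonneg less_imp_le[OF pos])
  moreover have "finite {a. c r a \<noteq> 0}" using assms(2,4) by (simp add: coefs_def)
  ultimately have "\<forall>a\<in>{a. c r a \<noteq> 0}. ?g a * (cmod (c r a))\<^sup>2 = 0"
    by (subst (asm) sum_nonneg_eq_0_iff) (auto intro!: mult_nonneg_nonneg less_imp_le[OF pos])
  thus ?thesis using pos by (force simp: less_le fun_eq_iff)
qed

section \<open>Quadratic forms and the second order operators adjoint to them\<close>

context
  fixes P :: "'r \<Rightarrow> ('i::finite \<times> 'i) set"
begin

definition quad :: "'r \<Rightarrow> ('i \<Rightarrow> complex) \<Rightarrow> complex" where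
  "quad r z = (\<Sum>(i, j)\<in>P r. z i * z j)"

definition lap :: "'r \<Rightarrow> (('i \<Rightarrow> complex) \<Rightarrow> complex) \<Rightarrow> ('i \<Rightarrow> complex) \<Rightarrow> complex" where
  "lap r f z = (\<Sum>(i, j)\<in>P r. pd i (pd j f) z)"

text \<open>Taking adjoints reverses the order of composition, hence \<open>fst\<close> innermost
  here and outermost in \<open>lapc\<close>.\<close>

definition quadc :: "'r \<Rightarrow> (('i \<Rightarrow> nat) \<Rightarrow> complex) \<Rightarrow> ('i \<Rightarrow> nat) \<Rightarrow> complex" where
  "quadc r c = (\<lambda>a. \<Sum>x\<in>P r. mX (snd x) (mX (fst x) c) a)"

definition lapc :: "'r \<Rightarrow> (('i \<Rightarrow> nat) \<Rightarrow> complex) \<Rightarrow> ('i \<Rightarrow> nat) \<Rightarrow> complex" where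
  "lapc r c = (\<lambda>a. \<Sum>x\<in>P r. dX (fst x) (dX (snd x) c) a)"

lemma fischer_quadc: "coefs UNIV c \<Longrightarrow> fischer (quadc r c) d = fischer c (lapc r d)"
  unfolding quadc_def lapc_def
  by (subst fischer_sum_left[of _ UNIV]) (auto simp: coefs_mX fischer_mX fischer_sum_right)

lemma coefs_quadc: "coefs UNIV c \<Longrightarrow> coefs UNIV (quadc r c)"
  unfolding quadc_def by (auto intro!: coefs_sum coefs_mX)

lemma coefs_lapc: "coefs UNIV c \<Longrightarrow> coefs UNIV (lapc r c)"
  unfolding lapc_def by (auto intro!: coefs_sum coefs_dX)

lemma ev_quadc: "coefs UNIV c \<Longrightarrow> ev UNIV (quadc r c) z = quad r z * ev UNIV c z"
  unfolding quadc_def quad_def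
  by (subst ev_sum) (auto simp: ev_mX coefs_mX sum_distrib_left sum_distrib_right case_prod_beta mult_ac)

lemma ev_lapc: "coefs UNIV c \<Longrightarrow> ev UNIV (lapc r c) z = lap r (ev UNIV c) z"
  unfolding lapc_def lap_def
  by (subst ev_sum) (auto simp: ev_dX coefs_dX case_prod_beta)

text \<open>Pairing the vanishing sum with \<open>f\<close> and moving each quadratic form to the
  other side gives the sum of the squared Fischer norms of the \<open>lap r f\<close>.\<close>

lemma lap_eq_0_if_sum_quad_lap_eq_0:
  assumes "finite R" "poly_fun UNIV f" "\<And>z. (\<Sum>r\<in>R. quad r z * lap r f z) = 0" "r \<in> R"
  shows "lap r f z = 0"
proof -
  obtain c where c: "coefs UNIV c" "f = ev UNIV c"
    using poly_fun_ev_ex[OF assms(2)] by auto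
  let ?t = "\<lambda>a. \<Sum>r\<in>R. quadc r (lapc r c) a"
  have "ev UNIV ?t = (\<lambda>z. 0)"
    using assms(3) c by (intro ext, subst ev_sum) (auto simp: coefs_quadc coefs_lapc ev_quadc ev_lapc)
  hence "?t = (\<lambda>a. 0)"
    by (intro ev_inject_0[of UNIV]) (auto intro!: coefs_sum coefs_quadc coefs_lapc c)
  hence "0 = fischer ?t c" by simp
  also have "\<dots> = (\<Sum>r\<in>R. fischer (lapc r c) (lapc r c))"
    by (subst fischer_sum_left[of _ UNIV]) (auto simp: coefs_quadc coefs_lapc fischer_quadc c)
  finally have "lapc r c = (\<lambda>a. 0)"
    using sum_fischer_self_eq_0[of R "\<lambda>r. lapc r c" r] assms(1,4) by (auto simp: coefs_lapc c)
  thus ?thesis using ev_lapc[OF c(1), of r z] c by simp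
qed

text \<open>The squared norm of \<open>f\<close> is the sum of the pairings of
  \<open>quad r * g r\<close> with \<open>f\<close>; by adjointness these are pairings of
  \<open>g r\<close> with \<open>lap r f = 0\<close>.\<close>

lemma eq_0_if_lap_eq_0_in_ideal:
  assumes "poly_fun UNIV f" "\<And>r z. r \<in> R \<Longrightarrow> lap r f z = 0"
    and "\<And>r. r \<in> R \<Longrightarrow> poly_fun UNIV (g r)" "\<And>z. f z = (\<Sum>r\<in>R. quad r z * g r z)"
  shows "f z = 0"
proof -
  obtain c where c: "coefs UNIV c" "f = ev UNIV c"
    using poly_fun_ev_ex[OF assms(1)] by auto
  have "\<forall>r\<in>R. \<exists>d. coefs UNIV d \<and> g r = ev UNIV d"
    using poly_fun_ev_ex[OF assms(3)] by auto
  then obtain d where d: "\<And>r. r \<in> R \<Longrightarrow> coefs UNIV (d r)" "\<And>r. r \<in> R \<Longrightarrow> g r = ev UNIV (d r)"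
    by metis
  let ?t = "\<lambda>a. \<Sum>r\<in>R. quadc r (d r) a"
  have t: "coefs UNIV ?t" by (intro coefs_sum coefs_quadc d)
  have "ev UNIV (\<lambda>a. c a + (-1) * ?t a) = (\<lambda>z. 0)"
  proof
    fix z
    have "ev UNIV ?t z = f z"
      unfolding assms(4) by (subst ev_sum) (auto simp: coefs_quadc ev_quadc d)
    thus "ev UNIV (\<lambda>a. c a + (-1) * ?t a) z = 0"
      by (subst ev_add[OF c(1) coefs_cmult[OF t]], subst ev_cmult[OF t]) (simp add: c)
  qed
  from ev_inject_0[OF _ coefs_add[OF c(1) coefs_cmult[OF t]] this]
  have "c = ?t" by (auto simp: fun_eq_iff)
  have "lapc r c = (\<lambda>a. 0)" if "r \<in> R" for r
    using assms(2)[OF that] c by (intro ev_inject_0[of UNIV]) (auto simp: coefs_lapc ev_lapc)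
  hence "fischer ?t c = 0"
    by (subst fischer_sum_left[of _ UNIV]) (auto simp: coefs_quadc fischer_quadc d)
  hence "fischer c c = 0" using \<open>c = ?t\<close> by metis
  hence "c = (\<lambda>a. 0)" using sum_fischer_self_eq_0[of "{()}" "\<lambda>_. c" "()"] c by simp
  thus ?thesis using c by simp
qed

end

section \<open>Cofactors over a commutative ring\<close>

definition with_row :: "'a^'m^'n \<Rightarrow> 'n \<Rightarrow> 'a^'m \<Rightarrow> 'a^'m^'n" where
  "with_row M s r = (\<chi> i. if i = s then r else M $ i)"

text \<open>Replacing a row by a unit vector gives the signed cofactor over any commutative ring;
  the ring in use is that of polynomials in \<lambda>.\<close>

definition cof :: "'a::comm_ring_1^'n^'n \<Rightarrow> 'n \<Rightarrow> 'n \<Rightarrow> 'a" where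
  "cof M s t = det (with_row M s (axis t 1))"

text \<open>The derivative of \<open>cof M i t\<close> with respect to the entry (s, j). It is zero
  for \<open>s = i\<close>, since row \<open>i\<close> has already been replaced.\<close>

definition cof2 :: "'a::comm_ring_1^'n^'n \<Rightarrow> 'n \<Rightarrow> 'n \<Rightarrow> 'n \<Rightarrow> 'n \<Rightarrow> 'a" where
  "cof2 M i t s j = (if s = i then 0 else det (with_row (with_row M i (axis t 1)) s (axis j 1)))"

lemma with_row_simps [simp]:
  "with_row M s r $ s = r" "i \<noteq> s \<Longrightarrow> with_row M s r $ i = M $ i"
  "with_row (with_row M s r) s r' = with_row M s r'" "with_row M s (M $ s) = M"
  by (auto simp: with_row_def vec_eq_iff)

lemma with_row_swap: "i \<noteq> s \<Longrightarrow> with_row (with_row M i x) s y = with_row (with_row M s y) i x"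
  by (auto simp: with_row_def vec_eq_iff)

lemma det_with_row_add:
  "det (with_row M s (x + y)) = det (with_row M s x) + det (with_row M s (y :: 'a::comm_ring_1^'n))"
  unfolding with_row_def using det_row_add[of s "\<lambda>_. x" "\<lambda>_. y" "\<lambda>i. M $ i"] by simp

lemma det_with_row_mult:
  "det (with_row M s (c *s x)) = c * det (with_row M s (x :: 'a::comm_ring_1^'n))"
  unfolding with_row_def using det_row_mul[of s c "\<lambda>_. x" "\<lambda>i. M $ i"] by simp

lemma det_with_row_0: "det (with_row M s (0 :: 'a::comm_ring_1^'n)) = 0"
  unfolding with_row_def using det_row_0[of s "\<lambda>i. M $ i"] by simp

lemma det_with_row: "det (with_row M s r) = (\<Sum>t\<in>UNIV. r $ t * cof M s t)"
proof -
  have "det (with_row M s (\<Sum>t\<in>UNIV. r $ t *s axis t 1)) = (\<Sum>t\<in>UNIV. r $ t * cof M s t)"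
    using det_linear_row_sum[of UNIV s "\<lambda>_ t. r $ t *s axis t 1" "\<lambda>i. M $ i"]
    by (simp add: with_row_def[symmetric] det_with_row_mult cof_def)
  thus ?thesis by (simp only: basis_expansion)
qed

lemma det_with_row_equal:
  "i \<noteq> s \<Longrightarrow> M $ i = r \<Longrightarrow> det (with_row M s r) = (0 :: 'a::comm_ring_1)"
  by (rule det_identical_rows[of i s]) (auto simp: row_def with_row_def vec_eq_iff)

lemma mult_cof_row: 
  "(\<Sum>t\<in>UNIV. M $ i $ t * cof M s t) = (if i = s then det M else 0)"
  by (simp add: det_with_row[symmetric] det_with_row_equal)

text \<open>The two modified matrices have the same Leibniz terms: for \<open>p s = t\<close> the
  factors agree, otherwise each product contains a zero of its unit vector.\<close>

lemma cof_transpose: "cof (transpose M) t s = cof M s t"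
  for M :: "'a::comm_ring_1^'n^'n"
proof -
  let ?N = "with_row M s (axis t 1)" and ?N' = "transpose (with_row (transpose M) t (axis s 1))"
  have "(\<Prod>i\<in>UNIV. ?N $ i $ p i) = (\<Prod>i\<in>UNIV. ?N' $ i $ p i)" if p: "p permutes UNIV" for p
  proof (cases "p s = t")
    case True
    have "p i = t \<longleftrightarrow> i = s" for i
      using True permutes_inj[OF p] by (auto dest: injD)
    thus ?thesis
      by (intro prod.cong) (auto simp: with_row_def transpose_def axis_def)
  next
    case False
    obtain i where i: "p i = t" using permutes_surj[OF p] by (metis surjD)
    have z: "?N $ s $ p s = 0" using False by (auto simp: axis_def)
    have z': "?N' $ i $ p i = 0" using False i by (auto simp: axis_def transpose_def)
    have "(\<Prod>i\<in>UNIV. ?N $ i $ p i) = 0" 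
      by (rule prod_zero) (simp, rule bexI[of _ s], rule z, simp)
    moreover have "(\<Prod>i\<in>UNIV. ?N' $ i $ p i) = 0"
      by (rule prod_zero) (simp, rule bexI[of _ i], rule z', simp)
    ultimately show ?thesis by simp
  qed
  hence "det ?N = det ?N'" unfolding det_def by (intro sum.cong) auto
  thus ?thesis by (simp add: cof_def)
qed

lemma transpose_component: "transpose M $ i $ j = M $ j $ i"
  by (simp add: transpose_def)

lemma mult_cof_col: 
  "(\<Sum>i\<in>UNIV. M $ i $ j * cof M i t) = (if j = t then det M else 0)"
  using mult_cof_row[of "transpose M" j t] by (simp add: cof_transpose transpose_component)

text \<open>As a function of the two replaced rows the determinant is bilinear and vanishes on equal
  rows, hence is alternating.\<close>

lemma cof2_antisym: "cof2 M i t s j = - cof2 M i j s t"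
proof (cases "s = i")
  case False
  let ?f = "\<lambda>x y. det (with_row (with_row M i x) s y)"
  have 0: "?f x x = 0" for x
    using False by (intro det_with_row_equal[of i]) auto
  have l: "?f (x + x') y = ?f x y + ?f x' y" for x x' y
    using False by (simp add: with_row_swap det_with_row_add)
  have r: "?f x (y + y') = ?f x y + ?f x y'" for x y y'
    by (simp add: det_with_row_add)
  have "?f x y + ?f y x = 0" for x y
    using 0[of "x + y"] 0[of x] 0[of y] unfolding l r by (simp add: add.commute)
  thus ?thesis using False by (simp add: cof2_def eq_neg_iff_add_eq_0)
qed (simp add: cof2_def)

text \<open>
  Moving the index \<open>j\<close> to row \<open>i\<close> by antisymmetry turns the inner sum into an expansion along row \<open>i\<close>.
\<close>

lemma sum_mult_cof2:
  "(\<Sum>i\<in>UNIV. \<Sum>j\<in>UNIV. R $ i $ j * cof2 M i t s j) =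
     - (\<Sum>i\<in>UNIV - {s}. det (with_row (with_row M s (axis t 1)) i (R $ i)))"
proof -
  have "(\<Sum>j\<in>UNIV. R $ i $ j * cof2 M i t s j) =
    (if i = s then 0 else - det (with_row (with_row M s (axis t 1)) i (R $ i)))" for i
  proof (cases "i = s")
    case False
    have "(\<Sum>j\<in>UNIV. R $ i $ j * cof2 M i t s j) =
       - (\<Sum>j\<in>UNIV. R $ i $ j * cof (with_row M s (axis t 1)) i j)"
      using False with_row_swap[of i s M] 
      by (subst cof2_antisym) (simp add: cof2_def cof_def sum_negf)
    thus ?thesis using False by (simp add: det_with_row)
  qed (simp add: cof2_def)
  thus ?thesis by (simp add: sum.remove[of UNIV s] sum_negf)
qed

text \<open>Putting row \<open>i\<close> of \<open>M\<close> back in its own place changes nothing,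
  so the n - 1 rows other than \<open>s\<close> all contribute the same cofactor.\<close>

lemma sum_mult_cof2_self:
  "(\<Sum>i\<in>UNIV. \<Sum>j\<in>UNIV. M $ i $ j * cof2 M i t s j) = - (of_nat (CARD('n) - 1) * cof M s t)"
  for M :: "'a::comm_ring_1^'n^'n"
proof -
  have "with_row (with_row M s (axis t 1)) i (M $ i) = with_row M s (axis t 1)" if "i \<noteq> s" for i
    using that by (auto simp: with_row_def vec_eq_iff)
  thus ?thesis unfolding sum_mult_cof2 by (simp add: cof_def)
qed

text \<open>The rank \<open>p\<close> replaces an order on the index type. A permutation with
  nonzero Leibniz term never raises the rank; as it preserves the sum of all ranks, it preserves
  each rank and is the identity.\<close>

lemma det_triangular:
  fixes A :: "'a::comm_ring_1^'n^'n" and p :: "'n \<Rightarrow> nat"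
  assumes "inj p" and "\<And>i j. A $ i $ j \<noteq> 0 \<Longrightarrow> p j \<le> p i"
  shows "det A = (\<Prod>i\<in>UNIV. A $ i $ i)"
proof -
  have "(\<Prod>i\<in>UNIV. A $ i $ q i) = 0" if q: "q permutes UNIV" "q \<noteq> id" for q
  proof (rule ccontr)
    assume "(\<Prod>i\<in>UNIV. A $ i $ q i) \<noteq> 0"
    hence "A $ i $ q i \<noteq> 0" for i
      using prod_zero[of UNIV "\<lambda>i. A $ i $ q i"] by auto
    hence le: "p (q i) \<le> p i" for i using assms(2) by blast
    have "(\<Sum>i\<in>UNIV. p (q i)) = (\<Sum>i\<in>UNIV. p i)"
      using sum.permute[OF q(1), of p] by (simp add: comp_def)
    hence "p (q i) = p i" for i
      using sum_mono_inv[of "\<lambda>i. p (q i)" UNIV p i] le by auto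
    hence "q i = i" for i using assms(1) by (auto dest: injD)
    thus False using q by auto
  qed
  hence "det A = (\<Sum>q\<in>{id}. of_int (sign q) * (\<Prod>i\<in>UNIV. A $ i $ q i))"
    unfolding det_def
    by (intro sum.mono_neutral_right) (auto simp: finite_permutations permutes_id)
  thus ?thesis by simp
qed

lemma pderiv_det:
  "pderiv (det A) = (\<Sum>i\<in>UNIV. det (with_row A i (\<chi> j. pderiv (A $ i $ j))))"
  for A :: "'a::idom poly^'n^'n"
proof -
  have "pderiv (\<Prod>i\<in>UNIV. A $ i $ q i) = 
     (\<Sum>i\<in>UNIV. \<Prod>k\<in>UNIV. with_row A i (\<chi> j. pderiv (A $ i $ j)) $ k $ q k)" for q
  proof -
    have "(\<Prod>k\<in>UNIV. with_row A i (\<chi> j. pderiv (A $ i $ j)) $ k $ q k) =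
      (\<Prod>k\<in>UNIV-{i}. A $ k $ q k) * pderiv (A $ i $ q i)" for i
      by (subst prod.remove[of UNIV i]) (auto simp: mult.commute intro!: prod.cong arg_cong2[of _ _ _ _ "(*)"])
    thus ?thesis by (simp add: pderiv_prod)
  qed
  moreover have "pderiv (of_int (sign q) * x) = of_int (sign q) * pderiv (x :: 'a poly)" for q :: "'n \<Rightarrow> 'n" and x
    by (simp add: sign_def pderiv_minus)
  ultimately show ?thesis
    unfolding det_def by (subst sum.swap) (simp add: sum_distrib_left higher_pderiv_sum[of 1, simplified])
qed

lemma degree_det_le:
  fixes A :: "'a::idom poly^'n^'n"
  assumes "\<And>i j. degree (A $ i $ j) \<le> d i"
  shows "degree (det A) \<le> (\<Sum>i\<in>UNIV. d i)"
  unfolding det_def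
proof (intro degree_sum_le)
  fix q :: "'n \<Rightarrow> 'n"
  have "degree (\<Prod>i\<in>UNIV. A $ i $ q i) \<le> (\<Sum>i\<in>UNIV. degree (A $ i $ q i))"
    using degree_prod_sum_le[of UNIV "\<lambda>i. A $ i $ q i"] by (simp add: comp_def)
  also have "\<dots> \<le> (\<Sum>i\<in>UNIV. d i)" by (intro sum_mono assms)
  finally show "degree (of_int (sign q) * (\<Prod>i\<in>UNIV. A $ i $ q i)) \<le> (\<Sum>i\<in>UNIV. d i)"
    by (simp add: sign_def)
qed (simp add: finite_permutations)

section \<open>The second order operator on polynomials in the determinant coefficients\<close>

text \<open>The matrix W + \<lambda>Z, with the entries of W under \<open>Inl\<close> and those of Z
  under \<open>Inr\<close>; thus \<open>edet a\<close> below is Q_a.\<close>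

definition pencil :: "('n \<times> 'n + 'n \<times> 'n \<Rightarrow> complex) \<Rightarrow> complex poly^'n^'n" where
  "pencil z = (\<chi> i j. [:z (Inl (i, j)), z (Inr (i, j)):])"

definition edet :: "nat \<Rightarrow> ('n::finite \<times> 'n + 'n \<times> 'n \<Rightarrow> complex) \<Rightarrow> complex" where
  "edet a z = coeff (det (pencil z)) a"

definition poly_coeffs_fun :: "(('i \<Rightarrow> complex) \<Rightarrow> complex poly) \<Rightarrow> bool" where
  "poly_coeffs_fun P \<longleftrightarrow> (\<forall>a. poly_fun UNIV (\<lambda>z. coeff (P z) a))"

lemma poly_coeffs_fun_const: "poly_coeffs_fun (\<lambda>z. p)"
  by (simp add: poly_coeffs_fun_def poly_fun.const)

lemma poly_coeffs_fun_mult: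
  "poly_coeffs_fun P \<Longrightarrow> poly_coeffs_fun Q \<Longrightarrow> poly_coeffs_fun (\<lambda>z. P z * Q z)"
  by (auto simp: poly_coeffs_fun_def coeff_mult intro!: poly_fun_sum poly_fun.mult)

lemma poly_coeffs_fun_sum:
  "(\<And>x. x \<in> A \<Longrightarrow> poly_coeffs_fun (P x)) \<Longrightarrow> poly_coeffs_fun (\<lambda>z. \<Sum>x\<in>A. P x z)"
  by (auto simp: poly_coeffs_fun_def coeff_sum intro!: poly_fun_sum)

lemma poly_coeffs_fun_prod:
  "(\<And>x. x \<in> A \<Longrightarrow> poly_coeffs_fun (P x)) \<Longrightarrow> poly_coeffs_fun (\<lambda>z. \<Prod>x\<in>A. P x z)"
  by (induction A rule: infinite_finite_induct)
     (auto intro: poly_coeffs_fun_const poly_coeffs_fun_mult)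

lemma poly_coeffs_fun_det:
  "(\<And>i j. poly_coeffs_fun (\<lambda>z. A z $ i $ j)) \<Longrightarrow> poly_coeffs_fun (\<lambda>z. det (A z))"
  unfolding det_def
  by (intro poly_coeffs_fun_sum poly_coeffs_fun_mult poly_coeffs_fun_prod poly_coeffs_fun_const)

lemma poly_coeffs_fun_pencil: "poly_coeffs_fun (\<lambda>z. pencil z $ i $ j)"
  unfolding poly_coeffs_fun_def
proof
  fix a
  show "poly_fun UNIV (\<lambda>z. coeff (pencil z $ i $ j) a)"
    by (cases a; cases "a - 1") (auto simp: pencil_def intro: poly_fun.intros)
qed

lemma poly_fun_edet: "poly_fun UNIV (edet a :: ('n::finite \<times> 'n + 'n \<times> 'n \<Rightarrow> complex) \<Rightarrow> complex)"
proof -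
  have "poly_coeffs_fun (\<lambda>z :: 'n \<times> 'n + 'n \<times> 'n \<Rightarrow> complex. det (pencil z))"
    by (intro poly_coeffs_fun_det poly_coeffs_fun_pencil)
  thus ?thesis by (simp add: poly_coeffs_fun_def edet_def[abs_def])
qed

text \<open>One entry perturbs one row by a multiple of a unit vector. Determinant and cofactors are
  therefore affine in it, with slopes \<open>cof\<close> and \<open>cof2\<close>; for an entry of Z
  the extra factor \<lambda> appears as \<open>pCons 0\<close>.\<close>

lemma pencil_upd_Inl:
  "pencil (z(Inl (s, t) := w)) = with_row (pencil z) s (pencil z $ s + [:w - z (Inl (s, t)):] *s axis t 1)"
  by (auto simp: pencil_def with_row_def vec_eq_iff axis_def)

lemma pencil_upd_Inr:
  "pencil (z(Inr (s, t) := w)) = with_row (pencil z) s (pencil z $ s + [:0, w - z (Inr (s, t)):] *s axis t 1)"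
  by (auto simp: pencil_def with_row_def vec_eq_iff axis_def)

lemma det_row_perturb:
  "det (with_row M s (M $ s + c *s axis t 1)) = det M + c * cof M s t"
  by (simp add: det_with_row_add det_with_row_mult cof_def)

lemma cof_row_perturb:
  "cof (with_row M s (M $ s + c *s axis j 1)) i t = cof M i t + c * cof2 M i t s j"
proof (cases "i = s")
  case False
  have "with_row (with_row M i x) s (M $ s) = with_row M i x" for x
    using False by (auto simp: with_row_def vec_eq_iff)
  thus ?thesis
    using False with_row_swap[of s i M]
    by (simp add: cof_def cof2_def det_with_row_add det_with_row_mult)
qed (simp add: cof_def cof2_def)

lemma coeff_linear_mult: "coeff ([:a, b:] * p) k = a * coeff p k + b * coeff (pCons 0 p) k"
  by (cases k) auto

lemma coeff_const_mult: "coeff ([:a:] * p) k = a * coeff p k"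
  by simp

lemma deriv_affine: "deriv (\<lambda>w. a + (w - b) * c) z = (c :: complex)"
  by (rule DERIV_imp_deriv) (auto intro!: derivative_eq_intros)

lemma pd_edet:
  "pd (Inl (s, t)) (edet a) z = coeff (cof (pencil z) s t) a"
  "pd (Inr (s, t)) (edet a) z = coeff (pCons 0 (cof (pencil z) s t)) a"
  by (simp_all add: pd_def edet_def pencil_upd_Inl pencil_upd_Inr det_row_perturb deriv_affine
       coeff_const_mult coeff_linear_mult[of 0] del: mult_pCons_left pCons_0_0)
  
lemma pd_coeff_cof:
  "pd (Inl (s, j)) (\<lambda>z. coeff (cof (pencil z) i t) a) z = coeff (cof2 (pencil z) i t s j) a"
  "pd (Inr (s, j)) (\<lambda>z. coeff (cof (pencil z) i t) a) z = coeff (pCons 0 (cof2 (pencil z) i t s j)) a"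
  by (simp_all add: pd_def pencil_upd_Inl pencil_upd_Inr cof_row_perturb deriv_affine
       coeff_const_mult coeff_linear_mult[of 0] del: mult_pCons_left pCons_0_0)

lemma pd_coeff_pCons_cof:
  "pd (Inr (s, j)) (\<lambda>z. coeff (pCons 0 (cof (pencil z) i t)) a) z =
     coeff (pCons 0 (pCons 0 (cof2 (pencil z) i t s j))) a"
  by (cases a) (auto simp: pd_coeff_cof)

text \<open>The operator D_st to which the Laplacian descends, see
  \<open>laplacian_compose_gram\<close>: the first order terms count columns, the second order terms
  carry Gram matrix entries.\<close>

definition dop ::
  "nat \<Rightarrow> nat \<Rightarrow> 'n \<Rightarrow> 'n \<Rightarrow> (('n::finite \<times> 'n + 'n \<times> 'n \<Rightarrow> complex) \<Rightarrow> complex) \<Rightarrow>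
    ('n \<times> 'n + 'n \<times> 'n \<Rightarrow> complex) \<Rightarrow> complex" where
  "dop k1 k2 s t Q z =
     of_nat k1 * pd (Inl (s, t)) Q z +
     (\<Sum>i\<in>UNIV. \<Sum>j\<in>UNIV. z (Inl (i, j)) * pd (Inl (s, j)) (pd (Inl (i, t)) Q) z) +
     of_nat k2 * pd (Inr (s, t)) Q z +
     (\<Sum>i\<in>UNIV. \<Sum>j\<in>UNIV. z (Inr (i, j)) * pd (Inr (s, j)) (pd (Inr (i, t)) Q) z)"

text \<open>Differentiating in \<lambda> replaces one row at a time by the row of Z, while row
  \<open>s\<close> is constant; \<open>sum_mult_cof2\<close> rewrites the resulting sum.\<close>

lemma pderiv_cof_pencil:
  "pderiv (cof (pencil z) s t) =
     - (\<Sum>i\<in>UNIV. \<Sum>j\<in>UNIV. [:z (Inr (i, j)):] * cof2 (pencil z) i t s j)"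
proof -
  let ?R = "\<chi> i j. [:z (Inr (i, j)):]"
  let ?N = "with_row (pencil z) s (axis t 1)"
  have "pderiv (cof (pencil z) s t) = (\<Sum>i\<in>UNIV. det (with_row ?N i (\<chi> j. pderiv (?N $ i $ j))))"
    by (simp add: cof_def pderiv_det)
  also have "\<dots> = (\<Sum>i\<in>UNIV. if i = s then 0 else det (with_row ?N i (?R $ i)))"
  proof (intro sum.cong refl)
    fix i
    have "(\<chi> j. pderiv (?N $ i $ j)) = (if i = s then 0 else ?R $ i)"
      by (auto simp: vec_eq_iff axis_def pencil_def pderiv_pCons)
    thus "det (with_row ?N i (\<chi> j. pderiv (?N $ i $ j))) = 
      (if i = s then 0 else det (with_row ?N i (?R $ i)))" 
      by (simp add: det_with_row_0)
  qed
  also have "\<dots> = (\<Sum>i\<in>UNIV-{s}. det (with_row ?N i (?R $ i)))"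
    by (simp add: sum.remove[of UNIV s])
  also have "\<dots> = - (\<Sum>i\<in>UNIV. \<Sum>j\<in>UNIV. ?R $ i $ j * cof2 (pencil z) i t s j)"
    by (simp only: sum_mult_cof2) simp
  finally show ?thesis by simp
qed

text \<open>Each derivative in Z brings a factor \<lambda>, so the second order part pairs
  \<open>cof2\<close> with W + \<lambda>^2 Z = (W + \<lambda>Z) + (\<lambda>^2 - \<lambda>) Z. The
  first summand gives -(n - 1) times the cofactor G, the second (\<lambda> - \<lambda>^2) times its
  derivative.\<close>

lemma dop_edet:
  fixes z :: "'n::finite \<times> 'n + 'n \<times> 'n \<Rightarrow> complex"
  shows "dop k1 k2 s t (edet a) z =
    (of_nat k1 - of_nat CARD('n) + 1 + of_nat a) * coeff (cof (pencil z) s t) a +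
    (of_nat k2 + 1 - of_nat a) * coeff (pCons 0 (cof (pencil z) s t)) a"
proof -
  let ?G = "cof (pencil z) s t" and ?H = "\<lambda>i j. cof2 (pencil z) i t s j"
  let ?S = "\<Sum>i\<in>UNIV. \<Sum>j\<in>UNIV. [:z (Inl (i, j)):] * ?H i j + [:0, 0, z (Inr (i, j)):] * ?H i j"
  let ?T = "\<Sum>i\<in>UNIV. \<Sum>j\<in>UNIV. [:z (Inr (i, j)):] * ?H i j"
  have eq: "[:z (Inl (i, j)):] * ?H i j + [:0, 0, z (Inr (i, j)):] * ?H i j =
     pencil z $ i $ j * ?H i j + [:0, -1, 1:] * ([:z (Inr (i, j)):] * ?H i j)" for i j
    by (simp add: pencil_def algebra_simps smult_diff_right)
  have "?S = - (of_nat (CARD('n) - 1) * ?G) + [:0, -1, 1:] * ?T"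
    unfolding eq sum.distrib sum_mult_cof2_self by (simp only: sum_distrib_left)
  also have "?T = - pderiv ?G" by (simp add: pderiv_cof_pencil)
  finally have S: "?S = - (of_nat (CARD('n) - 1) * ?G) + pCons 0 (pderiv ?G) - pCons 0 (pCons 0 (pderiv ?G))"
    by simp
  have 1: "(\<Sum>i\<in>UNIV. \<Sum>j\<in>UNIV. z (Inl (i, j)) * pd (Inl (s, j)) (pd (Inl (i, t)) (edet a)) z) +
     (\<Sum>i\<in>UNIV. \<Sum>j\<in>UNIV. z (Inr (i, j)) * pd (Inr (s, j)) (pd (Inr (i, t)) (edet a)) z) = coeff ?S a"
  proof -
    have "pd (Inl (i, t)) (edet a) = (\<lambda>z. coeff (cof (pencil z) i t) a)"
      "pd (Inr (i, t)) (edet a) = (\<lambda>z. coeff (pCons 0 (cof (pencil z) i t)) a)" for i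
      by (intro ext pd_edet)+
    moreover have "coeff ([:0, 0, c:] * p) a = c * coeff (pCons 0 (pCons 0 p)) a" for c and p :: "complex poly"
      by (cases a; cases "a - 1") auto
    ultimately show ?thesis
      by (simp only: pd_coeff_cof pd_coeff_pCons_cof coeff_sum coeff_add coeff_const_mult sum.distrib)
  qed
  have 2: "(of_nat (CARD('n) - 1) :: complex) = of_nat CARD('n) - 1" 
    by (simp add: of_nat_diff)
  have 3: "coeff (of_nat (CARD('n) - 1) * ?G) a = (of_nat CARD('n) - 1) * coeff ?G a"
  proof -
    have "coeff (of_nat k * p) a = of_nat k * coeff p a" for k and p :: "complex poly"
      by (simp add: of_nat_poly)
    thus ?thesis by (simp only: 2)
  qed
  have 4: "coeff (pCons 0 (pderiv p)) a = of_nat a * coeff p a" for p :: "complex poly"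
    by (cases a) (auto simp: coeff_pderiv)
  have 5: "coeff (pCons 0 (pCons 0 (pderiv p))) a = (of_nat a - 1) * coeff (pCons 0 p) a" for p :: "complex poly"
    by (cases a; cases "a - 1") (auto simp: coeff_pderiv)
  have "dop k1 k2 s t (edet a) z = of_nat k1 * coeff ?G a + of_nat k2 * coeff (pCons 0 ?G) a + coeff ?S a"
    unfolding dop_def 1[symmetric] by (simp add: pd_edet)
  also have "coeff ?S a = - ((of_nat CARD('n) - 1) * coeff ?G a) + of_nat a * coeff ?G a - (of_nat a - 1) * coeff (pCons 0 ?G) a"
    unfolding S by (simp only: coeff_add coeff_diff coeff_minus 3 4 5)
  finally show ?thesis by (simp add: algebra_simps)
qed

section \<open>The second order symbol: bilinear expressions in coefficients of cofactors\<close>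

definition ext_seq :: "nat \<Rightarrow> (nat \<Rightarrow> complex) \<Rightarrow> int \<Rightarrow> complex" where
  "ext_seq n e k = (if 0 \<le> k \<and> k \<le> int n then e (nat k) else 0)"

text \<open>With k = a + b - m nonnegative, this is the coefficient of \<lambda>^a \<mu>^b in the
  polynomial (\<lambda>^(m+1) \<mu>^k - \<lambda>^k \<mu>^(m+1)) / (\<lambda> - \<mu>).\<close>

definition side :: "nat \<Rightarrow> nat \<Rightarrow> nat \<Rightarrow> complex" where
  "side m a b = (if a \<le> m \<and> b \<le> m then 1 else if m < a \<and> m < b then -1 else 0)"

lemma side_Suc_left: "side m a b - side m (Suc a) b = (if m = a then 1 else 0)"
  by (auto simp: side_def)

lemma side_Suc_shift: "side m a (Suc b) - side m (Suc a) b = (if m = a then 1 else 0) - (if m = b then 1 else 0)"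
  by (auto simp: side_def)

text \<open>The recursion determines \<open>w\<close> from its column \<open>b = 0\<close>. Along an
  antidiagonal \<open>side\<close> jumps only at \<open>m = a\<close> and \<open>m = b\<close>,
  which produces the two inhomogeneous terms; the vanishing of \<open>e\<close> and \<open>g\<close>
  covers indices out of range.\<close>

lemma side_recursion:
  fixes g e :: "nat \<Rightarrow> complex"
  assumes w0: "\<And>a. w a 0 = e 0 * g a"
    and wS: "\<And>a b. w a (Suc b) = w (Suc a) b + e (Suc b) * g a - e (Suc a) * g b"
    and e: "\<And>k. k > n \<Longrightarrow> e k = 0" and g: "\<And>k. k \<ge> n \<Longrightarrow> g k = 0"
  shows "w a b = (\<Sum>m<n. g m * (side m a b * ext_seq n e (int a + int b - int m)))"
proof (induction b arbitrary: a)
  case 0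
  have "(\<Sum>m<n. g m * (side m a 0 * ext_seq n e (int a + int 0 - int m))) =
    (\<Sum>m<n. if m = a then g m * e 0 else 0)"
    by (intro sum.cong) (auto simp: side_def ext_seq_def)
  thus ?case using w0 g[of a] by (auto simp: mult.commute)
next
  case (Suc b)
  let ?E = "\<lambda>m. ext_seq n e (int a + int b + 1 - int m)"
  have "(\<Sum>m<n. g m * (side m a (Suc b) * ?E m)) - (\<Sum>m<n. g m * (side m (Suc a) b * ?E m)) =
     (\<Sum>m<n. (side m a (Suc b) - side m (Suc a) b) * (g m * ?E m))"
    by (simp add: sum_subtractf algebra_simps)
  also have "\<dots> = (\<Sum>m<n. (if m = a then g m * ?E m else 0)) - (\<Sum>m<n. if m = b then g m * ?E m else 0)"
    unfolding side_Suc_shift by (simp add: sum_subtractf left_diff_distrib if_distrib[of "\<lambda>x. x * _"] cong: if_cong)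
  also have "\<dots> = e (Suc b) * g a - e (Suc a) * g b"
    using g[of a] g[of b] e[of "Suc a"] e[of "Suc b"] by (auto simp: ext_seq_def nat_add_distrib)
  finally have D: "(\<Sum>m<n. g m * (side m a (Suc b) * ?E m)) =
      (\<Sum>m<n. g m * (side m (Suc a) b * ?E m)) + (e (Suc b) * g a - e (Suc a) * g b)"
    by (simp add: algebra_simps)
  have i1: "int a + int (Suc b) - int m = int a + int b + 1 - int m" for m by simp
  have i2: "int (Suc a) + int b - int m = int a + int b + 1 - int m" for m by simp
  show ?case unfolding wS Suc.IH i1 i2 D by simp
qed

lemma coeff_cof_pencil_eq_0:
  fixes z :: "'n::finite \<times> 'n + 'n \<times> 'n \<Rightarrow> complex"
  assumes "k \<ge> CARD('n)" shows "coeff (cof (pencil z) s t) k = 0"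
proof -
  have "degree (cof (pencil z) s t) \<le> (\<Sum>i\<in>UNIV. if i = s then 0 else 1)"
    unfolding cof_def by (rule degree_det_le) (auto simp: with_row_def axis_def pencil_def)
  also have "\<dots> = CARD('n) - 1" by (simp add: sum.If_cases Compl_eq_Diff_UNIV card_Diff_singleton)
  also have "\<dots> < CARD('n)" by simp
  finally show ?thesis using assms by (intro coeff_eq_0) simp
qed

lemma edet_eq_0:
  fixes z :: "'n::finite \<times> 'n + 'n \<times> 'n \<Rightarrow> complex"
  assumes "k > CARD('n)" shows "edet k z = 0"
proof -
  have "degree (det (pencil z)) \<le> (\<Sum>i\<in>(UNIV::'n set). 1)"
    by (rule degree_det_le) (auto simp: pencil_def)
  thus ?thesis using assms by (simp add: edet_def coeff_eq_0)
qed

text \<open>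
  With \<open>G(\<lambda>)\<close> the cofactor matrix of \<open>W + \<lambda>Z\<close> and \<open>e(\<lambda>)\<close> its determinant, \<open>gam s t a b\<close> is the coefficient of
  \<open>\<lambda>\<^sup>a\<mu>\<^sup>b\<close> in the entry \<open>(s, t)\<close> of \<open>G(\<mu>) (W + \<lambda>\<mu>Z)\<^sup>t G(\<lambda>)\<close>, which by Cramer's rule is
  \<open>(\<mu>(1 - \<lambda>) e(\<lambda>) G(\<mu>) - \<lambda>(1 - \<mu>) e(\<mu>) G(\<lambda>)) / (\<mu> - \<lambda>)\<close>; expanding this quotient gives \<open>kernel_coeff\<close>.
\<close>

definition gam :: "'n \<Rightarrow> 'n \<Rightarrow> nat \<Rightarrow> nat \<Rightarrow> ('n::finite \<times> 'n + 'n \<times> 'n \<Rightarrow> complex) \<Rightarrow> complex" where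
  "gam s t a b z =
    (\<Sum>i\<in>UNIV. \<Sum>j\<in>UNIV. z (Inl (i, j)) * (pd (Inl (s, j)) (edet b) z * pd (Inl (i, t)) (edet a) z)) +
    (\<Sum>i\<in>UNIV. \<Sum>j\<in>UNIV. z (Inr (i, j)) * (pd (Inr (s, j)) (edet b) z * pd (Inr (i, t)) (edet a) z))"

definition kernel_coeff :: "nat \<Rightarrow> (nat \<Rightarrow> complex) \<Rightarrow> nat \<Rightarrow> nat \<Rightarrow> nat \<Rightarrow> complex" where
  "kernel_coeff n e m a b = side m a b *
     (ext_seq n e (int a + int b - int m) - ext_seq n e (int a + int b - int m - 1))"

lemma gam_eq:
  fixes z :: "'n::finite \<times> 'n + 'n \<times> 'n \<Rightarrow> complex"
  shows "gam s t a b z =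
    (\<Sum>m<CARD('n). coeff (cof (pencil z) s t) m * kernel_coeff CARD('n) (\<lambda>a. edet a z) m a b)"
proof -
  let ?n = "CARD('n)"
  define gA where "gA = (\<lambda>i j. coeff (cof (pencil z) i j))"
  define gB where "gB = (\<lambda>i j. coeff (pCons 0 (cof (pencil z) i j)))"
  define W where "W = (\<lambda>i j. z (Inl (i, j)))"
  define Z where "Z = (\<lambda>i j. z (Inr (i, j)))"
  define e where "e = (\<lambda>a. edet a z)"
  have gB: "gB i j 0 = 0" "gB i j (Suc k) = gA i j k" for i j k
    by (auto simp: gA_def gB_def)
  have col: "(\<Sum>i\<in>UNIV. W i j * gA i t a + Z i j * gB i t a) = (if j = t then e a else 0)" for j a
  proof -
    have "(\<Sum>i\<in>UNIV. W i j * gA i t a + Z i j * gB i t a) = 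
        coeff (\<Sum>i\<in>UNIV. pencil z $ i $ j * cof (pencil z) i t) a"
      unfolding coeff_sum W_def Z_def gA_def gB_def coeff_linear_mult[symmetric] 
      by (simp only: pencil_def vec_lambda_beta)
    thus ?thesis by (simp add: mult_cof_col e_def edet_def)
  qed
  have row: "(\<Sum>j\<in>UNIV. W i j * gA s j b + Z i j * gB s j b) = (if i = s then e b else 0)" for i b
  proof -
    have "(\<Sum>j\<in>UNIV. W i j * gA s j b + Z i j * gB s j b) = 
        coeff (\<Sum>j\<in>UNIV. pencil z $ i $ j * cof (pencil z) s j) b"
      unfolding coeff_sum W_def Z_def gA_def gB_def coeff_linear_mult[symmetric] 
      by (simp only: pencil_def vec_lambda_beta)
    thus ?thesis by (simp add: mult_cof_row e_def edet_def)
  qed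
  \<comment> \<open>\<open>w + x\<close> is \<open>gam\<close>. The mixed sums \<open>y\<close> and
    \<open>y'\<close> shift only one of the two cofactors; the column and row forms of Cramer's rule
    express \<open>w + y\<close> and \<open>w + y'\<close>, and raising the index of the unshifted
    cofactor turns either mixed sum into \<open>x\<close>. Eliminating them gives the recursion for
    \<open>w\<close>.\<close>
  define w where "w = (\<lambda>a b. \<Sum>i\<in>UNIV. \<Sum>j\<in>UNIV. W i j * (gA s j b * gA i t a))"
  define x where "x = (\<lambda>a b. \<Sum>i\<in>UNIV. \<Sum>j\<in>UNIV. Z i j * (gB s j b * gB i t a))"
  define y where "y = (\<lambda>a b. \<Sum>i\<in>UNIV. \<Sum>j\<in>UNIV. Z i j * (gA s j b * gB i t a))"
  define y' where "y' = (\<lambda>a b. \<Sum>i\<in>UNIV. \<Sum>j\<in>UNIV. Z i j * (gB s j b * gA i t a))"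
  have wy: "w a b + y a b = e a * gA s t b" for a b
  proof -
    have "w a b + y a b = (\<Sum>i\<in>UNIV. \<Sum>j\<in>UNIV. (W i j * gA i t a + Z i j * gB i t a) * gA s j b)"
      unfolding w_def y_def by (simp add: sum.distrib algebra_simps)
    also have "\<dots> = (\<Sum>j\<in>UNIV. (\<Sum>i\<in>UNIV. W i j * gA i t a + Z i j * gB i t a) * gA s j b)"
      by (subst sum.swap) (simp add: sum_distrib_right)
    finally show ?thesis unfolding col by (simp add: if_distrib[of "\<lambda>x. x * _"] cong: if_cong)
  qed
  have wy': "w a b + y' a b = e b * gA s t a" for a b
  proof -
    have "w a b + y' a b = (\<Sum>i\<in>UNIV. \<Sum>j\<in>UNIV. (W i j * gA s j b + Z i j * gB s j b) * gA i t a)"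
      unfolding w_def y'_def by (simp add: sum.distrib algebra_simps)
    also have "\<dots> = (\<Sum>i\<in>UNIV. (\<Sum>j\<in>UNIV. W i j * gA s j b + Z i j * gB s j b) * gA i t a)"
      by (simp add: sum_distrib_right)
    finally show ?thesis unfolding row by (simp add: if_distrib[of "\<lambda>x. x * _"] cong: if_cong)
  qed
  have yx: "y (Suc a) b = x (Suc a) (Suc b)" "y' a (Suc b) = x (Suc a) (Suc b)" "y' a 0 = 0" "x 0 b = 0" "x a 0 = 0" for a b
    by (simp_all add: x_def y_def y'_def gB)
  have g0: "gA s t k = 0" if "k \<ge> ?n" for k
    using that by (simp add: gA_def coeff_cof_pencil_eq_0)
  have e0: "e k = 0" if "k > ?n" for k
    using that by (simp add: e_def edet_eq_0)
  have w: "w a b = (\<Sum>m<?n. gA s t m * (side m a b * ext_seq ?n e (int a + int b - int m)))" for a b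
  proof (rule side_recursion[OF _ _ e0 g0])
    show "w a 0 = e 0 * gA s t a" for a using wy'[of a 0] by (simp add: yx)
    show "w a (Suc b) = w (Suc a) b + e (Suc b) * gA s t a - e (Suc a) * gA s t b" for a b
      using wy'[of a "Suc b"] wy[of "Suc a" b] unfolding yx by (simp flip: eq_diff_eq)
  qed
  \<comment> \<open>For positive indices \<open>x a b\<close> equals \<open>y' (a - 1) b\<close>,
    hence is known from \<open>w (a - 1) b\<close>; the jump of \<open>side\<close> at
    \<open>m = a - 1\<close> cancels the Cramer term.\<close>
  have x: "x a b = - (\<Sum>m<?n. gA s t m * (side m a b * ext_seq ?n e (int a + int b - int m - 1)))" for a b
  proof (cases "a = 0 \<or> b = 0")
    case True
    hence "side m a b * ext_seq ?n e (int a + int b - int m - 1) = 0" for m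
      by (auto simp: side_def ext_seq_def)
    hence "(\<Sum>m<?n. gA s t m * (side m a b * ext_seq ?n e (int a + int b - int m - 1))) = 0"
      by (simp only: mult_zero_right sum.neutral_const)
    thus ?thesis using True yx by auto
  next
    case False
    then obtain a' b' where ab: "a = Suc a'" "b = Suc b'" by (metis nat.exhaust)
    let ?E = "\<lambda>m. ext_seq ?n e (int a' + int b - int m)"
    have "x a b = e b * gA s t a' - w a' b"
      using wy'[of a' b] by (simp add: ab yx algebra_simps)
    also have "w a' b = (\<Sum>m<?n. gA s t m * (side m a b * ?E m)) +
       (\<Sum>m<?n. (side m a' b - side m (Suc a') b) * (gA s t m * ?E m))"
      unfolding w by (simp add: ab sum.distrib[symmetric] algebra_simps)
    also have "(\<Sum>m<?n. (side m a' b - side m (Suc a') b) * (gA s t m * ?E m)) = e b * gA s t a'"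
      unfolding side_Suc_left using g0[of a'] e0[of b]
      by (auto simp: if_distrib[of "\<lambda>x. x * _"] ext_seq_def cong: if_cong)
    finally have "x a b = - (\<Sum>m<?n. gA s t m * (side m a b * ?E m))" by simp
    moreover have "int a + int b - int m - 1 = int a' + int b - int m" for m by (simp add: ab)
    ultimately show ?thesis by (simp only:)
  qed
  have "gam s t a b z = w a b + x a b"
    by (simp add: gam_def pd_edet w_def x_def W_def Z_def gA_def gB_def)
  also have "\<dots> = (\<Sum>m<?n. gA s t m * kernel_coeff ?n e m a b)"
    unfolding w x kernel_coeff_def by (simp add: sum_subtractf algebra_simps)
  finally show ?thesis by (simp add: gA_def e_def)
qed

section \<open>Descent of the operator to the variables Q_0, ..., Q_n\<close>

definition rop ::
  "nat \<Rightarrow> nat \<Rightarrow> nat \<Rightarrow> nat \<Rightarrow> ((nat \<Rightarrow> complex) \<Rightarrow> complex) \<Rightarrow> (nat \<Rightarrow> complex) \<Rightarrow> complex" where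
  "rop n k1 k2 m F e =
     (of_nat k1 - of_nat n + 1 + of_nat m) * pd m F e + (of_nat k2 - of_nat m) * pd (Suc m) F e +
     (\<Sum>a\<le>n. \<Sum>b\<le>n. pd b (pd a F) e * kernel_coeff n e m a b)"

lemma sum_swap3:
  "(\<Sum>i\<in>A. \<Sum>j\<in>B. \<Sum>a\<in>C. f i j a) = (\<Sum>a\<in>C. \<Sum>i\<in>A. \<Sum>j\<in>B. f i j a)"
proof -
  have "(\<Sum>i\<in>A. \<Sum>j\<in>B. \<Sum>a\<in>C. f i j a) = (\<Sum>i\<in>A. \<Sum>a\<in>C. \<Sum>j\<in>B. f i j a)"
    by (intro sum.cong refl sum.swap)
  thus ?thesis by (simp only: sum.swap[of _ A])
qed

text \<open>The chain rule reduces to \<open>dop_edet\<close> and \<open>gam_eq\<close>, both linear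
  in the coefficients g_m of the cofactor. In \<open>rop\<close> the factor k2 - m of
  \<open>pd (Suc m)\<close> is k2 + 1 - a at a = m + 1.\<close>

lemma dop_compose_edet:
  fixes z :: "'n::finite \<times> 'n + 'n \<times> 'n \<Rightarrow> complex"
  assumes F: "poly_fun {..CARD('n)} F"
  shows "dop k1 k2 s t (\<lambda>z. F (\<lambda>a. edet a z)) z =
    (\<Sum>m<CARD('n). coeff (cof (pencil z) s t) m * rop CARD('n) k1 k2 m F (\<lambda>a. edet a z))"
proof -
  let ?n = "CARD('n)" and ?e = "\<lambda>a. edet a z"
  let ?g = "coeff (cof (pencil z) s t)"
  have 1: "pd k (\<lambda>z. F (\<lambda>a. edet a z)) z = (\<Sum>a\<le>?n. pd a F ?e * pd k (edet a) z)" for k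
    by (subst pd_compose[OF F, where T = UNIV]) (auto simp: poly_fun_edet)
  have 2: "pd j (pd k (\<lambda>z. F (\<lambda>a. edet a z))) z = (\<Sum>a\<le>?n. pd a F ?e * pd j (pd k (edet a)) z) +
       (\<Sum>a\<le>?n. \<Sum>b\<le>?n. pd b (pd a F) ?e * (pd j (edet b) z * pd k (edet a) z))" for j k
    by (subst pd_pd_compose[OF F, where T = UNIV]) (auto simp: poly_fun_edet)
  have 3: "(\<Sum>i\<in>UNIV. \<Sum>j\<in>UNIV. x i j * (\<Sum>a\<le>?n. c a * y a i j)) = (\<Sum>a\<le>?n. c a * (\<Sum>i\<in>UNIV. \<Sum>j\<in>UNIV. x i j * y a i j))"
    for x :: "'n \<Rightarrow> 'n \<Rightarrow> complex" and c y
    unfolding sum_distrib_left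
    by (subst sum_swap3) (simp add: algebra_simps)
  have 4: "(\<Sum>i\<in>UNIV. \<Sum>j\<in>UNIV. x i j * (\<Sum>a\<le>?n. \<Sum>b\<le>?n. c a b * y a b i j)) = 
     (\<Sum>a\<le>?n. \<Sum>b\<le>?n. c a b * (\<Sum>i\<in>UNIV. \<Sum>j\<in>UNIV. x i j * y a b i j))"
    for x :: "'n \<Rightarrow> 'n \<Rightarrow> complex" and c y
  proof -
    have "(\<Sum>i\<in>UNIV. \<Sum>j\<in>UNIV. x i j * (\<Sum>a\<le>?n. \<Sum>b\<le>?n. c a b * y a b i j)) = 
       (\<Sum>a\<le>?n. \<Sum>i\<in>UNIV. \<Sum>j\<in>UNIV. x i j * (\<Sum>b\<le>?n. c a b * y a b i j))"
      using 3[of x "\<lambda>_. 1" "\<lambda>a i j. \<Sum>b\<le>?n. c a b * y a b i j"] by simp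
    thus ?thesis unfolding 3 .
  qed
  have "dop k1 k2 s t (\<lambda>z. F (\<lambda>a. edet a z)) z = 
     (\<Sum>a\<le>?n. pd a F ?e * dop k1 k2 s t (edet a) z) + 
     (\<Sum>a\<le>?n. \<Sum>b\<le>?n. pd b (pd a F) ?e * gam s t a b z)"
    unfolding dop_def gam_def 1 2 distrib_left sum.distrib 3 4
    by (simp add: sum_distrib_left algebra_simps)
  also have "(\<Sum>a\<le>?n. pd a F ?e * dop k1 k2 s t (edet a) z) = 
     (\<Sum>m<?n. ?g m * ((of_nat k1 - of_nat ?n + 1 + of_nat m) * pd m F ?e)) +
     (\<Sum>m<?n. ?g m * ((of_nat k2 - of_nat m) * pd (Suc m) F ?e))"
  proof -
    \<comment> \<open>In the unshifted sum the term a = n drops out because cofactors have degree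
      below n; in the shifted one the term a = 0 drops out and the index moves down by one.\<close>
    have *: "{..?n} = insert ?n {..<?n}" by auto
    have "(\<Sum>a\<le>?n. pd a F ?e * ((of_nat k1 - of_nat ?n + 1 + of_nat a) * ?g a)) =
      (\<Sum>m<?n. ?g m * ((of_nat k1 - of_nat ?n + 1 + of_nat m) * pd m F ?e))"
      by (simp add: * coeff_cof_pencil_eq_0 algebra_simps)
    moreover have "(\<Sum>a\<le>?n. pd a F ?e * ((of_nat k2 + 1 - of_nat a) * coeff (pCons 0 (cof (pencil z) s t)) a)) =
      (\<Sum>m<?n. ?g m * ((of_nat k2 - of_nat m) * pd (Suc m) F ?e))"
      unfolding sum.atMost_shift by (simp add: algebra_simps)
    ultimately show ?thesis unfolding dop_edet distrib_left sum.distrib by simp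
  qed
  also have "(\<Sum>a\<le>?n. \<Sum>b\<le>?n. pd b (pd a F) ?e * gam s t a b z) =
     (\<Sum>m<?n. ?g m * (\<Sum>a\<le>?n. \<Sum>b\<le>?n. pd b (pd a F) ?e * kernel_coeff ?n ?e m a b))"
    unfolding gam_eq sum_distrib_left
    by (subst sum_swap3) (simp add: algebra_simps)
  finally show ?thesis
    by (simp add: rop_def sum.distrib[symmetric] distrib_left)
qed

section \<open>Pencils with prescribed determinant coefficients\<close>

lemma poly_fun_cong: "poly_fun S f \<Longrightarrow> (\<And>i. i \<in> S \<Longrightarrow> z i = z' i) \<Longrightarrow> f z = f z'"
  by (induction rule: poly_fun.induct) auto

text \<open>The vector v with entries (-\<lambda>)^(p j) is annihilated by every row except row
  \<open>s\<close>. Multiplying by the unipotent \<open>U\<close> with v as column \<open>s\<close>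
  clears that column outside row \<open>s\<close>, leaving a triangular matrix whose only diagonal
  entry other than 1 is the product of \<open>r\<close> and v.\<close>

lemma det_companion:
  fixes M :: "complex poly^'n^'n" and p :: "'n \<Rightarrow> nat"
  assumes p: "bij_betw p UNIV {..<CARD('n)}" and s: "p s = 0"
    and M: "\<And>i j. i \<noteq> s \<Longrightarrow> M $ i $ j = (if j = i then 1 else if Suc (p j) = p i then [:0, 1:] else 0)"
  shows "det (with_row M s r) = (\<Sum>j\<in>UNIV. r $ j * monom ((-1) ^ p j) (p j))"
proof -
  have inj: "inj p" and lt: "p j < CARD('n)" for j using p by (auto simp: bij_betw_def)
  define v :: "'n \<Rightarrow> complex poly" where "v j = monom ((-1) ^ p j) (p j)" for j
  define K where "K = with_row M s r"
  define U :: "complex poly^'n^'n" where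
    "U = (\<chi> i j. if j = s then v i else if i = j then 1 else 0)"
  have vs: "v s = 1" by (simp add: v_def s)
  have p0: "p i \<noteq> 0" if "i \<noteq> s" for i using that s inj by (metis injD)
  have "det U = (\<Prod>i\<in>UNIV. U $ i $ i)"
    by (rule det_triangular[OF inj]) (auto simp: U_def s split: if_splits)
  also have "\<dots> = 1" by (rule prod.neutral) (auto simp: U_def vs)
  finally have detU: "det U = 1" .
  have Ks: "K $ s = r" by (simp add: K_def)
  have Ki: "K $ i $ j = M $ i $ j" if "i \<noteq> s" for i j
    using that by (simp add: K_def)
  have Kv: "(\<Sum>j\<in>UNIV. K $ i $ j * v j) = 0" if i: "i \<noteq> s" for i
  proof -
    have "p i - 1 \<in> {..<CARD('n)}" using lt[of i] by simp
    then obtain i' where i': "p i' = p i - 1" using p by (metis bij_betw_iff_bijections)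
    hence pi': "p i = Suc (p i')" using p0[OF i] by simp
    hence eq: "Suc (p j) = p i \<longleftrightarrow> j = i'" for j using inj by (auto dest: injD)
    have "i' \<noteq> i" using pi' by auto
    have "(\<Sum>j\<in>UNIV. K $ i $ j * v j) = (\<Sum>j\<in>UNIV. (if j = i then v j else 0) + (if j = i' then [:0, 1:] * v j else 0))"
      using i \<open>i' \<noteq> i\<close> by (intro sum.cong) (auto simp: K_def M eq)
    also have "\<dots> = v i + [:0, 1:] * v i'" by (simp add: sum.distrib)
    also have "\<dots> = 0" by (simp add: v_def pi' monom_Suc flip: minus_monom)
    finally show ?thesis .
  qed
  have KU: "(K ** U) $ i $ j = (if j = s then (\<Sum>k\<in>UNIV. K $ i $ k * v k) else K $ i $ j)" for i j
    by (simp add: matrix_matrix_mult_def U_def if_distrib[of "\<lambda>x. _ * x"] cong: if_cong)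
  \<comment> \<open>\<open>U\<close> is triangular when \<open>s\<close> has the lowest rank; for
    \<open>K ** U\<close> the full row \<open>s\<close> requires the highest rank, so
    \<open>s\<close> is moved from 0 to n.\<close>
  have inj': "inj (p(s := CARD('n)))"
    using inj lt by (auto simp: inj_on_def) (metis less_irrefl)+
  have "det (K ** U) = (\<Prod>i\<in>UNIV. (K ** U) $ i $ i)"
  proof (rule det_triangular[OF inj'])
    fix i j assume ne: "(K ** U) $ i $ j \<noteq> 0"
    show "(p(s := CARD('n))) j \<le> (p(s := CARD('n))) i"
    proof (cases "i = s")
      case True
      thus ?thesis using lt[of j] by auto
    next
      case False
      hence "j \<noteq> s" "M $ i $ j \<noteq> 0" using ne Kv[OF False] False unfolding KU by (auto simp: K_def split: if_splits)
      thus ?thesis using False by (auto simp: M split: if_splits)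
    qed
  qed
  also have "\<dots> = (K ** U) $ s $ s * (\<Prod>i\<in>UNIV-{s}. (K ** U) $ i $ i)"
    by (rule prod.remove) auto
  also have "(\<Prod>i\<in>UNIV-{s}. (K ** U) $ i $ i) = 1"
    by (rule prod.neutral) (auto simp: KU Ki M)
  finally have "det K = (\<Sum>j\<in>UNIV. r $ j * v j)"
    using detU by (simp add: det_mul KU Ks)
  thus ?thesis by (simp add: K_def v_def)
qed

text \<open>Row \<open>s\<close> holds the prescribed values with the signs of its cofactors, and
  the value for index n as \<lambda>-coefficient of the last column. Cofactors along row
  \<open>s\<close> do not see that row: they are signed distinct powers of \<lambda>, hence
  independent.\<close>

lemma ex_companion_pencil:
  fixes e :: "nat \<Rightarrow> complex"
  obtains z :: "'n::finite \<times> 'n + 'n \<times> 'n \<Rightarrow> complex" and s :: 'n and p :: "'n \<Rightarrow> nat"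
  where "bij_betw p UNIV {..<CARD('n)}" "\<And>a. a \<le> CARD('n) \<Longrightarrow> edet a z = e a"
    "\<And>t m. coeff (cof (pencil z) s t) m = (if m = p t then (-1) ^ m else 0)"
proof -
  let ?n = "CARD('n)"
  obtain p :: "'n \<Rightarrow> nat" where p: "bij_betw p UNIV {..<?n}"
    using ex_bij_betw_finite_nat[of "UNIV :: 'n set"] by (auto simp: atLeast0LessThan)
  have "0 \<in> {..<?n}" by simp
  then obtain s where s: "p s = 0" using p by (metis bij_betw_iff_bijections)
  define z :: "'n \<times> 'n + 'n \<times> 'n \<Rightarrow> complex" where
    "z = case_sum
      (\<lambda>(i, j). if i = s then (-1) ^ p j * e (p j) else if j = i then 1 else 0)
      (\<lambda>(i, j). if i = s then (if Suc (p j) = ?n then (-1) ^ p j * e ?n else 0)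
                else if Suc (p j) = p i then 1 else 0)"
  let ?M = "pencil z"
  have M: "?M $ i $ j = (if j = i then 1 else if Suc (p j) = p i then [:0, 1:] else 0)" if "i \<noteq> s" for i j
    using that by (auto simp: pencil_def z_def one_pCons)
  have D: "det (with_row ?M s r) = (\<Sum>j\<in>UNIV. r $ j * monom ((-1) ^ p j) (p j))" for r
    by (rule det_companion[OF p s M])
  have cof: "cof ?M s t = monom ((-1) ^ p t) (p t)" for t
    unfolding cof_def D by (simp add: axis_def if_distrib[of "\<lambda>x. x * _"] cong: if_cong)
  have "edet a z = e a" if a: "a \<le> ?n" for a
  proof -
    have "edet a z = (\<Sum>j\<in>UNIV. coeff (?M $ s $ j * monom ((-1) ^ p j) (p j)) a)"
      using D[of "?M $ s"] by (simp add: edet_def coeff_sum)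
    also have "\<dots> = (\<Sum>j\<in>UNIV. (if p j = a then e (p j) else 0) + (if p j = ?n - 1 \<and> a = ?n then e ?n else 0))"
    proof (rule sum.cong[OF refl])
      fix j :: 'n
      have 1: "Suc (p j) = ?n \<longleftrightarrow> p j = ?n - 1" by auto
      have "((-1) ^ p j * e (p j)) * (-1) ^ p j = e (p j)" "((-1) ^ p j * e ?n) * (-1) ^ p j = e ?n"
        by (simp_all flip: power_mult_distrib power_add add: mult.assoc mult.left_commute[of _ _ "(-1) ^ _"])
      thus "coeff (?M $ s $ j * monom ((-1) ^ p j) (p j)) a =
        (if p j = a then e (p j) else 0) + (if p j = ?n - 1 \<and> a = ?n then e ?n else 0)"
        by (cases a) (auto simp: pencil_def z_def coeff_linear_mult 1 mult.commute)
    qed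
    also have "\<dots> = (\<Sum>k<?n. (if k = a then e k else 0) + (if k = ?n - 1 \<and> a = ?n then e ?n else 0))"
      by (rule sum.reindex_bij_betw[OF p, of "\<lambda>k. (if k = a then e k else 0) + (if k = ?n - 1 \<and> a = ?n then e ?n else 0)"])
    also have "\<dots> = e a"
    proof (cases "a = ?n")
      case True
      thus ?thesis by (simp add: sum.distrib)
    next
      case False
      thus ?thesis using a by (simp add: sum.distrib)
    qed
    finally show ?thesis .
  qed
  thus ?thesis by (rule that[OF p, of z s]) (simp_all add: cof)
qed

lemma rop_cong:
  assumes F: "poly_fun {..n} F" and m: "m < n" and e: "\<And>a. a \<le> n \<Longrightarrow> e a = e' a"
  shows "rop n k1 k2 m F e = rop n k1 k2 m F e'"
proof -
  have 1: "ext_seq n e = ext_seq n e'" using e by (auto simp: ext_seq_def fun_eq_iff)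
  have 2: "pd a F e = pd a F e'" "pd b (pd a F) e = pd b (pd a F) e'" for a b
    by (rule poly_fun_cong[of "{..n}"]; simp add: poly_fun_pd F e)+
  show ?thesis unfolding rop_def kernel_coeff_def 1 2 ..
qed

text \<open>On a companion pencil the cofactor (s, t) is a single signed power of \<lambda>, so D_st
  isolates one operator R_m; choosing \<open>t\<close> with \<open>p t = m\<close> reaches every
  m.\<close>

lemma rop_eq_0_if_dop_eq_0:
  assumes F: "poly_fun {..CARD('n)} F" and m: "m < CARD('n)"
    and D: "\<And>s t (z :: 'n::finite \<times> 'n + 'n \<times> 'n \<Rightarrow> complex). dop k1 k2 s t (\<lambda>z. F (\<lambda>a. edet a z)) z = 0"
  shows "rop CARD('n) k1 k2 m F e = 0"
proof -
  let ?n = "CARD('n)"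
  obtain z :: "'n \<times> 'n + 'n \<times> 'n \<Rightarrow> complex" and s p
    where p: "bij_betw p UNIV {..<?n}" and e: "\<And>a. a \<le> ?n \<Longrightarrow> edet a z = e a"
    and c: "\<And>t m. coeff (cof (pencil z) s t) m = (if m = p t then (-1) ^ m else 0)"
    by (rule ex_companion_pencil[where 'n = 'n, of e]) (rule that)
  obtain t where t: "p t = m" using p m by (metis bij_betw_iff_bijections lessThan_iff)
  have "0 = (\<Sum>k<?n. (if k = m then (-1) ^ k * rop ?n k1 k2 k F (\<lambda>a. edet a z) else 0))"
    using D[of s t z] unfolding dop_compose_edet[OF F] c t
    by (simp add: if_distrib[of "\<lambda>x. x * _"] cong: if_cong)
  hence "rop ?n k1 k2 m F (\<lambda>a. edet a z) = 0" using m by simp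
  thus ?thesis using rop_cong[OF F m e] by simp
qed

text \<open>Companion pencils realise arbitrary values of Q_0, ..., Q_n; this is their algebraic
  independence.\<close>

lemma eq_0_if_compose_edet_eq_0:
  assumes F: "poly_fun {..CARD('n)} F"
    and 0: "\<And>z :: 'n::finite \<times> 'n + 'n \<times> 'n \<Rightarrow> complex. F (\<lambda>a. edet a z) = 0"
  shows "F e = 0"
proof -
  obtain z :: "'n \<times> 'n + 'n \<times> 'n \<Rightarrow> complex" and s p
    where "bij_betw p UNIV {..<CARD('n)}" and e: "\<And>a. a \<le> CARD('n) \<Longrightarrow> edet a z = e a"
    and "\<And>t m. coeff (cof (pencil z) s t) m = (if m = p t then (-1) ^ m else 0)"
    by (rule ex_companion_pencil[where 'n = 'n, of e]) (rule that)
  show ?thesis using 0[of z] poly_fun_cong[OF F, of "\<lambda>a. edet a z" e] e by simp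
qed

section \<open>Matrix polynomials as functions of their entries\<close>

text \<open>A pair of matrices is encoded as one family over a sum type, so that
  \<open>poly_fun\<close> and \<open>pd\<close> apply; \<open>entries\<close> is the inverse
  passage.\<close>

definition mat1 :: "('r \<times> 'c + 'r \<times> 'c \<Rightarrow> complex) \<Rightarrow> complex^'c^'r" where
  "mat1 z = (\<chi> i u. z (Inl (i, u)))"

definition mat2 :: "('r \<times> 'c + 'r \<times> 'c \<Rightarrow> complex) \<Rightarrow> complex^'c^'r" where
  "mat2 z = (\<chi> i u. z (Inr (i, u)))"

definition entries :: "complex^'c^'r \<Rightarrow> complex^'c^'r \<Rightarrow> 'r \<times> 'c + 'r \<times> 'c \<Rightarrow> complex" where
  "entries x y = case_sum (\<lambda>(i, u). x $ i $ u) (\<lambda>(i, u). y $ i $ u)"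

lemma mat_entries [simp]: "mat1 (entries x y) = x" "mat2 (entries x y) = y"
  by (simp_all add: mat1_def mat2_def entries_def vec_eq_iff)

lemma entries_mat [simp]: "entries (mat1 z) (mat2 z) = z"
  by (auto simp: mat1_def mat2_def entries_def split: sum.splits)

lemma matrix_polynomial_iff: "matrix_polynomial P \<longleftrightarrow> poly_fun UNIV (\<lambda>z. P (mat1 z) (mat2 z))"
proof
  assume "matrix_polynomial P"
  thus "poly_fun UNIV (\<lambda>z. P (mat1 z) (mat2 z))"
    by (induction) (auto simp: mat1_def mat2_def intro: poly_fun.intros)
next
  have "matrix_polynomial (\<lambda>x y. f (entries x y))" if "poly_fun UNIV f" for f :: "('b \<times> 'a + 'b \<times> 'a \<Rightarrow> complex) \<Rightarrow> complex"
    using that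
  proof induction
    case (coord i)
    show ?case by (cases i) (auto simp: entries_def intro: matrix_polynomial.intros)
  qed (auto intro: matrix_polynomial.intros)
  thus "matrix_polynomial P" if "poly_fun UNIV (\<lambda>z. P (mat1 z) (mat2 z))"
    using that by fastforce
qed

lemma mat_nth: "mat1 z $ i $ u = z (Inl (i, u))" "mat2 z $ i $ u = z (Inr (i, u))"
  by (simp_all add: mat1_def mat2_def)

lemma mat_upd:
  "mat1 (z(Inl (s, u) := w)) = set_entry (mat1 z) s u w" "mat2 (z(Inl (s, u) := w)) = mat2 z"
  "mat2 (z(Inr (s, u) := w)) = set_entry (mat2 z) s u w" "mat1 (z(Inr (s, u) := w)) = mat1 z"
  by (auto simp: mat1_def mat2_def set_entry_def vec_eq_iff)

lemma partial_deriv_mixed: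
  "partial_deriv s u (\<lambda>x'. partial_deriv t u' (\<lambda>y'. P x' y') (mat2 z)) (mat1 z) =
     pd (Inl (s, u)) (pd (Inr (t, u')) (\<lambda>z. P (mat1 z) (mat2 z))) z"
proof -
  have "pd (Inr (t, u')) (\<lambda>z. P (mat1 z) (mat2 z)) z = partial_deriv t u' (\<lambda>y'. P (mat1 z) y') (mat2 z)" for z
    unfolding pd_def partial_deriv_def mat_upd by (simp add: mat_nth)
  thus ?thesis
    unfolding pd_def[of "Inl _"] partial_deriv_def[of s] mat_upd by (simp add: mat_nth mat_upd)
qed

lemma pluriharmonic_iff:
  "pluriharmonic P \<longleftrightarrow> matrix_polynomial P \<and>
    (\<forall>s t z. (\<Sum>u\<in>UNIV. pd (Inl (s, u)) (pd (Inr (t, u)) (\<lambda>z. P (mat1 z) (mat2 z))) z) = 0)"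
proof -
  let ?f = "\<lambda>s t z. \<Sum>u\<in>UNIV. pd (Inl (s, u)) (pd (Inr (t, u)) (\<lambda>z. P (mat1 z) (mat2 z))) z"
  have "(\<Sum>u\<in>UNIV. partial_deriv s u (\<lambda>x'. partial_deriv t u (\<lambda>y'. P x' y') y) x) = ?f s t (entries x y)" 
    for s t x y
    using partial_deriv_mixed[of s _ t _ P "entries x y"] by simp
  moreover have "(\<forall>s t x y. ?f s t (entries x y) = 0) \<longleftrightarrow> (\<forall>s t z. ?f s t z = 0)"
  proof safe
    fix s t z assume "\<forall>s t x y. ?f s t (entries x y) = 0"
    hence "?f s t (entries (mat1 z) (mat2 z)) = 0" by blast
    thus "?f s t z = 0" by simp
  qed simp
  ultimately show ?thesis by (simp only: pluriharmonic_def)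
qed

lemma sum_UNIV_sum:
  "(\<Sum>x\<in>UNIV. f x) = (\<Sum>x\<in>UNIV. f (Inl x)) + (\<Sum>x\<in>UNIV. f (Inr x))"
  for f :: "'a::finite + 'b::finite \<Rightarrow> complex"
  unfolding UNIV_Plus_UNIV[symmetric] by (subst sum.Plus) auto

lemma sum_UNIV_prod:
  "(\<Sum>x\<in>UNIV. f x) = (\<Sum>i\<in>UNIV. \<Sum>j\<in>UNIV. f (i, j))"
  for f :: "'a::finite \<times> 'b::finite \<Rightarrow> complex"
  unfolding UNIV_Times_UNIV[symmetric] sum.cartesian_product by simp

section \<open>The Gram substitution and the Laplacians\<close>

definition gram ::
  "('n \<times> ('k1 + 'k2) + 'n \<times> ('k1 + 'k2) \<Rightarrow> complex) \<Rightarrow> ('n \<times> 'n + 'n \<times> 'n \<Rightarrow> complex)" where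
  "gram z = case_sum
     (\<lambda>(i, j). \<Sum>u\<in>(UNIV :: 'k1 set). z (Inl (i, Inl u)) * z (Inr (j, Inl u)))
     (\<lambda>(i, j). \<Sum>u\<in>(UNIV :: 'k2 set). z (Inl (i, Inr u)) * z (Inr (j, Inr u)))"

lemma mat_gram:
  "left_block (mat1 z) ** transpose (left_block (mat2 z)) = mat1 (gram z)"
  "right_block (mat1 z) ** transpose (right_block (mat2 z)) = mat2 (gram z)"
  by (simp_all add: vec_eq_iff matrix_matrix_mult_def left_block_def right_block_def mat1_def
       mat2_def transpose_def gram_def)

lemma poly_fun_gram: "poly_fun UNIV (\<lambda>z. gram z i)"
  by (cases i) (auto simp: gram_def intro!: poly_fun_sum poly_fun.mult poly_fun.coord)

lemma gram_simps:
  fixes z :: "'n \<times> ('k1::finite + 'k2::finite) + 'n \<times> ('k1 + 'k2) \<Rightarrow> complex"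
  shows "gram z (Inl (i, j)) = (\<Sum>u\<in>UNIV. z (Inl (i, Inl u)) * z (Inr (j, Inl u)))"
    "gram z (Inr (i, j)) = (\<Sum>u\<in>UNIV. z (Inl (i, Inr u)) * z (Inr (j, Inr u)))"
  by (simp_all add: gram_def)

lemma pd_sum_coord_mult:
  "pd k (\<lambda>z. \<Sum>u\<in>A. z (f u) * z (g u)) =
    (\<lambda>z. \<Sum>u\<in>A. z (f u) * (if k = g u then 1 else 0) + (if k = f u then 1 else 0) * z (g u))"
  by (subst pd_sum[where S = UNIV])
     (auto intro!: poly_fun.mult poly_fun.coord simp: pd_mult[of UNIV] poly_fun.coord)

lemma pd_gram:
  fixes u :: "'k1::finite" and u' :: "'k2::finite"
  shows
  "pd (Inr (t, Inl u)) (\<lambda>z :: 'n \<times> ('k1 + 'k2) + 'n \<times> ('k1 + 'k2) \<Rightarrow> complex. gram z (Inl (i, j))) = (\<lambda>z. if j = t then z (Inl (i, Inl u)) else 0)"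
  "pd (Inr (t, Inr u')) (\<lambda>z :: 'n \<times> ('k1 + 'k2) + 'n \<times> ('k1 + 'k2) \<Rightarrow> complex. gram z (Inl (i, j))) = (\<lambda>z. 0)"
  "pd (Inr (t, Inl u)) (\<lambda>z :: 'n \<times> ('k1 + 'k2) + 'n \<times> ('k1 + 'k2) \<Rightarrow> complex. gram z (Inr (i, j))) = (\<lambda>z. 0)"
  "pd (Inr (t, Inr u')) (\<lambda>z :: 'n \<times> ('k1 + 'k2) + 'n \<times> ('k1 + 'k2) \<Rightarrow> complex. gram z (Inr (i, j))) = (\<lambda>z. if j = t then z (Inl (i, Inr u')) else 0)"
  "pd (Inl (t, Inl u)) (\<lambda>z :: 'n \<times> ('k1 + 'k2) + 'n \<times> ('k1 + 'k2) \<Rightarrow> complex. gram z (Inl (i, j))) = (\<lambda>z. if i = t then z (Inr (j, Inl u)) else 0)"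
  "pd (Inl (t, Inr u')) (\<lambda>z :: 'n \<times> ('k1 + 'k2) + 'n \<times> ('k1 + 'k2) \<Rightarrow> complex. gram z (Inl (i, j))) = (\<lambda>z. 0)"
  "pd (Inl (t, Inl u)) (\<lambda>z :: 'n \<times> ('k1 + 'k2) + 'n \<times> ('k1 + 'k2) \<Rightarrow> complex. gram z (Inr (i, j))) = (\<lambda>z. 0)"
  "pd (Inl (t, Inr u')) (\<lambda>z :: 'n \<times> ('k1 + 'k2) + 'n \<times> ('k1 + 'k2) \<Rightarrow> complex. gram z (Inr (i, j))) = (\<lambda>z. if i = t then z (Inr (j, Inr u')) else 0)"
  unfolding gram_simps pd_sum_coord_mult
  by (auto simp: if_distrib[of "\<lambda>x. x * _"] if_distrib[of "\<lambda>x. _ * x"] fun_eq_iff cong: if_cong)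

text \<open>A column of block i only meets the Gram matrix of block i. The mixed second derivative
  of its entry (s, t) is 1 for each column, giving k_i copies of the first order term; in the second
  order terms the sum over columns rebuilds the Gram entries.\<close>

lemma laplacian_compose_gram:
  fixes z :: "'n::finite \<times> ('k1::finite + 'k2::finite) + 'n \<times> ('k1 + 'k2) \<Rightarrow> complex"
  assumes Q: "poly_fun UNIV Q"
  shows "(\<Sum>u\<in>UNIV. pd (Inl (s, u)) (pd (Inr (t, u)) (\<lambda>z. Q (gram z))) z) =
    dop CARD('k1) CARD('k2) s t Q (gram z)"
proof -
  let ?d = "\<lambda>b a. pd b (pd a Q) (gram z)"
  have C: "pd j (pd k (\<lambda>z. Q (gram z))) z =
    (\<Sum>a\<in>UNIV. pd a Q (gram z) * pd j (pd k (\<lambda>z. gram z a)) z) +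
    (\<Sum>a\<in>UNIV. \<Sum>b\<in>UNIV. ?d b a * (pd j (\<lambda>z. gram z b) z * pd k (\<lambda>z. gram z a) z))" for j k
    using pd_pd_compose[OF Q, of UNIV "\<lambda>a z. gram z a" j k z] by (simp add: poly_fun_gram)
  have d: "pd k (\<lambda>z :: 'n \<times> ('k1 + 'k2) + 'n \<times> ('k1 + 'k2) \<Rightarrow> complex. if b then z i else 0) = 
    (\<lambda>z. if k = i then if b then 1 else 0 else 0)" for k i and b :: bool
    by (cases b) auto
  have i: "(\<Sum>j\<in>A. if b then f j else 0) = (if b then sum f A else (0 :: complex))" for b A and f :: "'n \<Rightarrow> complex"
    by simp
  note simps = pd_gram d i if_distrib[of "\<lambda>x. x * _"] if_distrib[of "\<lambda>x. _ * x"] algebra_simps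
  have 1: "pd (Inl (s, Inl u)) (pd (Inr (t, Inl u)) (\<lambda>z. Q (gram z))) z = pd (Inl (s, t)) Q (gram z) +
     (\<Sum>i\<in>UNIV. \<Sum>j\<in>UNIV. z (Inl (i, Inl u)) * z (Inr (j, Inl u)) * ?d (Inl (s, j)) (Inl (i, t)))" for u
    unfolding C sum_UNIV_sum sum_UNIV_prod
    by (simp add: simps cong: if_cong)
  have 2: "pd (Inl (s, Inr u)) (pd (Inr (t, Inr u)) (\<lambda>z. Q (gram z))) z = pd (Inr (s, t)) Q (gram z) +
     (\<Sum>i\<in>UNIV. \<Sum>j\<in>UNIV. z (Inl (i, Inr u)) * z (Inr (j, Inr u)) * ?d (Inr (s, j)) (Inr (i, t)))" for u
    unfolding C sum_UNIV_sum sum_UNIV_prod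
    by (simp add: simps cong: if_cong)
  have swap: "(\<Sum>u\<in>UNIV. \<Sum>i\<in>UNIV. \<Sum>j\<in>UNIV. f i u * g j u * h i j) =
    (\<Sum>i\<in>UNIV. \<Sum>j\<in>UNIV. (\<Sum>u\<in>UNIV. f i u * g j u) * h i j)"
    for f g :: "'n \<Rightarrow> 'b::finite \<Rightarrow> complex" and h
    unfolding sum_distrib_right by (rule sum_swap3[symmetric])
  show ?thesis
    unfolding sum_UNIV_sum[where 'a = 'k1 and 'b = 'k2] 1 2 sum.distrib swap
    by (simp add: dop_def gram_simps)
qed

section \<open>The operators on coefficients and the linear relations\<close>

text \<open>The formal counterpart of multiplication by \<open>ext_seq\<close>; likewise
  \<open>rcoef\<close> below is \<open>rop\<close> on coefficients.\<close>

definition mext :: "nat \<Rightarrow> int \<Rightarrow> ((nat \<Rightarrow> nat) \<Rightarrow> complex) \<Rightarrow> (nat \<Rightarrow> nat) \<Rightarrow> complex" where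
  "mext n k c x = (if 0 \<le> k \<and> k \<le> int n then mX (nat k) c x else 0)"

lemma mext_int: "k \<le> n \<Longrightarrow> mext n (int k) c x = mX k c x"
  by (simp add: mext_def)

definition rcoef ::
  "nat \<Rightarrow> nat \<Rightarrow> nat \<Rightarrow> nat \<Rightarrow> ((nat \<Rightarrow> nat) \<Rightarrow> complex) \<Rightarrow> (nat \<Rightarrow> nat) \<Rightarrow> complex" where
  "rcoef n k1 k2 m c x =
     (of_nat k1 - of_nat n + 1 + of_nat m) * dX m c x + (of_nat k2 - of_nat m) * dX (Suc m) c x +
     (\<Sum>a\<le>n. \<Sum>b\<le>n. side m a b *
        (mext n (int a + int b - int m) (dX b (dX a c)) x -
         mext n (int a + int b - int m - 1) (dX b (dX a c)) x))"

lemma coefs_diff: "coefs S c \<Longrightarrow> coefs S d \<Longrightarrow> coefs S (\<lambda>a. c a - d a)"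
  using coefs_add[of S c "\<lambda>a. -1 * d a"] coefs_cmult[of S d "-1"] by simp

lemma ev_diff: "coefs S c \<Longrightarrow> coefs S d \<Longrightarrow> ev S (\<lambda>a. c a - d a) z = ev S c z - ev S d z"
  using ev_add[of S c "\<lambda>a. -1 * d a" z] coefs_cmult[of S d "-1"] ev_cmult[of S d "-1" z] by simp

lemma coefs_mext: "coefs {..n} c \<Longrightarrow> coefs {..n} (mext n k c)"
proof (cases "0 \<le> k \<and> k \<le> int n")
  case True
  hence "mext n k c = mX (nat k) c" for c by (simp add: mext_def fun_eq_iff)
  thus "coefs {..n} c \<Longrightarrow> ?thesis" using True by (simp add: coefs_mX nat_le_iff)
next
  case False
  hence "mext n k c = (\<lambda>x. 0)" for c by (auto simp: mext_def fun_eq_iff)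
  thus ?thesis by (simp add: coefs_0)
qed

lemma ev_mext: "ev {..n} (mext n k c) e = ext_seq n e k * ev {..n} c e"
proof (cases "0 \<le> k \<and> k \<le> int n")
  case True
  hence "mext n k c = mX (nat k) c" for c by (simp add: mext_def fun_eq_iff)
  thus ?thesis using True by (simp add: ev_mX ext_seq_def nat_le_iff)
next
  case False
  hence "mext n k c = (\<lambda>x. 0)" for c by (auto simp: mext_def fun_eq_iff)
  thus ?thesis using False by (auto simp: ext_seq_def)
qed

lemma coefs_rcoef: "coefs {..n} c \<Longrightarrow> coefs {..n} (rcoef n k1 k2 m c)"
  unfolding rcoef_def[abs_def]
  by (intro coefs_add coefs_cmult coefs_sum coefs_diff coefs_mext coefs_dX)

lemma ev_rcoef:
  assumes c: "coefs {..n} c" and m: "m < n"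
  shows "ev {..n} (rcoef n k1 k2 m c) e = rop n k1 k2 m (ev {..n} c) e"
proof -
  note closed = coefs_add coefs_cmult coefs_sum coefs_diff coefs_mext coefs_dX c
  have 1: "side m a b * ev {..n} (\<lambda>x. mext n (int a + int b - int m) (dX b (dX a c)) x -
         mext n (int a + int b - int m - 1) (dX b (dX a c)) x) e = 
       pd b (pd a (ev {..n} c)) e * kernel_coeff n e m a b" if "a \<le> n" "b \<le> n" for a b
    using that
    by (simp add: ev_diff closed ev_mext ev_dX kernel_coeff_def algebra_simps)
  show ?thesis
    unfolding rcoef_def[abs_def] rop_def
    by (subst ev_add; (intro closed)?; subst ev_add; (intro closed)?)
       (use m in \<open>auto simp: ev_cmult ev_sum closed 1 ev_dX intro!: sum.cong\<close>)
qed

section \<open>The operator E on coefficients, and homogeneity\<close>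

definition ecoef ::
  "nat \<Rightarrow> nat \<Rightarrow> nat \<Rightarrow> ((nat \<Rightarrow> nat) \<Rightarrow> complex) \<Rightarrow> (nat \<Rightarrow> nat) \<Rightarrow> complex" where
  "ecoef n k1 k2 c x = (\<Sum>m<n. (of_nat n - of_nat m) * mX m (rcoef n k1 k2 m c) x +
      (of_nat m + 1) * mX (Suc m) (rcoef n k1 k2 m c) x)"

text \<open>The weights are the sums of (W + Z)_st g_m(s, t) over s and t, computed in
  \<open>sum_pencil_coeff_cof\<close>; thus \<open>ecoef\<close> represents E.\<close>

lemma ev_ecoef:
  assumes c: "coefs {..n} c"
  shows "ev {..n} (ecoef n k1 k2 c) e =
    (\<Sum>m<n. ((of_nat n - of_nat m) * e m + (of_nat m + 1) * e (Suc m)) * rop n k1 k2 m (ev {..n} c) e)"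
proof -
  have 1: "coefs {..n} (\<lambda>x. (of_nat n - of_nat m) * mX m (rcoef n k1 k2 m c) x)"
    "coefs {..n} (\<lambda>x. (of_nat m + 1) * mX (Suc m) (rcoef n k1 k2 m c) x)" if "m < n" for m
    by (intro coefs_cmult coefs_mX coefs_rcoef c; use that in simp)+
  have 2: "ev {..n} (\<lambda>x. (of_nat n - of_nat m) * mX m (rcoef n k1 k2 m c) x +
      (of_nat m + 1) * mX (Suc m) (rcoef n k1 k2 m c) x) e =
    ((of_nat n - of_nat m) * e m + (of_nat m + 1) * e (Suc m)) * rop n k1 k2 m (ev {..n} c) e" if "m < n" for m
  proof -
    have "coefs {..n} (mX m (rcoef n k1 k2 m c))" "coefs {..n} (mX (Suc m) (rcoef n k1 k2 m c))"
      using that by (simp_all add: coefs_mX coefs_rcoef c)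
    thus ?thesis
      unfolding ev_add[OF 1[OF that]] using that
      by (simp only: ev_cmult) (simp add: ev_mX ev_rcoef c distrib_right mult.assoc)
  qed
  show ?thesis
    unfolding ecoef_def[abs_def]
    by (subst ev_sum) (auto intro!: sum.cong coefs_add 1 2)
qed

text \<open>The degree is an integer, so that derivatives lower it without truncation at 0.\<close>

definition homogeneous :: "nat \<Rightarrow> int \<Rightarrow> ((nat \<Rightarrow> nat) \<Rightarrow> complex) \<Rightarrow> bool" where
  "homogeneous n d c \<longleftrightarrow> (\<forall>x. c x \<noteq> 0 \<longrightarrow> (\<forall>j>n. x j = 0) \<and> (\<Sum>j\<le>n. int (x j)) = d)"

lemma inc_same: "inc i x i = Suc (x i)" and inc_other: "i \<noteq> j \<Longrightarrow> inc i x j = x j"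
  by (auto simp: inc_def)

lemma sum_inc: "i \<le> (n :: nat) \<Longrightarrow> (\<Sum>j\<le>n. int (inc i x j)) = (\<Sum>j\<le>n. int (x j)) + 1"
proof -
  assume i: "i \<le> n"
  have "(\<Sum>j\<in>{..n} - {i}. int (inc i x j)) = (\<Sum>j\<in>{..n} - {i}. int (x j))"
    by (intro sum.cong) (auto simp: inc_other)
  thus ?thesis
    using i sum.remove[of "{..n}" i "\<lambda>j. int (inc i x j)"] sum.remove[of "{..n}" i "\<lambda>j. int (x j)"]
    by (simp add: inc_same)
qed

lemma homogeneous_dX:
  assumes "homogeneous n d c" "i \<le> n" shows "homogeneous n (d - 1) (dX i c)"
  unfolding homogeneous_def
proof (intro allI impI)
  fix x assume "dX i c x \<noteq> 0"
  hence "c (inc i x) \<noteq> 0" by (auto simp: dX_def)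
  hence "\<forall>j>n. inc i x j = 0" "(\<Sum>j\<le>n. int (inc i x j)) = d"
    using assms(1) by (auto simp: homogeneous_def)
  thus "(\<forall>j>n. x j = 0) \<and> (\<Sum>j\<le>n. int (x j)) = d - 1"
    using assms(2) sum_inc[of i n x] by (auto simp: inc_def)
qed

lemma homogeneous_mX:
  assumes "homogeneous n d c" "i \<le> n" shows "homogeneous n (d + 1) (mX i c)"
  unfolding homogeneous_def
proof (intro allI impI)
  fix x assume "mX i c x \<noteq> 0"
  then obtain y where y: "x = inc i y" "c y \<noteq> 0" using supp_mX[of i c] by auto
  hence "\<forall>j>n. y j = 0" "(\<Sum>j\<le>n. int (y j)) = d" using assms(1) by (auto simp: homogeneous_def)
  thus "(\<forall>j>n. x j = 0) \<and> (\<Sum>j\<le>n. int (x j)) = d + 1"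
    using assms(2) by (simp add: y sum_inc) (simp add: inc_def)
qed

lemma homogeneous_0: "homogeneous n d (\<lambda>x. 0)"
  by (simp add: homogeneous_def)

lemma homogeneous_add:
  "homogeneous n d c \<Longrightarrow> homogeneous n d c' \<Longrightarrow> homogeneous n d (\<lambda>x. c x + c' x)"
  unfolding homogeneous_def by (metis add_0)

lemma homogeneous_diff:
  "homogeneous n d c \<Longrightarrow> homogeneous n d c' \<Longrightarrow> homogeneous n d (\<lambda>x. c x - c' x)"
  unfolding homogeneous_def by (metis diff_self)

lemma homogeneous_cmult: "homogeneous n d c \<Longrightarrow> homogeneous n d (\<lambda>x. r * c x)"
  unfolding homogeneous_def by auto

lemma homogeneous_sum:
  "(\<And>y. y \<in> A \<Longrightarrow> homogeneous n d (c y)) \<Longrightarrow> homogeneous n d (\<lambda>x. \<Sum>y\<in>A. c y x)"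
  by (induction A rule: infinite_finite_induct) (auto intro: homogeneous_add homogeneous_0)

lemma homogeneous_mext:
  assumes "homogeneous n d c" shows "homogeneous n (d + 1) (mext n k c)"
proof (cases "0 \<le> k \<and> k \<le> int n")
  case True
  hence "mext n k c = mX (nat k) c" by (simp add: mext_def fun_eq_iff)
  thus ?thesis using True homogeneous_mX[OF assms, of "nat k"] by (simp add: nat_le_iff)
next
  case False
  hence "mext n k c = (\<lambda>x. 0)" by (auto simp: mext_def fun_eq_iff)
  thus ?thesis by (simp add: homogeneous_0)
qed

lemma homogeneous_rcoef:
  assumes "homogeneous n d c" "m < n" shows "homogeneous n (d - 1) (rcoef n k1 k2 m c)"
proof -
  have "homogeneous n (d - 1) (mext n k (dX b (dX a c)))" if "a \<le> n" "b \<le> n" for a b k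
    using homogeneous_mext[OF homogeneous_dX[OF homogeneous_dX[OF assms(1) that(1)] that(2)], of k] by simp
  thus ?thesis unfolding rcoef_def[abs_def]
    using assms(2)
    by (intro homogeneous_add homogeneous_cmult homogeneous_sum homogeneous_diff homogeneous_dX assms) auto
qed

lemma homogeneous_ecoef:
  assumes "homogeneous n d c" shows "homogeneous n d (ecoef n k1 k2 c)"
proof -
  have "homogeneous n d (mX i (rcoef n k1 k2 m c))" if "i \<le> n" "m < n" for i m
    using homogeneous_mX[OF homogeneous_rcoef[OF assms that(2)] that(1)] by simp
  thus ?thesis unfolding ecoef_def[abs_def]
    by (intro homogeneous_sum homogeneous_add homogeneous_cmult) auto
qed

definition nat_exponents :: "nat \<Rightarrow> nat \<Rightarrow> (nat \<Rightarrow> nat) set" where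
  "nat_exponents n v = {x. (\<forall>j>n. x j = 0) \<and> (\<Sum>j\<le>n. x j) = v}"

lemma finite_nat_exponents: "finite (nat_exponents n v)"
proof (rule finite_subset)
  show "nat_exponents n v \<subseteq> {x. \<forall>j. (j \<in> {..n} \<longrightarrow> x j \<in> {..v}) \<and> (j \<notin> {..n} \<longrightarrow> x j = 0)}"
  proof
    fix x assume x: "x \<in> nat_exponents n v"
    have "x j \<in> {..v}" if "j \<in> {..n}" for j
      using x that member_le_sum[of j "{..n}" x] by (simp add: nat_exponents_def)
    moreover have "x j = 0" if "j \<notin> {..n}" for j using x that by (simp add: nat_exponents_def)
    ultimately show "x \<in> {x. \<forall>j. (j \<in> {..n} \<longrightarrow> x j \<in> {..v}) \<and> (j \<notin> {..n} \<longrightarrow> x j = 0)}" by blast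
  qed
  show "finite {x. \<forall>j. (j \<in> {..n} \<longrightarrow> x j \<in> {..v}) \<and> (j \<notin> {..n} \<longrightarrow> x j = 0)}"
    by (rule finite_set_of_finite_funs) auto
qed

lemma homogeneous_iff: "homogeneous n (int v) c \<longleftrightarrow> (\<forall>x. c x \<noteq> 0 \<longrightarrow> x \<in> nat_exponents n v)"
  unfolding homogeneous_def nat_exponents_def by (auto simp flip: of_nat_sum)

lemma coefs_homogeneous: "homogeneous n (int v) c \<Longrightarrow> coefs {..n} c"
  unfolding coefs_def
  using finite_subset[OF _ finite_nat_exponents[of n v], of "{x. c x \<noteq> 0}"]
  by (auto simp: homogeneous_iff nat_exponents_def)

lemma bij_betw_nat_exponents: "bij_betw (\<lambda>x j. int (x j)) (nat_exponents n v) (exponents n v)"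
proof (rule bij_betwI[where g = "\<lambda>\<alpha> j. nat (\<alpha> j)"])
  show "(\<lambda>x j. int (x j)) \<in> nat_exponents n v \<rightarrow> exponents n v"
    by (auto simp: nat_exponents_def exponents_def)
  show "(\<lambda>\<alpha> j. nat (\<alpha> j)) \<in> exponents n v \<rightarrow> nat_exponents n v"
  proof
    fix \<alpha> assume \<alpha>: "\<alpha> \<in> exponents n v"
    hence "int (\<Sum>j\<le>n. nat (\<alpha> j)) = (\<Sum>j\<le>n. \<alpha> j)"
      unfolding of_nat_sum by (intro sum.cong) (auto simp: exponents_def)
    also have "\<dots> = int v" using \<alpha> by (simp add: exponents_def)
    finally have "(\<Sum>j\<le>n. nat (\<alpha> j)) = v" by (simp only: of_nat_eq_iff)
    thus "(\<lambda>j. nat (\<alpha> j)) \<in> nat_exponents n v"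
      using \<alpha> by (auto simp: nat_exponents_def exponents_def)
  qed
  fix \<alpha> assume "\<alpha> \<in> exponents n v"
  hence "0 \<le> \<alpha> j" for j by (cases "j \<le> n") (auto simp: exponents_def)
  thus "(\<lambda>j. int (nat (\<alpha> j))) = \<alpha>" by auto
qed auto

text \<open>\<open>C\<close> is arbitrary outside \<open>exponents n v\<close>; the cut-off makes
  the family homogeneous and finitely supported.\<close>

definition nat_coefs :: "nat \<Rightarrow> nat \<Rightarrow> ((nat \<Rightarrow> int) \<Rightarrow> complex) \<Rightarrow> (nat \<Rightarrow> nat) \<Rightarrow> complex" where
  "nat_coefs n v C x = (if x \<in> nat_exponents n v then C (\<lambda>j. int (x j)) else 0)"

lemma homogeneous_nat_coefs: "homogeneous n (int v) (nat_coefs n v C)"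
  by (auto simp: homogeneous_iff nat_coefs_def split: if_splits)

lemma ev_nat_coefs:
  "ev {..n} (nat_coefs n v C) e = (\<Sum>\<alpha>\<in>exponents n v. C \<alpha> * (\<Prod>j\<le>n. e j ^ nat (\<alpha> j)))"
proof -
  have "ev {..n} (nat_coefs n v C) e = (\<Sum>x\<in>nat_exponents n v. nat_coefs n v C x * monv {..n} x e)"
    by (rule ev_superset[OF finite_nat_exponents]) (auto simp: nat_coefs_def)
  also have "\<dots> = (\<Sum>x\<in>nat_exponents n v. C (\<lambda>j. int (x j)) * (\<Prod>j\<le>n. e j ^ nat (int (x j))))"
    by (intro sum.cong) (auto simp: nat_coefs_def monv_def)
  also have "\<dots> = (\<Sum>\<alpha>\<in>exponents n v. C \<alpha> * (\<Prod>j\<le>n. e j ^ nat (\<alpha> j)))"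
    by (rule sum.reindex_bij_betw[OF bij_betw_nat_exponents, of "\<lambda>\<alpha>. C \<alpha> * (\<Prod>j\<le>n. e j ^ nat (\<alpha> j))"])
  finally show ?thesis .
qed

section \<open>From the coefficients of the operators to the linear relations\<close>

lemma dX_commute: "dX a (dX b c) = dX b (dX a c)"
proof (cases "a = b")
  case False
  show ?thesis
  proof
    fix x
    have "inc b (inc a x) = inc a (inc b x)" using False by (auto simp: inc_def fun_upd_twist)
    thus "dX a (dX b c) x = dX b (dX a c) x"
      using False by (simp add: dX_def inc_other)
  qed
qed simp

text \<open>Off-diagonal pairs occur in both orders and diagonal ones once, which is the factor 2 -
  \<delta> of the relations.\<close>

lemma sum_symmetric_pairs:
  fixes f :: "nat \<Rightarrow> nat \<Rightarrow> complex"
  assumes "\<And>a b. f a b = f b a"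
  shows "(\<Sum>a\<le>n. \<Sum>b\<le>n. if m < a \<and> m < b then f a b else 0) =
    (\<Sum>(l, l')\<in>{(l, l'). m < l \<and> l \<le> l' \<and> l' \<le> n}. of_int (2 - kronecker l l') * f l l')"
proof -
  let ?A = "{(l, l'). m < l \<and> l < l' \<and> l' \<le> n}" and ?B = "{(l, l'). m < l' \<and> l' < l \<and> l \<le> n}"
  let ?D = "{(l, l'). m < l \<and> l = l' \<and> l' \<le> n}" and ?f = "\<lambda>p. f (fst p) (snd p)"
  have fin: "finite ?A" "finite ?B" "finite ?D"
    by (rule finite_subset[of _ "{..n} \<times> {..n}"]; auto)+
  have "(\<Sum>a\<le>n. \<Sum>b\<le>n. if m < a \<and> m < b then f a b else 0) =
    (\<Sum>x\<in>{..n} \<times> {..n}. if m < fst x \<and> m < snd x then ?f x else 0)"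
    by (simp add: sum.cartesian_product case_prod_beta)
  also have "\<dots> = sum ?f ((?A \<union> ?B) \<union> ?D)"
    by (subst sum.inter_filter[symmetric]) (auto intro!: sum.cong)
  also have "\<dots> = sum ?f ?A + sum ?f ?B + sum ?f ?D"
    by (subst sum.union_disjoint, use fin in simp, use fin in simp, force,
        subst sum.union_disjoint) (use fin in auto)
  also have "sum ?f ?B = sum ?f ?A"
    by (rule sum.reindex_bij_witness[of _ prod.swap prod.swap]) (auto simp: assms)
  also have "sum ?f ?A + sum ?f ?A + sum ?f ?D = 
      (\<Sum>(l, l')\<in>?A. of_int (2 - kronecker l l') * f l l') + (\<Sum>(l, l')\<in>?D. of_int (2 - kronecker l l') * f l l')"
    by (intro arg_cong2[of _ _ _ _ "(+)"])
       (auto simp: sum.distrib[symmetric] kronecker_def intro!: sum.cong)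
  also have "\<dots> = (\<Sum>(l, l')\<in>?A \<union> ?D. of_int (2 - kronecker l l') * f l l')"
    by (subst sum.union_disjoint) (use fin in auto)
  also have "?A \<union> ?D = {(l, l'). m < l \<and> l \<le> l' \<and> l' \<le> n}" by auto
  finally show ?thesis .
qed

text \<open>Treats both sums of the relation together, with \<open>k\<close> standing for l + l' - m
  - 1 or l + l' - m; both are at least l'.\<close>

lemma relation_term_eq:
  assumes x: "x \<in> nat_exponents n v" "0 < x m" and k: "m < l" "l \<le> l'" "l' \<le> k" "k \<le> n"
    and \<beta>: "\<beta> = (\<lambda>j. int (x j)) - unit_tuple m + unit_tuple l + unit_tuple l' - unit_tuple k"
  shows "relation_term C \<beta> l l' =
    of_int (2 - kronecker l l') * mX k (dX l' (dX l (nat_coefs n v C))) (x(m := x m - 1))"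
proof (cases "x k = 0")
  case True
  have "coeff_at C \<beta> * of_int (\<beta> l * (\<beta> l' - kronecker l l')) = 0"
  \<comment> \<open>For \<open>k = l'\<close>, which happens in the first sum at l = m + 1, the
    increment at l' cancels and \<beta>_l' - \<delta> is zero. Otherwise \<beta>_k = -1 and the
    convention on negative components applies.\<close>
  proof (cases "k = l'")
    case kl: True
    have "\<beta> l * (\<beta> l' - kronecker l l') = 0"
      using True k kl by (auto simp: \<beta> unit_tuple_def kronecker_def)
    thus ?thesis by simp
  next
    case False
    hence "\<beta> k < 0" using True k by (simp add: \<beta> unit_tuple_def)
    thus ?thesis by (auto simp: coeff_at_def)
  qed
  thus ?thesis using True k by (auto simp: relation_term_def mX_def)
next
  case False
  \<comment> \<open>The exponent left after lowering \<open>x\<close> at \<open>m\<close> and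
    \<open>k\<close>; raising it at \<open>l\<close> and \<open>l'\<close> gives \<beta>.\<close>
  define w where "w = x(m := x m - 1, k := x k - 1)"
  have wk: "(x(m := x m - 1))(k := (x(m := x m - 1)) k - 1) = w"
    using k by (auto simp: w_def)
  have \<beta>': "\<beta> = (\<lambda>j. int (inc l (inc l' w) j))"
    using k x False by (auto simp: \<beta> w_def inc_def unit_tuple_def fun_eq_iff)
  have "x = inc k (inc m w)" using k x False by (auto simp: w_def inc_def fun_eq_iff)
  moreover have "(\<Sum>j\<le>n. int (x j)) = int v" using x by (simp add: nat_exponents_def flip: of_nat_sum)
  ultimately have "(\<Sum>j\<le>n. int (w j)) + 2 = int v" using k by (simp add: sum_inc)
  hence "(\<Sum>j\<le>n. int (inc l (inc l' w) j)) = int v" using k by (simp add: sum_inc)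
  moreover have "inc l (inc l' w) j = 0" if "j > n" for j 
    using x k that by (auto simp: nat_exponents_def w_def inc_def)
  ultimately have mem: "inc l (inc l' w) \<in> nat_exponents n v"
    by (simp add: nat_exponents_def flip: of_nat_sum)
  have "coeff_at C \<beta> = nat_coefs n v C (inc l (inc l' w))"
    using mem by (simp add: coeff_at_def \<beta>' nat_coefs_def)
  moreover have "\<beta> l = int (Suc (inc l' w l))" "\<beta> l' - kronecker l l' = int (Suc (w l'))"
    by (auto simp: \<beta>' inc_def kronecker_def)
  moreover have "mX k (dX l' (dX l (nat_coefs n v C))) (x(m := x m - 1)) =
     of_nat (Suc (w l')) * (of_nat (Suc (inc l' w l)) * nat_coefs n v C (inc l (inc l' w)))"
    using False k wk by (simp add: mX_def dX_def del: of_nat_Suc)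
  ultimately show ?thesis unfolding relation_term_def by (simp del: of_nat_Suc)
qed

text \<open>The relation is the coefficient of R_m at y = \<alpha> - 1_m. Since y vanishes below m,
  pairs with a, b \<le> m contribute only at a = b = m, and pairs above m give the two sums.\<close>

lemma linear_relation_if_rcoef_eq_0:
  assumes \<alpha>: "\<alpha> \<in> exponents n v" "\<alpha> \<noteq> last_exponent n v"
    and R: "\<And>m x. m < n \<Longrightarrow> rcoef n k1 k2 m (nat_coefs n v C) x = 0"
  shows "linear_relation n k1 k2 C \<alpha>"
proof -
  define m where "m = (LEAST j. \<alpha> j > 0)"
  define c where "c = nat_coefs n v C"
  obtain x where x: "x \<in> nat_exponents n v" "\<alpha> = (\<lambda>j. int (x j))"
    using \<alpha>(1) bij_betw_nat_exponents[of n v] by (auto simp: bij_betw_def)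
  \<comment> \<open>Otherwise the whole degree sits at index n and \<alpha> is the excluded tuple.
    This yields m < n, so that R_m is one of the operators.\<close>
  have "\<exists>j<n. 0 < x j"
  proof (rule ccontr)
    assume "\<not> ?thesis"
    hence 0: "x j = 0" if "j \<noteq> n" for j using that x by (cases "j < n") (auto simp: nat_exponents_def)
    have "(\<Sum>j\<le>n. x j) = x n" using 0 sum.remove[of "{..n}" n x] by simp
    hence "\<alpha> = last_exponent n v" using x 0 by (auto simp: last_exponent_def nat_exponents_def fun_eq_iff)
    thus False using \<alpha> by simp
  qed
  then obtain j0 where j0: "j0 < n" "0 < x j0" by auto
  have j0': "\<alpha> j0 > 0" using j0 x by simp
  have "\<alpha> m > 0" unfolding m_def by (rule LeastI[of _ j0]) fact
  moreover have "m \<le> j0" unfolding m_def by (rule Least_le) fact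
  ultimately have m: "0 < x m" "m < n" using x j0 by simp_all
  have below: "x j = 0" if "j < m" for j
  proof -
    have "\<not> \<alpha> j > 0" using that unfolding m_def by (rule not_less_Least)
    thus ?thesis using x by simp
  qed
  define y where "y = x(m := x m - 1)"
  have xy: "x = inc m y" using m by (auto simp: y_def inc_def fun_eq_iff)
  have cx: "c x = coeff_at C \<alpha>" using x by (simp add: c_def nat_coefs_def coeff_at_def)
  have T1: "dX m c y = coeff_at C \<alpha> * of_int (\<alpha> m)"
    using m x by (simp add: dX_def xy[symmetric] cx) (simp add: y_def)
  have sx: "(\<Sum>j\<le>n. int (x j)) = int v" using x by (simp add: nat_exponents_def flip: of_nat_sum)
  define \<beta> where "\<beta> = \<alpha> - unit_tuple m + unit_tuple (m + 1)"
  have \<beta>': "\<beta> = (\<lambda>j. int (inc (Suc m) y j))"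
    using m x by (auto simp: \<beta>_def y_def inc_def unit_tuple_def fun_eq_iff)
  have T2: "dX (Suc m) c y = coeff_at C \<beta> * of_int (\<beta> (m + 1))"
  proof -
    have "(\<Sum>j\<le>n. int (inc (Suc m) y j)) = int v"
      using sx m unfolding xy by (simp add: sum_inc)
    moreover have "inc (Suc m) y j = 0" if "j > n" for j
      using x m that by (auto simp: nat_exponents_def y_def inc_def)
    ultimately have "inc (Suc m) y \<in> nat_exponents n v"
      by (simp add: nat_exponents_def flip: of_nat_sum)
    hence "c (inc (Suc m) y) = coeff_at C \<beta>" by (simp add: c_def nat_coefs_def coeff_at_def \<beta>')
    thus ?thesis by (simp add: dX_def) (simp add: \<beta>' inc_def)
  qed
  let ?h = "\<lambda>a b k. mext n k (dX b (dX a c)) y"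
  define f where "f a b = ?h a b (int a + int b - int m - 1) - ?h a b (int a + int b - int m)" for a b
  have low: "mext n k d y = 0" if "k < int m" for k d
    using that below by (auto simp: mext_def mX_def y_def)
  have T3: "?h m m (int m) = coeff_at C \<alpha> * of_int (\<alpha> m * (\<alpha> m - 1))"
  proof (cases "y m")
    case 0
    thus ?thesis using m x by (simp add: mext_def mX_def y_def)
  next
    case (Suc r)
    have 1: "inc m (y(m := r)) = y" using Suc by (auto simp: inc_def fun_eq_iff)
    have "x m = Suc (Suc r)" using Suc m by (simp add: y_def)
    thus ?thesis
      using m x Suc by (simp add: mext_def mX_def dX_def 1 xy[symmetric] cx algebra_simps)
  qed
  have "side m a b * (?h a b (int a + int b - int m) - ?h a b (int a + int b - int m - 1)) = 
    (if a = m \<and> b = m then ?h m m (int m) else 0) + (if m < a \<and> m < b then f a b else 0)" for a b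
  proof (cases "a \<le> m \<and> b \<le> m")
    case True
    thus ?thesis using low[of "int a + int b - int m"] low[of "int a + int b - int m - 1"]
      by (auto simp: side_def)
  next
    case False
    thus ?thesis by (auto simp: side_def f_def)
  qed
  hence "(\<Sum>a\<le>n. \<Sum>b\<le>n. side m a b * (?h a b (int a + int b - int m) - ?h a b (int a + int b - int m - 1))) =
    (\<Sum>a\<le>n. \<Sum>b\<le>n. if a = m \<and> b = m then ?h m m (int m) else 0) +
    (\<Sum>a\<le>n. \<Sum>b\<le>n. if m < a \<and> m < b then f a b else 0)"
    by (simp only: sum.distrib)
  also have "(\<Sum>a\<le>n. \<Sum>b\<le>n. if a = m \<and> b = m then ?h m m (int m) else 0) = ?h m m (int m)"
  proof -
    have "(\<Sum>b\<le>n. if a = m \<and> b = m then ?h m m (int m) else 0) = (if a = m then ?h m m (int m) else 0)" for a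
      using m by auto
    thus ?thesis using m by simp
  qed
  also have "(\<Sum>a\<le>n. \<Sum>b\<le>n. if m < a \<and> m < b then f a b else 0) =
      (\<Sum>(l, l')\<in>{(l, l'). m < l \<and> l \<le> l' \<and> l' \<le> n}. of_int (2 - kronecker l l') * f l l')"
    by (rule sum_symmetric_pairs) (simp add: f_def dX_commute add.commute)
  also have "\<dots> = (\<Sum>(l, l')\<in>{(l, l'). m < l \<and> l \<le> l' \<and> l' \<le> n}.
        of_int (2 - kronecker l l') * ?h l l' (int l + int l' - int m - 1)) -
      (\<Sum>(l, l')\<in>{(l, l'). m < l \<and> l \<le> l' \<and> l' \<le> n}.
        of_int (2 - kronecker l l') * ?h l l' (int l + int l' - int m))"
    by (simp add: sum_subtractf[symmetric] f_def case_prod_beta right_diff_distrib)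
  also have "(\<Sum>(l, l')\<in>{(l, l'). m < l \<and> l \<le> l' \<and> l' \<le> n}.
        of_int (2 - kronecker l l') * ?h l l' (int l + int l' - int m - 1)) =
      (\<Sum>(l, l')\<in>{(l, l'). m < l \<and> l \<le> l' \<and> l' \<le> n \<and> l + l' - m - 1 \<le> n}.
         relation_term C (shift_tilde \<alpha> m l l') l l')"
  \<comment> \<open>\<open>mext\<close> kills indices above \<open>n\<close>; this is the additional
    constraint on the summation range of the relation.\<close>
  proof (rule sum.mono_neutral_cong_right)
    show "finite {(l, l'). m < l \<and> l \<le> l' \<and> l' \<le> n}"
      by (rule finite_subset[of _ "{..n} \<times> {..n}"]) auto
    fix p assume "p \<in> {(l, l'). m < l \<and> l \<le> l' \<and> l' \<le> n \<and> l + l' - m - 1 \<le> n}"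
    then obtain l l' where p: "p = (l, l')" "m < l" "l \<le> l'" "l' \<le> n" "l + l' - m - 1 \<le> n" by auto
    have "int l + int l' - int m - 1 = int (l + l' - m - 1)" using p by simp
    hence "?h l l' (int l + int l' - int m - 1) = mX (l + l' - m - 1) (dX l' (dX l c)) y"
      using p by (simp only: mext_int)
    moreover have "relation_term C (shift_tilde \<alpha> m l l') l l' =
       of_int (2 - kronecker l l') * mX (l + l' - m - 1) (dX l' (dX l c)) y"
      unfolding c_def y_def shift_tilde_def x(2) by (rule relation_term_eq[OF x(1) m(1)]) (use p in auto)
    ultimately show "(case p of (l, l') \<Rightarrow> of_int (2 - kronecker l l') * ?h l l' (int l + int l' - int m - 1)) =
       (case p of (l, l') \<Rightarrow> relation_term C (shift_tilde \<alpha> m l l') l l')"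
      by (simp add: p)
  qed (auto simp: mext_def split: if_splits)
  also have "(\<Sum>(l, l')\<in>{(l, l'). m < l \<and> l \<le> l' \<and> l' \<le> n}.
        of_int (2 - kronecker l l') * ?h l l' (int l + int l' - int m)) =
      (\<Sum>(l, l')\<in>{(l, l'). m < l \<and> l \<le> l' \<and> l' \<le> n \<and> l + l' - m \<le> n}.
         relation_term C (shift \<alpha> m l l') l l')"
  proof (rule sum.mono_neutral_cong_right)
    show "finite {(l, l'). m < l \<and> l \<le> l' \<and> l' \<le> n}"
      by (rule finite_subset[of _ "{..n} \<times> {..n}"]) auto
    fix p assume "p \<in> {(l, l'). m < l \<and> l \<le> l' \<and> l' \<le> n \<and> l + l' - m \<le> n}"
    then obtain l l' where p: "p = (l, l')" "m < l" "l \<le> l'" "l' \<le> n" "l + l' - m \<le> n" by auto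
    have "int l + int l' - int m = int (l + l' - m)" using p by simp
    hence "?h l l' (int l + int l' - int m) = mX (l + l' - m) (dX l' (dX l c)) y"
      using p by (simp only: mext_int)
    moreover have "relation_term C (shift \<alpha> m l l') l l' =
       of_int (2 - kronecker l l') * mX (l + l' - m) (dX l' (dX l c)) y"
      unfolding c_def y_def shift_def x(2) by (rule relation_term_eq[OF x(1) m(1)]) (use p in auto)
    ultimately show "(case p of (l, l') \<Rightarrow> of_int (2 - kronecker l l') * ?h l l' (int l + int l' - int m)) =
       (case p of (l, l') \<Rightarrow> relation_term C (shift \<alpha> m l l') l l')"
      by (simp add: p)
  qed (auto simp: mext_def split: if_splits)
  finally have S: "(\<Sum>a\<le>n. \<Sum>b\<le>n. side m a b * (?h a b (int a + int b - int m) - ?h a b (int a + int b - int m - 1))) =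
    ?h m m (int m) +
    ((\<Sum>(l, l')\<in>{(l, l'). m < l \<and> l \<le> l' \<and> l' \<le> n \<and> l + l' - m - 1 \<le> n}.
         relation_term C (shift_tilde \<alpha> m l l') l l') -
     (\<Sum>(l, l')\<in>{(l, l'). m < l \<and> l \<le> l' \<and> l' \<le> n \<and> l + l' - m \<le> n}.
         relation_term C (shift \<alpha> m l l') l l'))" .
  have "0 = rcoef n k1 k2 m c y" using R[OF m(2)] by (simp add: c_def)
  also have "\<dots> = (of_nat k1 - of_nat n + 1 + of_nat m) * (coeff_at C \<alpha> * of_int (\<alpha> m)) +
     (of_nat k2 - of_nat m) * (coeff_at C \<beta> * of_int (\<beta> (m + 1))) + (coeff_at C \<alpha> * of_int (\<alpha> m * (\<alpha> m - 1)) +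
    ((\<Sum>(l, l')\<in>{(l, l'). m < l \<and> l \<le> l' \<and> l' \<le> n \<and> l + l' - m - 1 \<le> n}.
         relation_term C (shift_tilde \<alpha> m l l') l l') -
     (\<Sum>(l, l')\<in>{(l, l'). m < l \<and> l \<le> l' \<and> l' \<le> n \<and> l + l' - m \<le> n}.
         relation_term C (shift \<alpha> m l l') l l')))"
    unfolding rcoef_def S T1 T2 T3 ..
  finally show ?thesis
    unfolding linear_relation_def Let_def m_def[symmetric] \<beta>_def[symmetric]
    by (simp add: algebra_simps)
qed

section \<open>Uniqueness and existence of solutions\<close>

text \<open>Downward induction on the number m of leading zeros, then induction on \<alpha>_m. The
  relation expresses C(\<alpha>) through tuples with the same zeros and a smaller m-th entry; its
  factor \<alpha>_m (k1 + 1 - n + m) + \<alpha>_m (\<alpha>_m - 1) is positive because k1 \<ge>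
  n.\<close>

lemma relations_unique:
  assumes C: "satisfies_relations n k1 k2 v C" and C': "satisfies_relations n k1 k2 v C'"
    and last: "C (last_exponent n v) = C' (last_exponent n v)" and k1: "n \<le> k1"
    and \<alpha>: "\<alpha> \<in> exponents n v"
  shows "C \<alpha> = C' \<alpha>"
proof -
  have cancel: "a * (p + q) = a' * (p + q)"
    if "0 = a * p + b + a * q + s - r" "0 = a' * p + b + a' * q + s - r" for a a' b p q r s :: complex
  proof -
    have "a * (p + q) - a' * (p + q) = (a * p + b + a * q + s - r) - (a' * p + b + a' * q + s - r)"
      by (simp add: algebra_simps)
    thus ?thesis unfolding that[symmetric] by simp
  qed
  have nonneg: "0 \<le> \<beta> j" if "\<beta> \<in> exponents n v" for \<beta> j
    using that by (cases "j \<le> n") (auto simp: exponents_def)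
  have *: "\<forall>\<alpha>\<in>exponents n v. (\<forall>j<m. \<alpha> j = 0) \<longrightarrow> C \<alpha> = C' \<alpha>" if "m \<le> n" for m
    using that
  proof (induction rule: inc_induct)
    case base
    show ?case
    proof safe
      fix \<alpha> assume \<alpha>: "\<alpha> \<in> exponents n v" "\<forall>j<n. \<alpha> j = 0"
      hence "(\<Sum>j\<le>n. \<alpha> j) = \<alpha> n" using sum.remove[of "{..n}" n \<alpha>] by simp
      hence "\<alpha> = last_exponent n v"
        using \<alpha> by (auto simp: exponents_def last_exponent_def fun_eq_iff) (metis linorder_neqE_nat)
      thus "C \<alpha> = C' \<alpha>" using last by simp
    qed
  next
    case (step m)
    have "\<forall>\<alpha>\<in>exponents n v. (\<forall>j<m. \<alpha> j = 0) \<longrightarrow> \<alpha> m = int r \<longrightarrow> C \<alpha> = C' \<alpha>" for r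
    proof (induction r)
      case 0
      show ?case
      proof safe
        fix \<alpha> assume \<alpha>: "\<alpha> \<in> exponents n v" "\<forall>j<m. \<alpha> j = 0" "\<alpha> m = int 0"
        hence "\<forall>j<Suc m. \<alpha> j = 0" by (simp add: less_Suc_eq)
        thus "C \<alpha> = C' \<alpha>" using step.IH \<alpha>(1) by blast
      qed
    next
      case (Suc r)
      show ?case
      proof safe
        fix \<alpha> assume \<alpha>: "\<alpha> \<in> exponents n v" "\<forall>j<m. \<alpha> j = 0" "\<alpha> m = int (Suc r)"
        have least: "(LEAST j. \<alpha> j > 0) = m"
          using \<alpha> by (intro Least_equality) (auto simp: not_less[symmetric])
        have "\<alpha> \<noteq> last_exponent n v"
          using \<alpha>(3) step.hyps by (auto simp: last_exponent_def)
        hence rel: "linear_relation n k1 k2 C \<alpha>" "linear_relation n k1 k2 C' \<alpha>"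
          using C C' \<alpha>(1) by (auto simp: satisfies_relations_def)
        \<comment> \<open>Covers every other tuple of the relation: the induction hypothesis applies
          if it is nonnegative, and otherwise both coefficients are zero by convention.\<close>
        have low: "coeff_at C \<beta> = coeff_at C' \<beta>"
          if \<beta>: "\<beta> m = int r" "\<And>j. j < m \<Longrightarrow> \<beta> j = 0" "\<And>j. j > n \<Longrightarrow> \<beta> j = 0"
            "(\<Sum>j\<le>n. \<beta> j) = int v" for \<beta>
        proof (cases "\<exists>j. \<beta> j < 0")
          case False
          hence "\<beta> \<in> exponents n v" using \<beta> by (auto simp: exponents_def not_less)
          thus ?thesis using Suc.IH \<beta> False by (simp add: coeff_at_def)
        qed (simp add: coeff_at_def)
        have sum_unit: "(\<Sum>j\<le>n. unit_tuple i j) = 1" if "i \<le> n" for i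
          using that by (simp add: unit_tuple_def)
        have mn: "m < n" using step.hyps by simp
        have out: "\<alpha> j = 0" if "j > n" for j using \<alpha>(1) that by (simp add: exponents_def)
        have sum\<alpha>: "(\<Sum>j\<le>n. \<alpha> j) = int v" using \<alpha>(1) by (simp add: exponents_def)
        have t1: "coeff_at C (\<alpha> - unit_tuple m + unit_tuple (m + 1)) =
            coeff_at C' (\<alpha> - unit_tuple m + unit_tuple (m + 1))"
          using \<alpha> mn out sum\<alpha>
          by (intro low) (auto simp: sum.distrib sum_subtractf sum_unit, auto simp: unit_tuple_def)
        have t2: "relation_term C (\<alpha> - unit_tuple m + unit_tuple l + unit_tuple l' - unit_tuple k) l l' =
          relation_term C' (\<alpha> - unit_tuple m + unit_tuple l + unit_tuple l' - unit_tuple k) l l'"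
          if "m < l" "l \<le> l'" "l' \<le> k" "k \<le> n" for l l' k
        proof -
          have "coeff_at C (\<alpha> - unit_tuple m + unit_tuple l + unit_tuple l' - unit_tuple k) =
            coeff_at C' (\<alpha> - unit_tuple m + unit_tuple l + unit_tuple l' - unit_tuple k)"
            using \<alpha> mn out sum\<alpha> that
            by (intro low) (auto simp: sum.distrib sum_subtractf sum_unit, auto simp: unit_tuple_def)
          thus ?thesis by (simp add: relation_term_def)
        qed
        have s1: "(\<Sum>(l, l') \<in> {(l, l'). m < l \<and> l \<le> l' \<and> l' \<le> n \<and> l + l' - m - 1 \<le> n}.
                relation_term C (shift_tilde \<alpha> m l l') l l') =
            (\<Sum>(l, l') \<in> {(l, l'). m < l \<and> l \<le> l' \<and> l' \<le> n \<and> l + l' - m - 1 \<le> n}.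
                relation_term C' (shift_tilde \<alpha> m l l') l l')"
          unfolding shift_tilde_def by (intro sum.cong refl) (auto intro!: t2)
        have s2: "(\<Sum>(l, l') \<in> {(l, l'). m < l \<and> l \<le> l' \<and> l' \<le> n \<and> l + l' - m \<le> n}.
                relation_term C (shift \<alpha> m l l') l l') =
            (\<Sum>(l, l') \<in> {(l, l'). m < l \<and> l \<le> l' \<and> l' \<le> n \<and> l + l' - m \<le> n}.
                relation_term C' (shift \<alpha> m l l') l l')"
          unfolding shift_def by (intro sum.cong refl) (auto intro!: t2)
        let ?d = "\<alpha> m * (int k1 + 1 - int n + int m) + \<alpha> m * (\<alpha> m - 1)"
        have at: "coeff_at C \<alpha> = C \<alpha>" "coeff_at C' \<alpha> = C' \<alpha>"
        proof -
          have "\<not> (\<exists>j. \<alpha> j < 0)" using nonneg[OF \<alpha>(1)] by (meson not_less)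
          thus "coeff_at C \<alpha> = C \<alpha>" "coeff_at C' \<alpha> = C' \<alpha>" by (simp_all only: coeff_at_def if_False)
        qed
        have "C \<alpha> * of_int ?d = C' \<alpha> * of_int ?d"
          using rel unfolding linear_relation_def Let_def least t1 s1 s2 at of_int_add
          by (rule cancel)
        moreover have "?d > 0"
          using \<alpha>(3) k1 by (intro add_pos_nonneg mult_pos_pos mult_nonneg_nonneg) auto
        ultimately show "C \<alpha> = C' \<alpha>" by (metis mult_cancel_right of_int_eq_0_iff less_irrefl)
      qed
    qed
    thus ?case using nonneg by (metis nonneg_int_cases)
  qed
  show ?thesis using *[of 0] \<alpha> by simp
qed

text \<open>If \<open>T\<close> were injective, the images of the unit vectors together with
  \<open>d\<close> would be card A + 1 independent vectors in a space of dimension at most card A.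
  \<open>L\<close> is linear on families supported in \<open>A\<close> only, since \<open>ev\<close>
  need not be additive on infinite supports.\<close>

lemma ex_kernel_if_functional_vanishes_on_range:
  fixes T :: "('x \<Rightarrow> complex) \<Rightarrow> 'x \<Rightarrow> complex" and L :: "('x \<Rightarrow> complex) \<Rightarrow> complex"
  assumes "finite A" and T: "\<And>c d r. T (\<lambda>x. c x + r * d x) = (\<lambda>x. T c x + r * T d x)"
    and supp: "\<And>c. (\<And>x. x \<notin> A \<Longrightarrow> c x = 0) \<Longrightarrow> (\<And>x. x \<notin> A \<Longrightarrow> T c x = 0)"
    and L: "\<And>c d r. (\<And>x. x \<notin> A \<Longrightarrow> c x = 0) \<Longrightarrow> (\<And>x. x \<notin> A \<Longrightarrow> d x = 0) \<Longrightarrow> 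
       L (\<lambda>x. c x + r * d x) = L c + r * L d"
    and LT: "\<And>c. (\<And>x. x \<notin> A \<Longrightarrow> c x = 0) \<Longrightarrow> L (T c) = 0"
    and d: "\<And>x. x \<notin> A \<Longrightarrow> d x = 0" "L d \<noteq> 0"
  obtains c where "c \<noteq> (\<lambda>x. 0)" "\<And>x. x \<notin> A \<Longrightarrow> c x = 0" "T c = (\<lambda>x. 0)"
proof (rule ccontr)
  assume not: "\<not> thesis"
  have inj: "c = (\<lambda>x. 0)" if "\<And>x. x \<notin> A \<Longrightarrow> c x = 0" "T c = (\<lambda>x. 0)" for c
    using not that(1) that(2) \<open>\<And>c. c \<noteq> (\<lambda>x. 0) \<Longrightarrow> (\<And>x. x \<notin> A \<Longrightarrow> c x = 0) \<Longrightarrow> T c = (\<lambda>x. 0) \<Longrightarrow> thesis\<close>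
    by blast
  interpret vs: vector_space "\<lambda>(r :: complex) f (x :: 'x). r * f x"
    by unfold_locales (auto simp: fun_eq_iff algebra_simps)
  define u :: "'x \<Rightarrow> 'x \<Rightarrow> complex" where "u a = (\<lambda>x. if x = a then 1 else 0)" for a
  have u: "x \<notin> A \<Longrightarrow> u a x = 0" if "a \<in> A" for a x using that by (auto simp: u_def)
  have T0: "T (\<lambda>x. 0) = (\<lambda>x. 0)" using T[of "\<lambda>x. 0" "-1" "\<lambda>x. 0"] by (simp add: fun_eq_iff)
  have Tsum: "T (\<lambda>x. \<Sum>a\<in>S. r a * u a x) = (\<lambda>x. \<Sum>a\<in>S. r a * T (u a) x)" if "finite S" for S r
    using that
  proof induction
    case empty
    thus ?case using T0 by simp
  next
    case (insert a S)
    have "T (\<lambda>x. (\<Sum>a\<in>S. r a * u a x) + r a * u a x) = (\<lambda>x. (\<Sum>a\<in>S. r a * T (u a) x) + r a * T (u a) x)"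
      unfolding T insert.IH ..
    thus ?case using insert.hyps by (simp add: add.commute)
  qed
  have inj_on: "inj_on (\<lambda>a. T (u a)) A"
  proof (rule inj_onI)
    fix a b assume ab: "a \<in> A" "b \<in> A" "T (u a) = T (u b)"
    have z: "T (\<lambda>x. u a x + (-1) * u b x) = (\<lambda>x. 0)" unfolding T using ab by simp
    have "(\<lambda>x. u a x + (-1) * u b x) = (\<lambda>x. 0)"
      by (rule inj[OF _ z]) (simp_all add: u ab)
    from fun_cong[OF this, of a] show "a = b" by (simp add: u_def split: if_splits)
  qed
  have fsum: "sum f S = (\<lambda>x. \<Sum>y\<in>S. f y x)" for f :: "'y \<Rightarrow> 'x \<Rightarrow> complex" and S
    by (induction S rule: infinite_finite_induct) (auto simp: fun_eq_iff)
  let ?B = "u ` A" and ?TB = "(\<lambda>a. T (u a)) ` A"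
  have ind: "vs.independent ?TB"
  proof (rule vs.independent_if_scalars_zero)
    fix f y assume "(\<Sum>y\<in>?TB. (\<lambda>x. f y * y x)) = 0" and y: "y \<in> ?TB"
    hence "(\<lambda>x. \<Sum>a\<in>A. f (T (u a)) * T (u a) x) = (\<lambda>x. 0)"
      unfolding fsum by (subst (asm) sum.reindex[OF inj_on]) (simp add: fun_eq_iff)
    hence Tz: "T (\<lambda>x. \<Sum>a\<in>A. f (T (u a)) * u a x) = (\<lambda>x. 0)"
      unfolding Tsum[OF \<open>finite A\<close>] .
    have z: "(\<lambda>x. \<Sum>a\<in>A. f (T (u a)) * u a x) = (\<lambda>x. 0)"
      by (rule inj[OF _ Tz]) (auto intro!: sum.neutral simp: u)
    obtain b where b: "b \<in> A" "y = T (u b)" using y by auto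
    have "(\<Sum>a\<in>A. f (T (u a)) * u a b) = (\<Sum>a\<in>A. if b = a then f (T (u a)) else 0)"
      by (intro sum.cong) (auto simp: u_def)
    thus "f y = 0" using fun_cong[OF z, of b] b \<open>finite A\<close> by simp
  qed (use \<open>finite A\<close> in simp)
  have span: "c \<in> vs.span ?B" if "\<And>x. x \<notin> A \<Longrightarrow> c x = 0" for c
  proof -
    have "c = (\<Sum>a\<in>A. (\<lambda>x. c a * u a x))"
      unfolding fsum using that \<open>finite A\<close>
      by (auto simp: fun_eq_iff u_def if_distrib[of "\<lambda>x. _ * x"] cong: if_cong)
    moreover have "(\<Sum>a\<in>A. (\<lambda>x. c a * u a x)) \<in> vs.span ?B"
      by (intro vs.span_sum vs.span_scale vs.span_base) auto
    ultimately show ?thesis by simp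
  qed
  let ?V = "{c. (\<forall>x. x \<notin> A \<longrightarrow> c x = 0) \<and> L c = 0}"
  have L0: "L (\<lambda>x. 0) = 0" using L[of "\<lambda>x. 0" "\<lambda>x. 0" "-1"] by simp
  have "vs.subspace ?V"
    unfolding vs.subspace_def
  proof (intro conjI ballI allI)
    show "0 \<in> ?V" using L0 by (simp add: zero_fun_def)
    fix c c' assume cc: "c \<in> ?V" "c' \<in> ?V"
    show "c + c' \<in> ?V" using cc L[of c c' 1] by (simp add: plus_fun_def)
    show "(\<lambda>x. r * c x) \<in> ?V" for r using cc L[of "\<lambda>x. 0" c r] L0 by simp
  qed
  moreover have "?TB \<subseteq> ?V" using u supp LT by auto
  ultimately have "vs.span ?TB \<subseteq> ?V" by (intro vs.span_minimal)
  hence nd: "d \<notin> vs.span ?TB" using d by auto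
  hence "vs.independent (insert d ?TB)" using ind by (rule vs.independent_insertI)
  moreover have "insert d ?TB \<subseteq> vs.span ?B" using d u supp by (auto intro!: span)
  ultimately have "card (insert d ?TB) \<le> card ?B"
    using vs.independent_span_bound[of ?B "insert d ?TB"] \<open>finite A\<close> by blast
  moreover have "d \<notin> ?TB" by (rule contra_subsetD[OF vs.span_superset nd])
  moreover have "card ?TB = card A" using inj_on by (rule card_image)
  moreover have "card ?B \<le> card A" using \<open>finite A\<close> by (rule card_image_le)
  ultimately show False using \<open>finite A\<close> by simp
qed

section \<open>Linearity of the operators and a nontrivial kernel of E\<close>

lemma dX_linear: "dX i (\<lambda>x. c x + r * d x) = (\<lambda>x. dX i c x + r * dX i d x)"
  by (auto simp: dX_def fun_eq_iff algebra_simps)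

lemma mX_linear: "mX i (\<lambda>x. c x + r * d x) = (\<lambda>x. mX i c x + r * mX i d x)"
  by (auto simp: mX_def fun_eq_iff)

lemma mext_linear: "mext n k (\<lambda>x. c x + r * d x) = (\<lambda>x. mext n k c x + r * mext n k d x)"
  by (auto simp: mext_def fun_eq_iff mX_linear)

lemma rcoef_linear:
  "rcoef n k1 k2 m (\<lambda>x. c x + r * d x) = (\<lambda>x. rcoef n k1 k2 m c x + r * rcoef n k1 k2 m d x)"
  unfolding rcoef_def dX_linear mext_linear
  by (simp add: fun_eq_iff sum_distrib_left algebra_simps flip: sum.distrib sum_subtractf)

lemma ecoef_linear:
  "ecoef n k1 k2 (\<lambda>x. c x + r * d x) = (\<lambda>x. ecoef n k1 k2 c x + r * ecoef n k1 k2 d x)"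
  unfolding ecoef_def rcoef_linear mX_linear
  by (simp add: fun_eq_iff sum_distrib_left algebra_simps flip: sum.distrib sum_subtractf)

text \<open>Write W + Z = (W + \<lambda>Z) + (1 - \<lambda>) Z. Paired with the cofactors, the first
  summand gives n times the determinant, and Z gives its derivative in \<lambda>.\<close>

lemma sum_pencil_coeff_cof:
  fixes z :: "'n::finite \<times> 'n + 'n \<times> 'n \<Rightarrow> complex"
  shows "(\<Sum>s\<in>UNIV. \<Sum>t\<in>UNIV. (z (Inl (s, t)) + z (Inr (s, t))) * coeff (cof (pencil z) s t) m) =
    (of_nat CARD('n) - of_nat m) * edet m z + (of_nat m + 1) * edet (Suc m) z"
proof -
  let ?M = "pencil z" and ?Z = "\<lambda>s t. [:z (Inr (s, t)):]"
  have 1: "(\<Sum>s\<in>UNIV. \<Sum>t\<in>UNIV. ?M $ s $ t * cof ?M s t) = of_nat CARD('n) * det ?M"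
    by (simp add: mult_cof_row)
  have 2: "(\<Sum>s\<in>UNIV. \<Sum>t\<in>UNIV. ?Z s t * cof ?M s t) = pderiv (det ?M)"
  proof -
    have "(\<chi> j. pderiv (?M $ i $ j)) = (\<chi> j. ?Z i j)" for i
      by (simp add: vec_eq_iff pencil_def pderiv_pCons)
    thus ?thesis by (simp add: pderiv_det det_with_row)
  qed
  have "[:z (Inl (s, t)) + z (Inr (s, t)):] * cof ?M s t =
     ?M $ s $ t * cof ?M s t + [:1, -1:] * (?Z s t * cof ?M s t)" for s t
    by (simp add: pencil_def algebra_simps smult_add_left smult_add_right)
  hence "(\<Sum>s\<in>UNIV. \<Sum>t\<in>UNIV. [:z (Inl (s, t)) + z (Inr (s, t)):] * cof ?M s t) =
     of_nat CARD('n) * det ?M + [:1, -1:] * pderiv (det ?M)"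
    by (simp only: sum.distrib 1 2[symmetric] sum_distrib_left)
  hence "(\<Sum>s\<in>UNIV. \<Sum>t\<in>UNIV. (z (Inl (s, t)) + z (Inr (s, t))) * coeff (cof ?M s t) m) =
     coeff (of_nat CARD('n) * det ?M + [:1, -1:] * pderiv (det ?M)) m"
    by (simp only: coeff_const_mult[symmetric] coeff_sum[symmetric])
  also have "\<dots> = of_nat CARD('n) * edet m z + (of_nat m + 1) * edet (Suc m) z - of_nat m * edet m z"
    unfolding coeff_add coeff_linear_mult
    by (cases m) (simp_all add: edet_def of_nat_poly coeff_pderiv)
  finally show ?thesis by (simp add: algebra_simps)
qed

text \<open>The point (1, -1), where W + Z = 0 and hence every value of E vanishes; the determinant
  there is (1 - \<lambda>)^n.\<close>

definition pencil_one :: "'n::finite \<times> 'n + 'n \<times> 'n \<Rightarrow> complex" where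
  "pencil_one = entries (mat 1) (- mat 1)"

lemma edet_pencil_one: "edet CARD('n) (pencil_one :: 'n::finite \<times> 'n + 'n \<times> 'n \<Rightarrow> complex) \<noteq> 0"
proof -
  have "det (pencil (pencil_one :: 'n \<times> 'n + 'n \<times> 'n \<Rightarrow> complex)) = [:1, -1:] ^ CARD('n)"
    by (subst det_diagonal) (auto simp: pencil_def pencil_one_def entries_def mat_def)
  moreover have "degree ([:1, -1 :: complex:] ^ CARD('n)) = CARD('n)"
    by (simp add: degree_power_eq)
  ultimately show ?thesis
    using lead_coeff_power[of "[:1, -1 :: complex:]" "CARD('n)"] by (simp add: edet_def)
qed

lemma ex_ecoef_kernel:
  obtains c where "c \<noteq> (\<lambda>x. 0)" "homogeneous CARD('n::finite) (int v) c" "ecoef CARD('n) k1 k2 c = (\<lambda>x. 0)"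
proof -
  let ?n = "CARD('n)" and ?A = "nat_exponents CARD('n) v"
  define e where "e = (\<lambda>a. edet a (pencil_one :: 'n \<times> 'n + 'n \<times> 'n \<Rightarrow> complex))"
  have hom: "homogeneous ?n (int v) c" if "\<And>x. x \<notin> ?A \<Longrightarrow> c x = 0" for c
    using that by (auto simp: homogeneous_iff)
  have supp: "c x = 0" if "homogeneous ?n (int v) c" "x \<notin> ?A" for c x
    using that by (auto simp: homogeneous_iff)
  \<comment> \<open>The monomial Q_n^v, nonzero at (1, -1): evaluation at this point is a nonzero
    functional that vanishes on the range of E.\<close>
  let ?d = "\<lambda>x. if x = (\<lambda>j. if j = ?n then v else 0) then 1 else 0 :: complex"
  have z: "pencil_one (Inl p) + pencil_one (Inr p) = 0" for p :: "'n \<times> 'n"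
    by (cases p) (simp add: pencil_one_def entries_def mat_def)
  obtain c where "c \<noteq> (\<lambda>x. 0)" "\<And>x. x \<notin> ?A \<Longrightarrow> c x = 0" "ecoef ?n k1 k2 c = (\<lambda>x. 0)"
  proof (rule ex_kernel_if_functional_vanishes_on_range[of ?A "ecoef ?n k1 k2" "\<lambda>c. ev {..?n} c e" ?d])
    show "ecoef ?n k1 k2 c x = 0" if "\<And>x. x \<notin> ?A \<Longrightarrow> c x = 0" "x \<notin> ?A" for c x
      using supp[OF homogeneous_ecoef[OF hom]] that by blast
    show "ev {..?n} (\<lambda>x. c x + r * d x) e = ev {..?n} c e + r * ev {..?n} d e"
      if "\<And>x. x \<notin> ?A \<Longrightarrow> c x = 0" "\<And>x. x \<notin> ?A \<Longrightarrow> d x = 0" for c d r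
      using coefs_homogeneous[OF hom[OF that(1)]] coefs_homogeneous[OF hom[OF that(2)]]
      by (simp add: ev_add coefs_cmult ev_cmult)
    show "ev {..?n} (ecoef ?n k1 k2 c) e = 0" if "\<And>x. x \<notin> ?A \<Longrightarrow> c x = 0" for c
    proof -
      have "(of_nat ?n - of_nat m) * e m + (of_nat m + 1) * e (Suc m) = 0" for m
        unfolding e_def sum_pencil_coeff_cof[symmetric] z by simp
      thus ?thesis by (simp add: ev_ecoef[OF coefs_homogeneous[OF hom[OF that]]])
    qed
    show "?d x = 0" if "x \<notin> ?A" for x
      using that by (auto simp: nat_exponents_def)
    have "{x. ?d x \<noteq> 0} = {\<lambda>j. if j = ?n then v else 0}" by auto
    hence "ev {..?n} ?d e = (\<Prod>j\<le>?n. e j ^ (if j = ?n then v else 0))" by (simp add: ev_def monv_def)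
    also have "\<dots> = e ?n ^ v" by (subst prod.remove[of _ ?n]) (auto intro!: prod.neutral)
    finally show "ev {..?n} ?d e \<noteq> 0" using edet_pencil_one[where 'n = 'n] by (simp add: e_def)
  qed (use finite_nat_exponents ecoef_linear in auto)
  thus ?thesis using that hom by blast
qed

section \<open>Pluriharmonic invariant polynomials\<close>

lemma poly_fun_compose_gram: "poly_fun UNIV h \<Longrightarrow> poly_fun UNIV (\<lambda>z. h (gram z))"
  using poly_fun_compose[of UNIV h UNIV "\<lambda>i z. gram z i"] by (simp add: poly_fun_gram)

lemma det_coeff_eq_edet: "det_coeff a W Z = edet a (entries W Z)"
  by (simp add: det_coeff_def edet_def pencil_def entries_def)

lemma det_expansion_eq_ev:
  fixes W :: "complex^'n^'n"
  shows "det_expansion v C W Z = ev {..CARD('n)} (nat_coefs CARD('n) v C) (\<lambda>a. edet a (entries W Z))"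
  by (simp add: det_expansion_def ev_nat_coefs det_coeff_eq_edet)

lemma det_const_poly: "det (\<chi> i j. [:A $ i $ j:]) = [:det A:]" for A :: "complex^'n^'n"
proof -
  have "of_int (sign p) * (\<Prod>i\<in>UNIV. [:A $ i $ p i:]) = [:of_int (sign p) * (\<Prod>i\<in>UNIV. A $ i $ p i):]" 
    for p :: "'n \<Rightarrow> 'n"
    by (simp add: prod_to_poly of_int_poly)
  thus ?thesis by (simp add: det_def sum_to_poly)
qed

text \<open>Multiplicativity of the determinant over polynomials in \<lambda>, applied to A (W +
  \<lambda>Z) B^t.\<close>

lemma det_coeff_mult:
  fixes A B W Z :: "complex^'n^'n"
  shows "det_coeff a (A ** W ** transpose B) (A ** Z ** transpose B) = det A * det B * det_coeff a W Z"
proof -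
  let ?c = "\<lambda>A :: complex^'n^'n. \<chi> i j. [:A $ i $ j:]"
  have "(\<chi> i j. [:(A ** W ** transpose B) $ i $ j, (A ** Z ** transpose B) $ i $ j:]) =
    ?c A ** (\<chi> i j. [:W $ i $ j, Z $ i $ j:]) ** ?c (transpose B)"
  proof -
    have *: "(\<Sum>x\<in>S. [:f x, g x:]) = [:sum f S, sum g S:]" for f g :: "'n \<Rightarrow> complex" and S
      by (induction S rule: infinite_finite_induct) auto
    show ?thesis
      by (simp add: vec_eq_iff matrix_matrix_mult_def * sum_distrib_right mult.commute)
  qed
  thus ?thesis by (simp add: det_coeff_def det_mul det_const_poly)
qed

lemma matrix_polynomial_det_expansion: "matrix_polynomial (det_expansion v C)"
  unfolding matrix_polynomial_iff det_expansion_eq_ev entries_mat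
  by (rule poly_fun_compose[OF poly_fun_ev poly_fun_edet])

lemma det_expansion_invariant:
  "(det_expansion v C :: complex^'n^'n \<Rightarrow> complex^'n^'n \<Rightarrow> complex) \<in> invariant_polynomials v"
proof -
  have "det_expansion v C (A ** W ** transpose B) (A ** Z ** transpose B) =
    det A ^ v * det B ^ v * det_expansion v C W Z" for A B W Z :: "complex^'n^'n"
  proof -
    have "(\<Prod>j\<le>CARD('n). (det A * det B * det_coeff j W Z) ^ nat (\<alpha> j)) =
      (det A ^ v * det B ^ v) * (\<Prod>j\<le>CARD('n). det_coeff j W Z ^ nat (\<alpha> j))" 
      if \<alpha>: "\<alpha> \<in> exponents CARD('n) v" for \<alpha>
    proof -
      have "int (\<Sum>j\<le>CARD('n). nat (\<alpha> j)) = (\<Sum>j\<le>CARD('n). \<alpha> j)"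
        unfolding of_nat_sum using \<alpha> by (intro sum.cong) (auto simp: exponents_def)
      also have "\<dots> = int v" using \<alpha> by (simp add: exponents_def)
      finally have "(\<Sum>j\<le>CARD('n). nat (\<alpha> j)) = v" by (simp only: of_nat_eq_iff)
      hence "(\<Prod>j\<le>CARD('n). (det A * det B) ^ nat (\<alpha> j)) = (det A * det B) ^ v"
        by (simp flip: power_sum)
      thus ?thesis by (simp add: power_mult_distrib[of "det A * det B"] prod.distrib power_mult_distrib[of "det A" "det B" v])
    qed
    thus ?thesis
      unfolding det_expansion_def det_coeff_mult sum_distrib_left
      by (intro sum.cong) (auto simp: mult_ac)
  qed
  thus ?thesis by (simp add: invariant_polynomials_def matrix_polynomial_det_expansion)
qed

section \<open>Pluriharmonicity as vanishing of \<open>dop\<close>\<close>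

lemma surj_gram:
  fixes w :: "'n::finite \<times> 'n + 'n \<times> 'n \<Rightarrow> complex"
  assumes "CARD('n) \<le> CARD('k1)" "CARD('n) \<le> CARD('k2)"
  obtains z :: "'n \<times> ('k1::finite + 'k2::finite) + 'n \<times> ('k1 + 'k2) \<Rightarrow> complex" where "gram z = w"
proof -
  obtain \<phi> :: "'n \<Rightarrow> 'k1" where \<phi>: "inj \<phi>"
    using card_le_inj[of "UNIV :: 'n set" "UNIV :: 'k1 set"] assms by auto
  obtain \<psi> :: "'n \<Rightarrow> 'k2" where \<psi>: "inj \<psi>"
    using card_le_inj[of "UNIV :: 'n set" "UNIV :: 'k2 set"] assms by auto
  \<comment> \<open>As k_i \<ge> n, the matrix Y_i can carry an identity block in n of its columns
    and X_i the prescribed matrix in the same columns. Elsewhere \<open>inv_into\<close> gives X_i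
    arbitrary entries, but those of Y_i are zero.\<close>
  define z :: "'n \<times> ('k1 + 'k2) + 'n \<times> ('k1 + 'k2) \<Rightarrow> complex" where
    "z = case_sum
      (\<lambda>(i, u). case u of Inl a \<Rightarrow> w (Inl (i, inv_into UNIV \<phi> a)) | Inr b \<Rightarrow> w (Inr (i, inv_into UNIV \<psi> b)))
      (\<lambda>(j, u). case u of Inl a \<Rightarrow> if a = \<phi> j then 1 else 0 | Inr b \<Rightarrow> if b = \<psi> j then 1 else 0)"
  have "gram z (Inl (i, j)) = w (Inl (i, j))" "gram z (Inr (i, j)) = w (Inr (i, j))" for i j
    using \<phi> \<psi> by (simp_all add: gram_simps z_def if_distrib[of "\<lambda>x. _ * x"] cong: if_cong)
  hence "gram z p = w p" for p by (cases p; cases "projl p"; cases "projr p") auto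
  hence "gram z = w" by (rule ext)
  thus ?thesis by (rule that)
qed

text \<open>The Laplacians are \<open>dop\<close> evaluated on Gram matrices, and by
  \<open>surj_gram\<close> these fill the whole space of pairs (W, Z).\<close>

lemma mem_pluriharmonic_polynomials_iff:
  fixes Q :: "complex^'n^'n \<Rightarrow> complex^'n^'n \<Rightarrow> complex"
  assumes "CARD('n) \<le> CARD('k1)" "CARD('n) \<le> CARD('k2)"
  shows "Q \<in> pluriharmonic_polynomials v TYPE('k1::finite) TYPE('k2::finite) \<longleftrightarrow>
    Q \<in> invariant_polynomials v \<and>
    (\<forall>s t z. dop CARD('k1) CARD('k2) s t (\<lambda>z. Q (mat1 z) (mat2 z)) z = 0)"
proof (cases "Q \<in> invariant_polynomials v")
  case True
  let ?Q = "\<lambda>z. Q (mat1 z) (mat2 z)"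
  let ?P = "\<lambda>(x :: complex^('k1 + 'k2)^'n) y.
       Q (left_block x ** transpose (left_block y)) (right_block x ** transpose (right_block y))"
  have Q: "poly_fun UNIV ?Q"
    using True by (simp add: invariant_polynomials_def matrix_polynomial_iff)
  have "poly_fun UNIV (\<lambda>z :: 'n \<times> ('k1 + 'k2) + 'n \<times> ('k1 + 'k2) \<Rightarrow> complex. ?Q (gram z))"
    using poly_fun_compose_gram[OF Q] .
  hence P: "matrix_polynomial ?P" unfolding matrix_polynomial_iff mat_gram .
  have surj: "\<exists>z :: 'n \<times> ('k1 + 'k2) + 'n \<times> ('k1 + 'k2) \<Rightarrow> complex. gram z = w" for w
    using surj_gram[OF assms] by blast
  have "(\<forall>s t (z :: 'n \<times> ('k1 + 'k2) + 'n \<times> ('k1 + 'k2) \<Rightarrow> complex). 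
      dop CARD('k1) CARD('k2) s t ?Q (gram z) = 0) \<longleftrightarrow>
    (\<forall>s t z. dop CARD('k1) CARD('k2) s t ?Q z = 0)"
    using surj by metis
  thus ?thesis
    using True P
    by (simp add: pluriharmonic_polynomials_def pluriharmonic_iff mat_gram laplacian_compose_gram[OF Q])
qed (simp add: pluriharmonic_polynomials_def)

lemma det_expansion_mem_iff:
  assumes "CARD('n) \<le> CARD('k1)" "CARD('n) \<le> CARD('k2)"
  shows "(det_expansion v C :: complex^'n^'n \<Rightarrow> complex^'n^'n \<Rightarrow> complex)
      \<in> pluriharmonic_polynomials v TYPE('k1::finite) TYPE('k2::finite) \<longleftrightarrow>
    (\<forall>s t (z :: 'n \<times> 'n + 'n \<times> 'n \<Rightarrow> complex). dop CARD('k1) CARD('k2) s t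
       (\<lambda>z. ev {..CARD('n)} (nat_coefs CARD('n) v C) (\<lambda>a. edet a z)) z = 0)"
  using mem_pluriharmonic_polynomials_iff[OF assms, of "det_expansion v C" v]
  by (simp add: det_expansion_invariant det_expansion_eq_ev)

text \<open>The converse of the claimed sufficiency. It places the polynomial obtained from the
  kernel of E among the solutions of the relations, where uniqueness applies.\<close>

lemma satisfies_relations_if_pluriharmonic:
  assumes k: "CARD('n) \<le> CARD('k1)" "CARD('n) \<le> CARD('k2)"
    and mem: "(det_expansion v C :: complex^'n^'n \<Rightarrow> complex^'n^'n \<Rightarrow> complex)
      \<in> pluriharmonic_polynomials v TYPE('k1::finite) TYPE('k2::finite)"
  shows "satisfies_relations CARD('n) CARD('k1) CARD('k2) v C"
proof -
  let ?n = "CARD('n)" and ?c = "nat_coefs CARD('n) v C"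
  have c: "coefs {..?n} ?c" by (rule coefs_homogeneous[OF homogeneous_nat_coefs])
  have "rop ?n CARD('k1) CARD('k2) m (ev {..?n} ?c) e = 0" if "m < ?n" for m e
    using mem that unfolding det_expansion_mem_iff[OF k]
    by (intro rop_eq_0_if_dop_eq_0[where 'n = 'n]) (auto simp: poly_fun_ev)
  hence "ev {..?n} (rcoef ?n CARD('k1) CARD('k2) m ?c) = (\<lambda>e. 0)" if "m < ?n" for m
    using that by (simp add: fun_eq_iff ev_rcoef[OF c])
  hence "rcoef ?n CARD('k1) CARD('k2) m ?c = (\<lambda>x. 0)" if "m < ?n" for m
    using that by (intro ev_inject_0[of "{..?n}"] coefs_rcoef c) auto
  thus ?thesis
    unfolding satisfies_relations_def by (auto intro!: linear_relation_if_rcoef_eq_0)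
qed

text \<open>
  The Laplacians of \<open>P(X, Y) = Q(X\<^sub>1 Y\<^sub>1\<^sup>t, X\<^sub>2 Y\<^sub>2\<^sup>t)\<close> and the entries of \<open>X Y\<^sup>t = X\<^sub>1 Y\<^sub>1\<^sup>t + X\<^sub>2 Y\<^sub>2\<^sup>t\<close> are
  adjoint to each other; both are described by the following pairs of variables.
\<close>

definition column_pairs :: "'n \<times> 'n \<Rightarrow> (('n \<times> 'k + 'n \<times> 'k) \<times> ('n \<times> 'k + 'n \<times> 'k)) set" where
  "column_pairs r = (\<lambda>u. (Inl (fst r, u), Inr (snd r, u))) ` UNIV"

lemma quad_column_pairs:
  fixes z :: "'n::finite \<times> ('k1::finite + 'k2::finite) + 'n \<times> ('k1 + 'k2) \<Rightarrow> complex"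
  shows "quad column_pairs (s, t) z = gram z (Inl (s, t)) + gram z (Inr (s, t))"
  unfolding quad_def column_pairs_def
  by (subst sum.reindex) (auto simp: inj_on_def sum_UNIV_sum gram_simps)

lemma lap_column_pairs:
  fixes z :: "'n::finite \<times> ('k1::finite + 'k2::finite) + 'n \<times> ('k1 + 'k2) \<Rightarrow> complex"
  assumes "poly_fun UNIV Q"
  shows "lap column_pairs (s, t) (\<lambda>z. Q (gram z)) z = dop CARD('k1) CARD('k2) s t Q (gram z)"
  unfolding lap_def column_pairs_def laplacian_compose_gram[OF assms, symmetric]
  by (subst sum.reindex) (auto simp: inj_on_def)

section \<open>A nonzero pluriharmonic polynomial, and the role of the antidiagonal Z = -W\<close>

lemma ex_pluriharmonic_det_expansion:
  assumes k: "CARD('n) \<le> CARD('k1)" "CARD('n) \<le> CARD('k2)"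
  obtains C where "(det_expansion v C :: complex^'n^'n \<Rightarrow> complex^'n^'n \<Rightarrow> complex)
      \<in> pluriharmonic_polynomials v TYPE('k1::finite) TYPE('k2::finite)"
    "(det_expansion v C :: complex^'n^'n \<Rightarrow> complex^'n^'n \<Rightarrow> complex) \<noteq> 0"
proof -
  let ?n = "CARD('n)" and ?k1 = "CARD('k1)" and ?k2 = "CARD('k2)"
  obtain c where c: "c \<noteq> (\<lambda>x. 0)" "homogeneous ?n (int v) c" "ecoef ?n ?k1 ?k2 c = (\<lambda>x. 0)"
    by (rule ex_ecoef_kernel[where 'n = 'n]) (rule that)
  define C where "C = (\<lambda>\<alpha>. c (\<lambda>j. nat (\<alpha> j)))"
  have cC: "nat_coefs ?n v C = c"
    using c(2) by (auto simp: C_def nat_coefs_def homogeneous_iff fun_eq_iff)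
  have coefs: "coefs {..?n} c" by (rule coefs_homogeneous[OF c(2)])
  define F where "F = ev {..?n} c"
  define Q where "Q = (\<lambda>z :: 'n \<times> 'n + 'n \<times> 'n \<Rightarrow> complex. F (\<lambda>a. edet a z))"
  have F: "poly_fun {..?n} F" by (simp add: F_def poly_fun_ev)
  have Q: "poly_fun UNIV Q" unfolding Q_def by (rule poly_fun_compose[OF F poly_fun_edet])
  \<comment> \<open>E applied to Q, rewritten through \<open>rop\<close>; it vanishes because
    \<open>c\<close> lies in the kernel of \<open>ecoef\<close>.\<close>
  have E: "(\<Sum>s\<in>UNIV. \<Sum>t\<in>UNIV. (w (Inl (s, t)) + w (Inr (s, t))) * dop ?k1 ?k2 s t Q w) = 0" for w
  proof -
    let ?e = "\<lambda>a. edet a w"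
    have "(\<Sum>s\<in>UNIV. \<Sum>t\<in>UNIV. (w (Inl (s, t)) + w (Inr (s, t))) * dop ?k1 ?k2 s t Q w) =
      (\<Sum>s\<in>UNIV. \<Sum>t\<in>UNIV. \<Sum>m<?n. (w (Inl (s, t)) + w (Inr (s, t))) * coeff (cof (pencil w) s t) m * rop ?n ?k1 ?k2 m F ?e)"
      unfolding Q_def dop_compose_edet[OF F] by (simp add: sum_distrib_left mult.assoc)
    also have "\<dots> = (\<Sum>m<?n. (\<Sum>s\<in>UNIV. \<Sum>t\<in>UNIV. (w (Inl (s, t)) + w (Inr (s, t))) * coeff (cof (pencil w) s t) m) * rop ?n ?k1 ?k2 m F ?e)"
      unfolding sum_distrib_right by (rule sum_swap3)
    also have "\<dots> = ev {..?n} (ecoef ?n ?k1 ?k2 c) ?e"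
      unfolding sum_pencil_coeff_cof ev_ecoef[OF coefs] F_def ..
    finally show ?thesis by (simp add: c(3))
  qed
  have "dop ?k1 ?k2 s t Q w = 0" for s t w
  proof -
    obtain z :: "'n \<times> ('k1 + 'k2) + 'n \<times> ('k1 + 'k2) \<Rightarrow> complex" where z: "gram z = w"
      by (rule surj_gram[OF k]) (rule that)
    let ?f = "\<lambda>z :: 'n \<times> ('k1 + 'k2) + 'n \<times> ('k1 + 'k2) \<Rightarrow> complex. Q (gram z)"
    \<comment> \<open>On Gram matrices E becomes the sum of the forms (X Y^t)_st times their adjoint
      Laplacians, so Fischer positivity kills each Laplacian.\<close>
    have "lap column_pairs (s, t) ?f z = 0"
    proof (rule lap_eq_0_if_sum_quad_lap_eq_0)
      show "poly_fun UNIV ?f" by (rule poly_fun_compose_gram[OF Q])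
      show "(\<Sum>r\<in>UNIV. quad column_pairs r z * lap column_pairs r ?f z) = 0" for z
        unfolding sum_UNIV_prod quad_column_pairs lap_column_pairs[OF Q] by (rule E)
    qed auto
    thus ?thesis by (simp add: lap_column_pairs[OF Q] z)
  qed
  hence "(det_expansion v C :: complex^'n^'n \<Rightarrow> complex^'n^'n \<Rightarrow> complex)
      \<in> pluriharmonic_polynomials v TYPE('k1::finite) TYPE('k2::finite)"
    by (simp add: det_expansion_mem_iff[OF k] cC Q_def F_def)
  moreover have "(det_expansion v C :: complex^'n^'n \<Rightarrow> complex^'n^'n \<Rightarrow> complex) \<noteq> 0"
  proof
    assume 0: "(det_expansion v C :: complex^'n^'n \<Rightarrow> complex^'n^'n \<Rightarrow> complex) = 0"
    have "F (\<lambda>a. edet a z) = 0" for z :: "'n \<times> 'n + 'n \<times> 'n \<Rightarrow> complex"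
      using fun_cong[OF fun_cong[OF 0, of "mat1 z"], of "mat2 z"] by (simp add: det_expansion_eq_ev cC F_def)
    hence "F e = 0" for e by (rule eq_0_if_compose_edet_eq_0[OF F])
    hence "c = (\<lambda>x. 0)" by (intro ev_inject_0[of "{..?n}"] coefs) (auto simp: F_def)
    thus False using c(1) by simp
  qed
  ultimately show ?thesis by (rule that)
qed

text \<open>Modulo the ideal generated by the entries of W + Z, the variables of Z may be replaced
  by those of -W. For products use f g - f' g' = (f - f') g + f' (g - g').\<close>

lemma poly_fun_diff_antidiagonal:
  fixes f :: "('n::finite \<times> 'n + 'n \<times> 'n \<Rightarrow> complex) \<Rightarrow> complex"
  assumes "poly_fun UNIV f"
  shows "\<exists>R. (\<forall>r. poly_fun UNIV (R r)) \<and>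
    (\<forall>z. f z - f (case_sum (\<lambda>r. z (Inl r)) (\<lambda>r. - z (Inl r))) =
       (\<Sum>r\<in>UNIV. (z (Inl r) + z (Inr r)) * R r z))"
  using assms
proof induction
  case (const c)
  show ?case by (intro exI[of _ "\<lambda>r z. 0"]) (auto intro: poly_fun.const)
next
  case (coord i)
  show ?case
  proof (cases i)
    case (Inl r)
    thus ?thesis by (intro exI[of _ "\<lambda>r z. 0"]) (auto intro: poly_fun.const)
  next
    case (Inr r)
    thus ?thesis
      by (intro exI[of _ "\<lambda>r' z. if r' = r then 1 else 0"])
         (auto simp: if_distrib[of "\<lambda>x. _ * x"] intro: poly_fun.const cong: if_cong)
  qed
next
  case (add f g)
  let ?d = "\<lambda>z :: 'n \<times> 'n + 'n \<times> 'n \<Rightarrow> complex. case_sum (\<lambda>r. z (Inl r)) (\<lambda>r. - z (Inl r))"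
  obtain R where R: "\<And>r. poly_fun UNIV (R r)" "\<And>z. f z - f (case_sum (\<lambda>r. z (Inl r)) (\<lambda>r. - z (Inl r))) =
       (\<Sum>r\<in>UNIV. (z (Inl r) + z (Inr r)) * R r z)" using add.IH(1) by auto
  obtain S where S: "\<And>r. poly_fun UNIV (S r)" "\<And>z. g z - g (case_sum (\<lambda>r. z (Inl r)) (\<lambda>r. - z (Inl r))) =
       (\<Sum>r\<in>UNIV. (z (Inl r) + z (Inr r)) * S r z)" using add.IH(2) by auto
  have "f z + g z - (f (?d z) + g (?d z)) = (\<Sum>r\<in>UNIV. (z (Inl r) + z (Inr r)) * (R r z + S r z))" for z
  proof -
    have "f z + g z - (f (?d z) + g (?d z)) = (f z - f (?d z)) + (g z - g (?d z))" by simp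
    thus ?thesis unfolding R(2) S(2) by (simp only: distrib_left sum.distrib)
  qed
  moreover have "poly_fun UNIV (\<lambda>z. R r z + S r z)" for r
    by (intro poly_fun.intros R(1) S(1))
  ultimately show ?case by (intro exI[of _ "\<lambda>r z. R r z + S r z"]) blast
next
  case (mult f g)
  let ?d = "\<lambda>z :: 'n \<times> 'n + 'n \<times> 'n \<Rightarrow> complex. case_sum (\<lambda>r. z (Inl r)) (\<lambda>r. - z (Inl r))"
  obtain R where R: "\<And>r. poly_fun UNIV (R r)" "\<And>z. f z - f (?d z) =
       (\<Sum>r\<in>UNIV. (z (Inl r) + z (Inr r)) * R r z)" using mult.IH(1) by auto
  obtain S where S: "\<And>r. poly_fun UNIV (S r)" "\<And>z. g z - g (?d z) =
       (\<Sum>r\<in>UNIV. (z (Inl r) + z (Inr r)) * S r z)" using mult.IH(2) by auto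
  have d: "poly_fun UNIV (\<lambda>z. f (?d z))"
  proof -
    have "poly_fun UNIV (\<lambda>z. ?d z i)" for i
      using poly_fun.mult[OF poly_fun.const[of UNIV "-1"] poly_fun.coord[of "Inl (projr i)" UNIV]]
      by (cases i) (auto intro: poly_fun.coord)
    thus ?thesis using poly_fun_compose[OF mult.hyps(1), of UNIV "\<lambda>i z. ?d z i"] by simp
  qed
  have "f z * g z - f (?d z) * g (?d z) =
     (\<Sum>r\<in>UNIV. (z (Inl r) + z (Inr r)) * (R r z * g z + f (?d z) * S r z))" for z
  proof -
    have "f z * g z - f (?d z) * g (?d z) = (f z - f (?d z)) * g z + f (?d z) * (g z - g (?d z))"
      by (simp add: algebra_simps)
    thus ?thesis unfolding R(2) S(2) sum_distrib_left sum_distrib_right sum.distrib[symmetric]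
      by (simp add: algebra_simps)
  qed
  moreover have "poly_fun UNIV (\<lambda>z. R r z * g z + f (?d z) * S r z)" for r
    by (intro poly_fun.intros R(1) S(1) d mult.hyps)
  ultimately show ?case by (intro exI[of _ "\<lambda>r z. R r z * g z + f (?d z) * S r z"]) blast
qed

lemma poly_fun_line:
  assumes "poly_fun S f" shows "\<exists>p. \<forall>t. f (\<lambda>i. a i + t * b i) = poly p t"
  using assms
proof induction
  case (const c)
  show ?case by (intro exI[of _ "[:c:]"]) simp
next
  case (coord i)
  show ?case by (intro exI[of _ "[:a i, b i:]"]) simp
next
  case (add f g)
  thus ?case by (metis poly_add)
next
  case (mult f g)
  thus ?case by (metis poly_mult)
qed

text \<open>For invertible W, invariance with A = W and B = 1 reduces to the point (1, -1). Singular
  W are reached along a line, where a product of two polynomials in one variable vanishes only if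
  one of them does.\<close>

lemma invariant_antidiagonal_eq_0:
  assumes Q: "Q \<in> invariant_polynomials v" and 0: "Q (mat 1) (- mat 1) = 0"
  shows "Q W (- W) = 0"
proof -
  have inv: "Q W (- W) = 0" if "det W \<noteq> 0" for W
  proof -
    have "Q (A ** W ** transpose B) (A ** Z ** transpose B) = det A ^ v * det B ^ v * Q W Z"
      if "invertible A" "invertible B" for A B W Z
      using Q that by (simp add: invariant_polynomials_def)
    from this[of W "mat 1" "mat 1" "- mat 1"]
    have "Q (W ** mat 1 ** transpose (mat 1)) (W ** (- mat 1) ** transpose (mat 1)) = 0"
      using 0 that by (simp add: invertible_det_nz)
    moreover have "W ** (- mat 1) = - W"
      by (simp add: vec_eq_iff matrix_matrix_mult_def mat_def sum_negf if_distrib[of "\<lambda>x. _ * x"] cong: if_cong)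
    ultimately show ?thesis by (simp add: transpose_mat)
  qed
  let ?f = "\<lambda>z. Q (mat1 z) (mat2 z)"
  have f: "poly_fun UNIV ?f" using Q by (simp add: invariant_polynomials_def matrix_polynomial_iff)
  have d: "poly_fun UNIV (\<lambda>z. det (mat1 z))"
    unfolding det_def by (intro poly_fun_sum poly_fun.mult poly_fun.const poly_fun_prod) 
      (simp add: mat_nth poly_fun.coord)
  \<comment> \<open>The line from (W, -W) at t = 0 to (1, -1) at t = 1 stays on the antidiagonal.
    Along it \<open>p\<close> is Q and \<open>q\<close> the determinant, with q(1) = 1.\<close>
  let ?a = "entries W (- W)" and ?b = "entries (mat 1 - W) (- (mat 1 - W))"
  obtain p where p: "\<And>t. ?f (\<lambda>i. ?a i + t * ?b i) = poly p t" using poly_fun_line[OF f] by metis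
  obtain q where q: "\<And>t. det (mat1 (\<lambda>i. ?a i + t * ?b i)) = poly q t" using poly_fun_line[OF d] by metis
  have neg: "mat2 (\<lambda>i. ?a i + t * ?b i) = - mat1 (\<lambda>i. ?a i + t * ?b i)" for t
    by (simp add: vec_eq_iff mat_nth entries_def algebra_simps)
  have "mat1 (\<lambda>i. ?a i + 1 * ?b i) = mat 1" 
    by (simp add: vec_eq_iff mat_nth entries_def)
  hence "poly q 1 \<noteq> 0" using q[of 1] by simp
  hence "q \<noteq> 0" by auto
  have "poly (p * q) t = 0" for t
    using inv[of "mat1 (\<lambda>i. ?a i + t * ?b i)"] p[of t] q[of t] neg[of t] by auto
  hence "p * q = 0" using poly_all_0_iff_0[of "p * q"] by blast
  hence "p = 0" using \<open>q \<noteq> 0\<close> by simp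
  thus ?thesis using p[of 0] by simp
qed

text \<open>Q vanishes on the antidiagonal, so it lies in the ideal generated by the entries of W +
  Z. On Gram matrices these are the forms adjoint to the Laplacians, which annihilate Q.\<close>

lemma pluriharmonic_eq_0:
  fixes Q :: "complex^'n^'n \<Rightarrow> complex^'n^'n \<Rightarrow> complex"
  assumes k: "CARD('n) \<le> CARD('k1)" "CARD('n) \<le> CARD('k2)"
    and Q: "Q \<in> pluriharmonic_polynomials v TYPE('k1::finite) TYPE('k2::finite)"
    and 0: "Q (mat 1) (- mat 1) = 0"
  shows "Q = 0"
proof -
  let ?f = "\<lambda>z. Q (mat1 z) (mat2 z)"
  have inv: "Q \<in> invariant_polynomials v" and D: "\<And>s t z. dop CARD('k1) CARD('k2) s t ?f z = 0"
    using Q unfolding mem_pluriharmonic_polynomials_iff[OF k] by auto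
  have f: "poly_fun UNIV ?f" using inv by (simp add: invariant_polynomials_def matrix_polynomial_iff)
  let ?d = "\<lambda>z :: 'n \<times> 'n + 'n \<times> 'n \<Rightarrow> complex. case_sum (\<lambda>r. z (Inl r)) (\<lambda>r. - z (Inl r))"
  obtain R where R: "\<And>r. poly_fun UNIV (R r)" "\<And>z. ?f z - ?f (?d z) =
       (\<Sum>r\<in>UNIV. (z (Inl r) + z (Inr r)) * R r z)" using poly_fun_diff_antidiagonal[OF f] by auto
  have fd: "?f (?d z) = 0" for z
  proof -
    have "mat2 (?d z) = - mat1 (?d z)" by (simp add: vec_eq_iff mat_nth)
    thus ?thesis using invariant_antidiagonal_eq_0[OF inv 0] by simp
  qed
  have "?f w = 0" for w
  proof -
    obtain z :: "'n \<times> ('k1 + 'k2) + 'n \<times> ('k1 + 'k2) \<Rightarrow> complex" where z: "gram z = w"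
      by (rule surj_gram[OF k]) (rule that)
    let ?g = "\<lambda>z :: 'n \<times> ('k1 + 'k2) + 'n \<times> ('k1 + 'k2) \<Rightarrow> complex. ?f (gram z)"
    have "?g z = 0"
    proof (rule eq_0_if_lap_eq_0_in_ideal[where R = UNIV and f = ?g and P = column_pairs and g = "\<lambda>r z. R r (gram z)"])
      show "poly_fun UNIV ?g" by (rule poly_fun_compose_gram[OF f])
      show "lap column_pairs r ?g z = 0" for r z
        using lap_column_pairs[OF f, of "fst r" "snd r" z] D by simp
      show "poly_fun UNIV (\<lambda>z. R r (gram z))" for r by (rule poly_fun_compose_gram[OF R(1)])
      show "?g z = (\<Sum>r\<in>UNIV. quad column_pairs r z * R r (gram z))" for z
      proof -
        have "quad column_pairs r z = gram z (Inl r) + gram z (Inr r)" for r :: "'n \<times> 'n"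
          using quad_column_pairs[of "fst r" "snd r" z] by simp
        thus ?thesis using R(2)[of "gram z"] fd[of "gram z"] by simp
      qed
    qed
    thus ?thesis by (simp add: z)
  qed
  hence "Q W Z = 0" for W Z using mat_entries by metis
  thus ?thesis by (simp add: fun_eq_iff)
qed

section \<open>The pluriharmonic polynomials form a line\<close>

lemma vector_space_scale_fun: "vector_space scale_fun"
  by unfold_locales (auto simp: scale_fun_def fun_eq_iff algebra_simps)

lemma dop_scale_add:
  assumes "poly_fun UNIV f" "poly_fun UNIV g"
  shows "dop k1 k2 s t (\<lambda>z. f z + c * g z) z = dop k1 k2 s t f z + c * dop k1 k2 s t g z"
proof -
  have 1: "pd i (\<lambda>z. f z + c * g z) = (\<lambda>z. pd i f z + c * pd i g z)" 
    if "poly_fun UNIV f" "poly_fun UNIV g" for i f g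
    using that by (simp add: pd_add[of UNIV] pd_cmult[of UNIV] poly_fun.mult poly_fun.const)
  show ?thesis
    unfolding dop_def 1[OF assms] 1[OF poly_fun_pd[OF assms(1)] poly_fun_pd[OF assms(2)]]
    by (simp add: algebra_simps sum.distrib sum_distrib_left)
qed

lemma pluriharmonic_polynomials_add_scale:
  fixes Q Q' :: "complex^'n^'n \<Rightarrow> complex^'n^'n \<Rightarrow> complex"
  assumes k: "CARD('n) \<le> CARD('k1)" "CARD('n) \<le> CARD('k2)"
    and "Q \<in> pluriharmonic_polynomials v TYPE('k1::finite) TYPE('k2::finite)"
    and "Q' \<in> pluriharmonic_polynomials v TYPE('k1::finite) TYPE('k2::finite)"
  shows "Q + scale_fun c Q' \<in> pluriharmonic_polynomials v TYPE('k1::finite) TYPE('k2::finite)"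
proof -
  have poly: "poly_fun UNIV (\<lambda>z. Q (mat1 z) (mat2 z))" "poly_fun UNIV (\<lambda>z. Q' (mat1 z) (mat2 z))"
    and inv: "Q \<in> invariant_polynomials v" "Q' \<in> invariant_polynomials v"
    using assms(3,4) 
    by (auto simp: pluriharmonic_polynomials_def invariant_polynomials_def matrix_polynomial_iff)
  have "Q + scale_fun c Q' \<in> invariant_polynomials v"
    using inv unfolding invariant_polynomials_def
    by (auto simp: scale_fun_def plus_fun_def algebra_simps intro!: matrix_polynomial.intros)
  thus ?thesis
    using assms(3,4) unfolding mem_pluriharmonic_polynomials_iff[OF k]
    by (simp add: scale_fun_def dop_scale_add[OF poly])
qed

lemma zero_mem_pluriharmonic_polynomials:
  assumes "CARD('n) \<le> CARD('k1)" "CARD('n) \<le> CARD('k2)"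
  shows "(0 :: complex^'n^'n \<Rightarrow> complex^'n^'n \<Rightarrow> complex)
    \<in> pluriharmonic_polynomials v TYPE('k1::finite) TYPE('k2::finite)"
  unfolding mem_pluriharmonic_polynomials_iff[OF assms]
  by (simp add: invariant_polynomials_def zero_fun_def matrix_polynomial.const dop_def)

theorem theorem22:
  fixes L Lp :: "'l::field_char_0 set" and v :: nat
  defines "H \<equiv> (pluriharmonic_polynomials v TYPE('k1::finite) TYPE('k2::finite)
                  :: (complex^'n^'n \<Rightarrow> complex^'n^'n \<Rightarrow> complex) set)"
  assumes "totally_imaginary_quadratic_extension L Lp"
    and "v > 0"
    and "CARD('k1) \<ge> CARD('n)" and "CARD('k2) \<ge> CARD('n)"
    and "card (roots_of_unity L) div 2 * unit_index L Lp dvd v"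
  shows
    "(\<forall>Q \<in> invariant_polynomials v. \<forall>C.
        Q = det_expansion v C \<longrightarrow>
        satisfies_relations CARD('n) CARD('k1) CARD('k2) v C \<longrightarrow> Q \<in> H) \<and>
     (\<forall>C C'.
        satisfies_relations CARD('n) CARD('k1) CARD('k2) v C \<longrightarrow>
        satisfies_relations CARD('n) CARD('k1) CARD('k2) v C' \<longrightarrow>
        C (last_exponent CARD('n) v) = C' (last_exponent CARD('n) v) \<longrightarrow>
        (\<forall>\<alpha> \<in> exponents CARD('n) v. C \<alpha> = C' \<alpha>)) \<and>
     (\<forall>C C'.
        det_expansion v C \<in> H \<longrightarrow> det_expansion v C' \<in> H \<longrightarrow>
        C (last_exponent CARD('n) v) = C' (last_exponent CARD('n) v) \<longrightarrow>
        (\<forall>\<alpha> \<in> exponents CARD('n) v. C \<alpha> = C' \<alpha>)) \<and>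
     (\<exists>Q\<^sub>0 \<in> H. Q\<^sub>0 \<noteq> 0 \<and> (\<forall>Q \<in> H. \<exists>c. Q = scale_fun c Q\<^sub>0)) \<and>
     module.subspace scale_fun H \<and> vector_space.dim scale_fun H = 1"
proof -
  let ?S = "satisfies_relations CARD('n) CARD('k1) CARD('k2) v" and ?last = "last_exponent CARD('n) v"
  let ?D = "det_expansion v :: _ \<Rightarrow> complex^'n^'n \<Rightarrow> complex^'n^'n \<Rightarrow> complex"
  note k = assms(4,5)
  interpret vs: vector_space "scale_fun :: complex \<Rightarrow> (complex^'n^'n \<Rightarrow> complex^'n^'n \<Rightarrow> complex) \<Rightarrow> _"
    by (rule vector_space_scale_fun)
  have rel: "?S C" if "?D C \<in> H" for C
    using satisfies_relations_if_pluriharmonic[OF k] that unfolding H_def .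
  have unique: "C \<alpha> = C' \<alpha>" if "?S C" "?S C'" "C ?last = C' ?last" "\<alpha> \<in> exponents CARD('n) v" for C C' \<alpha>
    using relations_unique[OF that(1-3) assms(4) that(4)] .
  have cong: "?D C = ?D C'" if "\<And>\<alpha>. \<alpha> \<in> exponents CARD('n) v \<Longrightarrow> C \<alpha> = C' \<alpha>" for C C'
    using that by (auto simp: det_expansion_def fun_eq_iff)
  have H_add: "Q + scale_fun c Q' \<in> H" if "Q \<in> H" "Q' \<in> H" for Q Q' c
    using that pluriharmonic_polynomials_add_scale[OF k] unfolding H_def by blast
  have H_0: "0 \<in> H" unfolding H_def by (rule zero_mem_pluriharmonic_polynomials[OF k])
  have H_scale: "scale_fun c Q \<in> H" if "Q \<in> H" for c Q
    using H_add[OF H_0 that] by simp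
  have D_scale: "?D (\<lambda>\<alpha>. t * C \<alpha>) = scale_fun t (?D C)" for t C
    by (simp add: det_expansion_def scale_fun_def fun_eq_iff sum_distrib_left mult.assoc)
  obtain C0 where "?D C0 \<in> pluriharmonic_polynomials v TYPE('k1) TYPE('k2)" "?D C0 \<noteq> 0"
    by (rule ex_pluriharmonic_det_expansion[OF k]) (rule that)
  hence C0: "?D C0 \<in> H" "?D C0 \<noteq> 0" unfolding H_def by simp_all
  \<comment> \<open>Otherwise \<open>C0\<close> and the zero family would be two solutions with the
    same last coefficient, and uniqueness would make the expansion of \<open>C0\<close>
    zero.\<close>
  have last0: "C0 ?last \<noteq> 0"
  proof
    assume 0: "C0 ?last = 0"
    have D0: "?D (\<lambda>\<alpha>. 0) = 0" by (simp add: det_expansion_def fun_eq_iff)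
    have "?D C0 = ?D (\<lambda>\<alpha>. 0)"
      using unique[OF rel[OF C0(1)] rel[of "\<lambda>\<alpha>. 0"]] 0 D0 H_0 by (intro cong) simp
    thus False using D0 C0(2) by simp
  qed
  \<comment> \<open>Rescaling \<open>C0\<close> to the last coefficient of \<open>C\<close> gives a
    second solution, which uniqueness identifies with \<open>C\<close>.\<close>
  have suff: "?D C \<in> H" if "?S C" for C
  proof -
    let ?t = "C ?last / C0 ?last"
    have mem: "?D (\<lambda>\<alpha>. ?t * C0 \<alpha>) \<in> H" unfolding D_scale using C0(1) by (rule H_scale)
    have "?D C = ?D (\<lambda>\<alpha>. ?t * C0 \<alpha>)"
    proof (rule cong)
      fix \<alpha> assume \<alpha>: "\<alpha> \<in> exponents CARD('n) v"
      show "C \<alpha> = ?t * C0 \<alpha>"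
        by (rule unique[OF that rel[OF mem] _ \<alpha>]) (use last0 in simp)
    qed
    thus ?thesis using mem by simp
  qed
  have zero: "Q = 0" if "Q \<in> H" "Q (mat 1) (- mat 1) = 0" for Q
    using pluriharmonic_eq_0[OF k] that unfolding H_def by blast
  \<comment> \<open>Elements of \<open>H\<close> are not given as expansions, so they are compared
    with \<open>?D C0\<close> through their values at (1, -1).\<close>
  have multiple: "\<exists>c. Q = scale_fun c (?D C0)" if "Q \<in> H" for Q
  proof -
    define a where "a = ?D C0 (mat 1) (- mat 1)"
    have "a \<noteq> 0" using zero C0 by (auto simp: a_def)
    let ?c = "Q (mat 1) (- mat 1) / a"
    have "Q + scale_fun (- ?c) (?D C0) = 0"
      using \<open>a \<noteq> 0\<close> by (intro zero H_add that C0(1)) (simp add: scale_fun_def flip: a_def)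
    hence "Q = scale_fun ?c (?D C0)" by (simp add: eq_neg_iff_add_eq_0[symmetric] vs.scale_minus_left)
    thus ?thesis by blast
  qed
  have sub: "vs.subspace H"
    unfolding vs.subspace_def using H_0 H_scale H_add[where c = 1] by auto
  have "H = vs.span {?D C0}"
  proof
    show "H \<subseteq> vs.span {?D C0}" using multiple by (auto simp: vs.span_singleton)
    show "vs.span {?D C0} \<subseteq> H" using C0(1) sub by (intro vs.span_minimal) auto
  qed
  moreover have "vs.independent {?D C0}" using C0(2) by simp
  ultimately have "vs.dim H = 1"
    using vs.dim_eq_card[of "{?D C0}" H] by (simp add: vs.span_span)
  moreover have "\<forall>Q \<in> invariant_polynomials v. \<forall>C. Q = ?D C \<longrightarrow> ?S C \<longrightarrow> Q \<in> H"
    using suff by blast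
  moreover have "\<exists>Q\<^sub>0 \<in> H. Q\<^sub>0 \<noteq> 0 \<and> (\<forall>Q \<in> H. \<exists>c. Q = scale_fun c Q\<^sub>0)"
    using C0 multiple by blast
  ultimately show ?thesis
    using sub unique rel by blast
qed


end
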